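(* Let $l \in \{1,2,3\}$, $k \in \mathbb{N}_0$ and $\epsilon > 0$. Then there exist a natural number $q$ and a set $A \subset \mathbb{Z}_q$ such that \[A - A = \mathbb{Z}_q \quad\text{but}\quad |lA^2 + kA| < \epsilon q.\] Moreover, $q$ can be taken to be a product of distinct primes, and the smallest prime dividing $q$ can be taken to be arbitrarily large (i.e. for every $M$ one may choose $q$ so that all its prime factors exceed $M$).
   Context: $\mathbb{Z}_q$ denotes the integers modulo $q$. For $A \subset \mathbb{Z}_q$, $A - A = \{a - b : a,b \in A\}$ and \[lA^2 + kA = \{a_1a_2 + a_3a_4 + \dots + a_{2l-1}a_{2l} + a'_1 + \dots + a'_k : a_1,\dots,a_{2l},a'_1,\dots,a'_k \in A\}.\] *)

theory Defs
  imports Complex_Main "HOL-Number_Theory.Number_Theory"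
begin

definition difference_set :: "('a, 'b) ring_scheme \<Rightarrow> 'a set \<Rightarrow> 'a set" where
  "difference_set R A = {a \<ominus>\<^bsub>R\<^esub> b | a b. a \<in> A \<and> b \<in> A}"

text \<open>The set written \<open>lA\<^sup>2 + kA\<close>: sums of \<open>l\<close> products of two elements of \<open>A\<close> and
  of \<open>k\<close> further elements of \<open>A\<close>, repetitions allowed. Only the values of \<open>a\<close> on \<open>{1..2 * l}\<close>
  and of \<open>a'\<close> on \<open>{1..k}\<close> matter, and an empty sum is \<open>\<zero>\<close>.\<close>

definition quad_lin_sumset :: "('a, 'b) ring_scheme \<Rightarrow> nat \<Rightarrow> nat \<Rightarrow> 'a set \<Rightarrow> 'a set" where
  "quad_lin_sumset R l k A =
    {(\<Oplus>\<^bsub>R\<^esub>i\<in>{1..l}. a (2 * i - 1) \<otimes>\<^bsub>R\<^esub> a (2 * i)) \<oplus>\<^bsub>R\<^esub> (\<Oplus>\<^bsub>R\<^esub>j\<in>{1..k}. a' j) | a a'.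
      a \<in> {1..2 * l} \<rightarrow> A \<and> a' \<in> {1..k} \<rightarrow> A}"

end

theory Submission
  imports Defs "HOL-Analysis.Kronecker_Approximation_Theorem" "HOL-Analysis.Harmonic_Numbers" "HOL-Real_Asymp.Real_Asymp"
begin

text \<open>
  For every difference \<open>d\<close> one puts two elements \<open>x\<close>, \<open>y\<close> with \<open>x - y = d\<close> into \<open>A\<close>, prescribed
  modulo each prime separately, following Haight and Ruzsa. The primes come in successive blocks. Modulo
  a prime of a new block the pair may depend on the class of \<open>d\<close> modulo the product \<open>q\<close> of the earlier
  primes. There are only finitely many ways to fill the slots of \<open>lA\<^sup>2 + kA\<close> with such classes, and each
  of them gets its own set of new primes \<open>p\<close>, modulo which the pairs are chosen so that the expression
  avoids one residue. As \<open>\<Sum>1/p\<close> diverges, this leaves few values, except for tuples of differences that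
  split into more classes modulo the new product than modulo \<open>q\<close>. The number of classes is at most the number of slots, so
  finitely many blocks suffice.

  Avoiding a residue modulo a large \<open>p\<close> is a game on a multigraph with at most three edges (the
  products), whose vertices are the two elements of each class. If no edge joins two classes that
  are touched at both of their vertices, the value of the expression can be steered close to \<open>0\<close> modulo
  \<open>p\<close>. The remaining graphs are treated one by one, mostly by making the expression constant or a
  quadratic polynomial in one variable; one of them needs a strategy based on quadratic residues.
\<close>

section \<open>Residues close to multiples of the modulus\<close>

text \<open>Every class fixes its pairs knowing its own difference D but not the differences of the
  other classes, while the value is a polynomial in all of them. Hence a steering class may use only
  moves from a finite set independent of \<open>p\<close>: products of two moves are then negligible
  against \<open>p\<close>. The numbers that multiply these moves belong to other classes, which
  must bring them close to prescribed multiples of \<open>p\<close> without knowing the moves. An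
  edge between two classes that both have to supply such multipliers is the first obstacle. The
  second is an expression u * x + v * y in the two numbers of one class with u + v = 0: it is a
  multiple of D, and no choice changes it. This is behind the shift in \<open>loop_and_leaf\<close>
  and the strategy with quadratic residues. Classes are taken modulo the earlier product because
  only then there are finitely many fillings. The price is that two slots of one class may carry
  different differences modulo a new prime, although a strategy answers once per class; this is
  exactly the case left to the next block.\<close>

definition near :: "int \<Rightarrow> real \<Rightarrow> int \<Rightarrow> bool" where
  "near p \<epsilon> t \<longleftrightarrow> (\<exists>k. \<bar>real_of_int (t - p * k)\<bar> \<le> \<epsilon> * real_of_int p)"

lemma nearI: "\<bar>real_of_int (t - p * k)\<bar> \<le> \<epsilon> * real_of_int p \<Longrightarrow> near p \<epsilon> t"
  unfolding near_def by blast

lemma near_cong: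
  assumes "[s = t] (mod p)" shows "near p \<epsilon> s \<longleftrightarrow> near p \<epsilon> t"
proof -
  have *: "near p \<epsilon> t" if c: "[s = t] (mod p)" and n: "near p \<epsilon> s" for s t
  proof -
    obtain k where k: "\<bar>real_of_int (s - p * k)\<bar> \<le> \<epsilon> * real_of_int p" using n near_def by auto
    obtain d where d: "t = s + p * d" using c by (metis cong_iff_lin mult.commute)
    have "t - p * (k + d) = s - p * k" unfolding d by (simp add: algebra_simps)
    then show ?thesis using k nearI by metis
  qed
  show ?thesis using *[OF assms] *[OF cong_sym[OF assms]] by blast
qed

lemma near_add: "near p \<epsilon> s \<Longrightarrow> near p \<delta> t \<Longrightarrow> near p (\<epsilon> + \<delta>) (s + t)"
proof -
  assume "near p \<epsilon> s" "near p \<delta> t"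
  then obtain k l where "\<bar>real_of_int (s - p * k)\<bar> \<le> \<epsilon> * p" "\<bar>real_of_int (t - p * l)\<bar> \<le> \<delta> * p"
    unfolding near_def by auto
  then have "\<bar>real_of_int (s + t - p * (k + l))\<bar> \<le> (\<epsilon> + \<delta>) * p" by (simp add: algebra_simps)
  then show ?thesis by (rule nearI)
qed

lemma near_mono: "near p \<epsilon> t \<Longrightarrow> \<epsilon> \<le> \<delta> \<Longrightarrow> p \<ge> 0 \<Longrightarrow> near p \<delta> t"
  unfolding near_def by (meson mult_right_mono of_int_0_le_iff order_trans)

lemma near_mult:
  assumes "near p \<epsilon> t" shows "near p (\<bar>real_of_int j\<bar> * \<epsilon>) (j * t)"
proof -
  obtain k where k: "\<bar>real_of_int (t - p * k)\<bar> \<le> \<epsilon> * p" using assms near_def by auto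
  have "j * t - p * (j * k) = j * (t - p * k)" by (simp add: algebra_simps)
  then have "\<bar>real_of_int (j * t - p * (j * k))\<bar> = \<bar>real_of_int j\<bar> * \<bar>real_of_int (t - p * k)\<bar>"
    by (metis abs_mult of_int_mult)
  also have "\<dots> \<le> \<bar>real_of_int j\<bar> * (\<epsilon> * p)" using k by (rule mult_left_mono) simp
  finally show ?thesis by (intro nearI[of _ _ "j * k"]) (simp add: mult.assoc)
qed

lemma near_sum:
  assumes "finite A" "\<And>x. x \<in> A \<Longrightarrow> near p (e x) (f x)"
  shows "near p (\<Sum>x\<in>A. e x) (\<Sum>x\<in>A. f x)"
  using assms by (induction A rule: finite_induct) (auto intro: near_add nearI[of _ _ 0])

lemma near_bounded: "\<bar>real_of_int t\<bar> \<le> \<epsilon> * p \<Longrightarrow> near p \<epsilon> t"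
  by (rule nearI[of _ _ 0]) simp

text \<open>The residue \<open>p div 2\<close> lies about half a period away from the multiples of
  \<open>p\<close>, so a strategy that aims at 0 leaves it out.\<close>

lemma near_avoids_half:
  assumes "near p \<epsilon> t" "\<epsilon> < 1/4" "p > 4"
  shows "\<not> [t = p div 2] (mod p)"
proof
  assume c: "[t = p div 2] (mod p)"
  have "near p \<epsilon> (p div 2)" using assms(1) near_cong[OF c] by simp
  then obtain k where k: "\<bar>real_of_int (p div 2 - p * k)\<bar> \<le> \<epsilon> * p" by (auto simp: near_def)
  have "\<epsilon> * p < real_of_int p / 4" using assms(2,3) by simp
  moreover define z where "z = p div 2 - p * k"
  ultimately have "real_of_int \<bar>4 * z\<bar> < real_of_int p" using k[folded z_def] by simp
  then have "real_of_int \<bar>4 * (p div 2 - p * k)\<bar> < real_of_int p" unfolding z_def .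
  then have **: "\<bar>4 * (p div 2 - p * k)\<bar> < p" unfolding of_int_less_iff .
  then have b: "4 * (p div 2) < p + 4 * (p * k)" "4 * (p * k) < p + 4 * (p div 2)" by (auto simp: abs_less_iff algebra_simps)
  show False
  proof (cases "k \<le> 0")
    case True
    then have "p * k \<le> 0" using assms(3) by (simp add: mult_le_0_iff)
    moreover have "2 * (p div 2) \<ge> p - 1" by linarith
    ultimately show False using b assms(3) by linarith
  next
    case False
    then have "p * k \<ge> p * 1" using assms(3) by (intro mult_left_mono) auto
    moreover have "2 * (p div 2) \<le> p" by linarith
    ultimately show False using b assms(3) by linarith
  qed
qed

text \<open>While \<open>x\<close> crosses an interval of length \<open>\<delta> * p\<close>, the
  product \<open>M * x\<close> covers at least two periods of \<open>p\<close>, so it meets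
  \<open>\<tau>\<close> modulo \<open>p\<close> with almost half of the interval to spare, and it
  stays close on a short subinterval behind the meeting point. The bound \<open>Mmax\<close> allows
  \<open>\<delta>'\<close> and \<open>p0\<close> to be fixed before \<open>M\<close> is
  known.\<close>

lemma one_digit:
  fixes \<delta> \<epsilon> :: real and Mmax :: nat
  assumes "\<delta> > 0" "\<epsilon> > 0"
  shows "\<exists>\<delta>'>0. \<exists>p0. \<forall>p\<ge>p0. \<forall>(M::nat) (a::real) (\<tau>::int).
     M > 0 \<and> M \<le> Mmax \<and> real M * \<delta> \<ge> 2 \<longrightarrow>
     (\<exists>a'::real. a \<le> a' \<and> a' + \<delta>' * real_of_int p \<le> a + \<delta> * real_of_int p \<and>
        (\<forall>x::int. a' \<le> x \<and> x \<le> a' + \<delta>' * real_of_int p \<longrightarrow> near p \<epsilon> (int M * x - \<tau>)))"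
proof -
  \<comment> \<open>The meeting point lies at most \<open>\<delta> / 2 * p + 1\<close> from the left
    end, so a length of \<open>\<delta> / 4 * p\<close> still fits. On a stretch of length
    \<open>\<delta>' * p\<close> the product \<open>M * x\<close> grows by at most
    \<open>\<epsilon> / 2 * p\<close>; the bounds in \<open>p0\<close> absorb the rounding errors
    \<open>M\<close> and 1.\<close>
  define \<delta>' where "\<delta>' = min (\<epsilon> / (2 * (real Mmax + 1))) (\<delta> / 4)"
  define p0 where "p0 = max 1 (max \<lceil>2 * real Mmax / \<epsilon>\<rceil> \<lceil>4 / \<delta>\<rceil>)"
  have d: "\<delta>' > 0" "\<delta>' \<le> \<epsilon> / (2 * (real Mmax + 1))" "\<delta>' \<le> \<delta> / 4"
    unfolding \<delta>'_def using assms min.cobounded2[of _ "\<delta> / 4"] by auto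
  have "\<exists>a'::real. a \<le> a' \<and> a' + \<delta>' * p \<le> a + \<delta> * p \<and>
        (\<forall>x::int. a' \<le> x \<and> x \<le> a' + \<delta>' * p \<longrightarrow> near p \<epsilon> (int M * x - \<tau>))"
    if p: "p \<ge> p0" and M: "M > 0" "M \<le> Mmax" "real M * \<delta> \<ge> 2" for p :: int and M a \<tau>
  proof -
    have "real_of_int p \<ge> real_of_int \<lceil>2 * real Mmax / \<epsilon>\<rceil>" "real_of_int p \<ge> real_of_int \<lceil>4 / \<delta>\<rceil>" and p1: "p \<ge> 1"
      using p unfolding p0_def by linarith+
    then have "real_of_int p \<ge> 2 * real Mmax / \<epsilon>" "real_of_int p \<ge> 4 / \<delta>" by linarith+
    then have pe: "\<epsilon> * p \<ge> 2 * real Mmax" and pd: "\<delta> * p \<ge> 4" using assms by (simp_all add: field_simps)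
    define k where "k = \<lceil>(M * a - \<tau>) / p\<rceil>"
    define a' where "a' = real_of_int \<lceil>(\<tau> + p * k) / M\<rceil>"
    have k1: "real_of_int k \<ge> (M * a - \<tau>) / p" "real_of_int k < (M * a - \<tau>) / p + 1" unfolding k_def by linarith+
    have k2: "real_of_int (p * k) \<ge> M * a - \<tau>" "real_of_int (p * k) < M * a - \<tau> + p"
      using k1 p1 by (simp_all add: field_simps)
    have a1: "a' \<ge> (\<tau> + p * k) / M" "a' < (\<tau> + p * k) / M + 1" unfolding a'_def by linarith+
    have M0: "real M > 0" using M by simp
    have A: "a' \<ge> a" using a1(1) k2(1) M0 by (smt (verit, best) divide_right_mono mult.commute nonzero_mult_div_cancel_right of_int_add)
    have a2: "M * a' \<ge> \<tau> + p * k" "M * a' < \<tau> + p * k + M" using a1 M0 by (simp_all add: field_simps)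
    have "M * a' < M * a + p + M" using a2 k2 by linarith
    also have "\<dots> \<le> M * a + M * \<delta> / 2 * p + M" using M(3) p1 mult_right_mono[of 2 "M * \<delta>" "p"] by simp
    finally have "M * a' < M * (a + \<delta> / 2 * p + 1)" by (simp add: algebra_simps)
    then have "a' < a + \<delta> / 2 * p + 1" using M0 by simp
    moreover have "\<delta>' * p \<le> \<delta> / 4 * p" using d p1 by (intro mult_right_mono) auto
    ultimately have B: "a' + \<delta>' * p \<le> a + \<delta> * p" using pd by simp
    have "near p \<epsilon> (int M * x - \<tau>)" if x: "a' \<le> real_of_int x" "x \<le> a' + \<delta>' * p" for x
    proof (rule nearI[of _ _ k])
      have l: "real_of_int (int M * x - \<tau> - p * k) \<ge> 0" using a2(1) mult_left_mono[OF x(1), of "real M"] by simp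
      have "real M * real_of_int x \<le> M * (a' + \<delta>' * p)" using x(2) M0 by (intro mult_left_mono) auto
      also have "\<dots> \<le> \<tau> + p * k + M + M * (\<delta>' * p)" using a2(2) by (simp add: distrib_left)
      finally have u: "real_of_int (int M * x - \<tau> - p * k) \<le> M + M * (\<delta>' * p)" by simp
      have "M * \<delta>' \<le> Mmax * \<delta>'" using M d by (intro mult_right_mono) auto
      also have "\<dots> \<le> Mmax * (\<epsilon> / (2 * (real Mmax + 1)))" using d by (intro mult_left_mono) auto
      also have "\<dots> \<le> \<epsilon> / 2" using assms by (simp add: field_simps)
      finally have "M * \<delta>' * p \<le> \<epsilon> / 2 * p" using p1 by (intro mult_right_mono) auto
      with u have "real_of_int (int M * x - \<tau> - p * k) \<le> M + \<epsilon> / 2 * p" by (simp add: mult.assoc)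
      also have "\<dots> \<le> \<epsilon> * p" using pe M(2) by simp
      finally show "\<bar>real_of_int (int M * x - \<tau> - p * k)\<bar> \<le> \<epsilon> * p" using l by simp
    qed
    then show ?thesis using A B by blast
  qed
  then show ?thesis using d(1) by blast
qed

text \<open>\<open>K\<close> is an argument and not a witness, so that one choice of multipliers
  serves all bounded factors \<open>\<sigma>\<close> and targets \<open>\<tau>\<close>, which become
  known only when a class moves. An interval is returned instead of a point to leave room for
  further conditions.\<close>

definition controls :: "'c set \<Rightarrow> nat \<Rightarrow> real \<Rightarrow> real \<Rightarrow> ('c \<Rightarrow> nat) \<Rightarrow> real \<Rightarrow> int \<Rightarrow> bool" where
  "controls Q S \<epsilon> \<delta> K \<delta>' p \<longleftrightarrow> (\<forall>(\<sigma>::'c \<Rightarrow> nat) (a::real) (\<tau>::'c \<Rightarrow> int). (\<forall>c\<in>Q. \<sigma> c > 0 \<and> \<sigma> c \<le> S) \<longrightarrow>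
     (\<exists>a'::real. a \<le> a' \<and> a' + \<delta>' * real_of_int p \<le> a + \<delta> * real_of_int p \<and>
        (\<forall>x::int. a' \<le> x \<and> x \<le> a' + \<delta>' * real_of_int p \<longrightarrow> (\<forall>c\<in>Q. near p \<epsilon> (int (K c) * int (\<sigma> c) * x - \<tau> c)))))"

lemma controlsE:
  assumes "controls Q S \<epsilon> \<delta> K \<delta>' p" "\<forall>c\<in>Q. \<sigma> c > 0 \<and> \<sigma> c \<le> S"
  obtains a' :: real where "a \<le> a'" "a' + \<delta>' * real_of_int p \<le> a + \<delta> * real_of_int p"
    "\<And>x::int. a' \<le> x \<Longrightarrow> x \<le> a' + \<delta>' * real_of_int p \<Longrightarrow> \<forall>c\<in>Q. near p \<epsilon> (int (K c) * int (\<sigma> c) * x - \<tau> c)"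
  using assms(1)[unfolded controls_def, rule_format, of \<sigma> a \<tau>] assms(2) by blast

text \<open>One \<open>x\<close> satisfies all the conditions at once, because each new \<open>K c\<close> reads off a finer digit of \<open>x / p\<close>.\<close>

lemma digits:
  fixes \<delta> \<epsilon> :: real and S :: nat
  assumes "finite Q" "\<delta> > 0" "\<epsilon> > 0"
  shows "\<exists>K::'c \<Rightarrow> nat. (\<forall>c. K c > 0) \<and> (\<exists>\<delta>'>0. \<forall>\<^sub>F p in at_top. controls Q S \<epsilon> \<delta> K \<delta>' p)"
  using assms(1)
proof (induction Q rule: finite_induct)
  case empty
  have "controls {} S \<epsilon> \<delta> (\<lambda>_::'c. 1) \<delta> p" for p
    unfolding controls_def by (intro allI impI, rule_tac x = a in exI) simp
  then show ?case using assms(2) by (intro exI[of _ "\<lambda>_. 1"] conjI exI[of _ \<delta>]) simp_all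
next
  case (insert c Q)
  then obtain K \<delta>1 where K: "\<forall>c. K c > 0" and d1: "\<delta>1 > 0" and 1: "\<forall>\<^sub>F p in at_top. controls Q S \<epsilon> \<delta> K \<delta>1 p"
    by (elim exE conjE)
  \<comment> \<open>With \<open>k * \<delta>1 \<ge> 2\<close> the product
    \<open>k * \<sigma> c * x\<close> still makes two periods inside the interval left by the
    earlier conditions, whatever the positive factor \<open>\<sigma> c\<close> is.\<close>
  define k where "k = nat \<lceil>2 / \<delta>1\<rceil> + 1"
  have k: "k > 0" "real k * \<delta>1 \<ge> 2"
  proof -
    have "real k \<ge> 2 / \<delta>1" unfolding k_def using d1 by linarith
    then show "real k * \<delta>1 \<ge> 2" using d1 by (simp add: field_simps)
  qed (simp add: k_def)
  obtain \<delta>2 p2 where d2: "\<delta>2 > 0" and 2: "\<forall>p\<ge>p2. \<forall>(M::nat) (a::real) (\<tau>::int).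
     M > 0 \<and> M \<le> k * S \<and> real M * \<delta>1 \<ge> 2 \<longrightarrow>
     (\<exists>a'::real. a \<le> a' \<and> a' + \<delta>2 * real_of_int p \<le> a + \<delta>1 * real_of_int p \<and>
        (\<forall>x::int. a' \<le> x \<and> x \<le> a' + \<delta>2 * real_of_int p \<longrightarrow> near p \<epsilon> (int M * x - \<tau>)))"
    using one_digit[OF d1 assms(3), of "k * S"] by (elim exE conjE)
  define K' where "K' = K(c := k)"
  have "controls (insert c Q) S \<epsilon> \<delta> K' \<delta>2 p" if p: "p \<ge> p2" "p \<ge> 0" "controls Q S \<epsilon> \<delta> K \<delta>1 p" for p
    unfolding controls_def
  proof (intro allI impI)
    fix \<sigma> :: "'c \<Rightarrow> nat" and a :: real and \<tau> assume s: "\<forall>c\<in>insert c Q. \<sigma> c > 0 \<and> \<sigma> c \<le> S"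
    obtain a1 :: real where a1: "a \<le> a1" "a1 + \<delta>1 * real_of_int p \<le> a + \<delta> * real_of_int p"
        "\<And>x::int. a1 \<le> x \<Longrightarrow> x \<le> a1 + \<delta>1 * real_of_int p \<Longrightarrow> (\<forall>c\<in>Q. near p \<epsilon> (int (K c) * int (\<sigma> c) * x - \<tau> c))"
      using controlsE[OF p(3), of \<sigma> a \<tau>] s by auto
    have "real k * 1 \<le> real k * real (\<sigma> c)" using s by (intro mult_left_mono) auto
    then have "real (k * \<sigma> c) * \<delta>1 \<ge> real k * \<delta>1" using d1 by (intro mult_right_mono) auto
    then have s2: "real (k * \<sigma> c) * \<delta>1 \<ge> 2" using k by linarith
    obtain a2 :: real where a2: "a1 \<le> a2" "a2 + \<delta>2 * real_of_int p \<le> a1 + \<delta>1 * real_of_int p"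
        "\<And>x::int. a2 \<le> x \<and> x \<le> a2 + \<delta>2 * real_of_int p \<Longrightarrow> near p \<epsilon> (int (k * \<sigma> c) * x - \<tau> c)"
      using 2[rule_format, of p "k * \<sigma> c" a1 "\<tau> c"] p s s2 k by auto
    have "near p \<epsilon> (int (K' c') * int (\<sigma> c') * x - \<tau> c')" if "a2 \<le> real_of_int x \<and> x \<le> a2 + \<delta>2 * p" "c' \<in> insert c Q" for x c'
      using a2(3)[OF that(1)] a1(3)[of x] that a2(1,2) insert.hyps by (auto simp: K'_def)
    then show "\<exists>a'::real. a \<le> a' \<and> a' + \<delta>2 * real_of_int p \<le> a + \<delta> * real_of_int p \<and>
        (\<forall>x::int. a' \<le> x \<and> x \<le> a' + \<delta>2 * real_of_int p \<longrightarrow> (\<forall>c\<in>insert c Q. near p \<epsilon> (int (K' c) * int (\<sigma> c) * x - \<tau> c)))"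
      using a1 a2 by (intro exI[of _ a2]) auto
  qed
  then have "\<forall>\<^sub>F p in at_top. controls (insert c Q) S \<epsilon> \<delta> K' \<delta>2 p"
    by (rule eventually_mono[OF eventually_conj[OF 1 eventually_conj[OF eventually_ge_at_top[of p2] eventually_ge_at_top[of 0]]]]) blast+
  moreover have "\<forall>c. K' c > 0" using K k by (simp add: K'_def)
  ultimately show ?case using d2 by (intro exI[of _ K'] conjI exI[of _ \<delta>2])
qed

text \<open>Dirichlet's theorem supplies a step \<open>r\<close>, at most a small multiple of
  \<open>sqrt p\<close>, for which \<open>r * b\<close> differs from a multiple of \<open>p\<close>
  by \<open>e = O(sqrt p)\<close>. Along the multiples of \<open>r\<close>, with the right sign, the
  expression is congruent to \<open>f v + c\<close>, where \<open>f\<close> is nondecreasing with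
  increments of at most \<open>\<epsilon> * p\<close> until it passes the target, so it comes close
  to 0. Because \<open>w\<close> is so small, the solution can be placed inside a given long
  interval.\<close>

lemma quadratic_near_zero:
  fixes \<epsilon> :: real and m :: nat
  assumes "\<epsilon> > 0" "m > 0"
  shows "\<exists>p0. \<forall>p\<ge>p0. \<forall>b c. \<exists>w::int. \<bar>real_of_int w\<bar> \<le> 2 * sqrt (real_of_int p) \<and> near p \<epsilon> (int m * w^2 + b * w + c)"
proof -
  define \<eta> where "\<eta> = min \<epsilon> 1"
  have eta: "0 < \<eta>" "\<eta> \<le> \<epsilon>" "\<eta> \<le> 1" using assms by (auto simp: \<eta>_def)
  \<comment> \<open>An increment of \<open>f\<close> is at most
    \<open>6 * (m * \<kappa>) * p + sqrt p / \<kappa>\<close>. The factor 16 puts the first term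
    below \<open>\<eta> / 2 * p\<close>, and the first nontrivial bound in \<open>p0\<close> does so
    for the second; the other one makes \<open>\<kappa> * sqrt p\<close> at least 1, so that
    rounding it up to \<open>N\<close> at most doubles it. Capping \<open>\<eta>\<close> at 1 keeps
    \<open>r\<close> below \<open>sqrt p\<close>.\<close>
  define \<kappa> where "\<kappa> = \<eta> / (16 * m)"
  have kappa: "\<kappa> > 0" "\<kappa> \<le> 1/16" "m * \<kappa> = \<eta> / 16" using eta assms by (auto simp: \<kappa>_def field_simps)
  define p0 where "p0 = max 1 (max \<lceil>(2 / (\<kappa> * \<eta>))^2\<rceil> \<lceil>(1 / \<kappa>)^2\<rceil>)"
  have "\<exists>w::int. \<bar>real_of_int w\<bar> \<le> 2 * sqrt p \<and> near p \<epsilon> (int m * w^2 + b * w + c)" if p: "p \<ge> p0" for p b c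
  proof -
    have p1: "p \<ge> 1" using p p0_def by simp
    have "real_of_int p \<ge> \<lceil>(2 / (\<kappa> * \<eta>))^2\<rceil>" "real_of_int p \<ge> \<lceil>(1 / \<kappa>)^2\<rceil>" using p p0_def by linarith+
    then have "real_of_int p \<ge> (2 / (\<kappa> * \<eta>))^2" "real_of_int p \<ge> (1 / \<kappa>)^2" by linarith+
    then have s: "sqrt p \<ge> 2 / (\<kappa> * \<eta>)" "sqrt p \<ge> 1 / \<kappa>" by (auto intro: real_le_rsqrt)
    then have s': "\<kappa> * sqrt p \<ge> 1" "\<eta> * sqrt p \<ge> 2 / \<kappa>" using kappa eta by (simp_all add: field_simps)
    define s where "s = sqrt p"
    have s2: "s * s = p" "s > 0" unfolding s_def using p1 by auto
    define N where "N = nat \<lceil>\<kappa> * s\<rceil>"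
    have N: "real N \<ge> \<kappa> * s" "real N \<le> 2 * (\<kappa> * s)" "N > 0" unfolding N_def using s'(1)[folded s_def] by linarith+
    obtain h r where r: "0 < r" "r \<le> int N" "\<bar>of_int r * (b / p) - of_int h\<bar> < 1 / N"
      using Dirichlet_approx[OF N(3)] by blast
    define e where "e = r * b - h * p"
    have "\<bar>real_of_int e\<bar> = p * \<bar>of_int r * (b / p) - of_int h\<bar>"
    proof -
      have "real_of_int e = p * (of_int r * (b / p) - of_int h)" using p1 by (simp add: e_def field_simps)
      then show ?thesis using p1 by (simp add: abs_mult)
    qed
    also have "\<dots> \<le> p * (1 / N)" using r(3) p1 by (intro mult_left_mono) auto
    also have "\<dots> \<le> p * (1 / (\<kappa> * s))" using N kappa s2 p1 by (intro mult_left_mono divide_left_mono) auto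
    also have "\<dots> = s / \<kappa>" using s2 kappa p1 by (simp add: field_simps)
    finally have e: "\<bar>real_of_int e\<bar> \<le> s / \<kappa>" .
    define T where "T = (- c) mod p"
    have T: "0 \<le> T" "T < p" using p1 by (simp_all add: T_def)
    define f :: "nat \<Rightarrow> int" where "f v = int m * (r * v)^2 + \<bar>e\<bar> * v" for v
    have "f (nat p) \<ge> T"
    proof -
      have "r * p \<ge> 1 * p" using r(1) p1 by (intro mult_right_mono) auto
      then have "(r * p) * (r * p) \<ge> p * 1" using p1 by (intro mult_mono) linarith+
      then have "(r * p)^2 \<ge> p" by (simp add: power2_eq_square)
      moreover have "int m * (r * p)^2 \<ge> 1 * (r*p)^2" using assms by (intro mult_right_mono) auto
      moreover have "\<bar>e\<bar> * p \<ge> 0" using p1 by simp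
      moreover have "f (nat p) = int m * (r * p)^2 + \<bar>e\<bar> * p" using p1 by (simp add: f_def)
      ultimately show ?thesis using T by linarith
    qed
    define v where "v = (LEAST v. f v \<ge> T)"
    have v: "f v \<ge> T" unfolding v_def using \<open>f (nat p) \<ge> T\<close> by (rule LeastI)
    have main: "real_of_int (f v - T) \<le> \<epsilon> * p \<and> real_of_int r * v \<le> 2 * s"
    proof (cases v)
      case 0
      then show ?thesis using v T s2 eta p1 by (simp add: f_def)
    next
      case (Suc v')
      have lt: "f v' < T" using not_less_Least[of v' "\<lambda>v. f v \<ge> T"] Suc v_def by simp
      have "(r * v')^2 \<le> int m * (r * v')^2" using assms mult_right_mono[of 1 "int m" "(r * v')^2"] by simp
      also have "\<dots> \<le> f v'" by (simp add: f_def)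
      finally have "(r * v')^2 \<le> p" using lt T by linarith
      then have "real_of_int ((r * v')^2) \<le> p" by linarith
      then have "(real_of_int r * v')^2 \<le> s^2" using s2 by (simp add: power2_eq_square)
      then have rv: "real_of_int r * v' \<le> s" by (rule power2_le_imp_le) (use s2 in simp)
      have rN: "real_of_int r \<le> 2 * (\<kappa> * s)" using r(2) N(2) by linarith
      have "\<kappa> * s \<le> s / 2" using kappa s2 by simp
      then have A: "real_of_int r * v \<le> 2 * s" using rv rN Suc by (simp add: algebra_simps)
      have "f v - T \<le> f v - f v'" using lt by simp
      also have "\<dots> = int m * r * (2 * (r * v') + r) + \<bar>e\<bar>" unfolding f_def Suc by (simp add: power2_eq_square algebra_simps)
      finally have "real_of_int (f v - T) \<le> real_of_int (int m * r * (2 * (r * v') + r) + \<bar>e\<bar>)" by linarith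
      also have "\<dots> = m * real_of_int r * (2 * (real_of_int r * v') + r) + \<bar>real_of_int e\<bar>" by simp
      also have "\<dots> \<le> m * (2 * (\<kappa> * s)) * (2 * s + s) + s / \<kappa>"
      proof -
        have "2 * (real_of_int r * v') + r \<le> 2 * s + s" using rv rN \<open>\<kappa> * s \<le> s / 2\<close> by linarith
        then have "m * real_of_int r * (2 * (real_of_int r * v') + r) \<le> m * (2 * (\<kappa> * s)) * (2 * s + s)"
          using rN r(1) s2 kappa by (intro mult_mono) auto
        then show ?thesis using e by linarith
      qed
      also have "\<dots> = 6 * (m * \<kappa>) * p + s / \<kappa>" using s2(1)[symmetric] by simp
      also have "\<dots> \<le> \<eta> / 2 * p + \<eta> / 2 * p"
      proof -
        have "6 * (m * \<kappa>) * p \<le> \<eta> / 2 * p" using kappa(3) eta p1 by (intro mult_right_mono) auto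
        moreover have "s / \<kappa> \<le> \<eta> / 2 * p"
        proof -
          have "s / \<kappa> = s * (2 / \<kappa>) / 2" by simp
          also have "\<dots> \<le> s * (\<eta> * s) / 2"
            using s'(2) s2 s_def by (intro divide_right_mono mult_left_mono) auto
          also have "\<dots> = \<eta> / 2 * p" using s2 by (simp add: algebra_simps)
          finally show ?thesis .
        qed
        ultimately show ?thesis by (rule add_mono)
      qed
      also have "\<dots> = \<eta> * p" by simp
      also have "\<dots> \<le> \<epsilon> * p" using eta p1 by (intro mult_right_mono) auto
      finally show ?thesis using A by simp
    qed
    \<comment> \<open>The sign of \<open>e\<close> is moved into \<open>w\<close>: in both cases
      \<open>b * w\<close> is congruent to \<open>\<bar>e\<bar> * v\<close>, and \<open>w^2\<close>
      is not affected.\<close>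
    define w where "w = (if e \<ge> 0 then r * v else - (r * int v))"
    have w: "\<bar>real_of_int w\<bar> \<le> 2 * s" using main r(1) by (auto simp: w_def abs_mult)
    have "\<exists>t. b * w = \<bar>e\<bar> * v + p * t"
    proof (cases "e \<ge> 0")
      case True
      then show ?thesis unfolding w_def e_def by (intro exI[of _ "h * v"]) (simp add: algebra_simps)
    next
      case False
      then show ?thesis unfolding w_def e_def by (intro exI[of _ "- h * v"]) (simp add: algebra_simps)
    qed
    then obtain t where t: "b * w = \<bar>e\<bar> * v + p * t" by blast
    have "w^2 = (r * v)^2" by (simp add: w_def)
    have "c = - T + p * (- ((- c) div p))" using mult_div_mod_eq[of p "-c"] unfolding T_def by (simp only: mult_minus_right)
    then have "int m * w^2 + b * w + c = (f v - T) + p * (t - ((- c) div p))"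
      unfolding t \<open>w^2 = (r * v)^2\<close> f_def by (simp add: algebra_simps)
    then have "int m * w^2 + b * w + c - p * (t - ((- c) div p)) = f v - T" by simp
    then have "near p \<epsilon> (int m * w^2 + b * w + c)"
      using main v by (intro nearI[of _ _ "t - ((- c) div p)"]) simp
    then show ?thesis using w s_def by blast
  qed
  then show ?thesis by blast
qed

section \<open>Strategies\<close>

text \<open>A strategy for a class \<open>c\<close> of differences is a set of functions \<open>f\<close>; \<open>f True\<close> and \<open>f False\<close> are the
  residues modulo \<open>p\<close> of the two elements of \<open>A\<close> with difference \<open>D\<close>.\<close>

definition cover :: "int \<Rightarrow> (bool \<Rightarrow> int) set \<Rightarrow> bool" where
  "cover p S \<longleftrightarrow> (\<forall>D. \<exists>f\<in>S. [f True - f False = D] (mod p))"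

text \<open>The sets \<open>S c\<close> are fixed in advance and every combination of their members
  counts: each class answers its own difference without seeing the others.\<close>

definition avoidable :: "int \<Rightarrow> (('c \<Rightarrow> bool \<Rightarrow> int) \<Rightarrow> int) \<Rightarrow> bool" where
  "avoidable p F \<longleftrightarrow> (\<exists>S s. (\<forall>c. cover p (S c)) \<and> (\<forall>g. (\<forall>c. g c \<in> S c) \<longrightarrow> \<not> [F g = s] (mod p)))"

definition nearable :: "int \<Rightarrow> real \<Rightarrow> (('c \<Rightarrow> bool \<Rightarrow> int) \<Rightarrow> int) \<Rightarrow> bool" where
  "nearable p \<epsilon> F \<longleftrightarrow> (\<exists>S. (\<forall>c. cover p (S c)) \<and> (\<forall>g. (\<forall>c. g c \<in> S c) \<longrightarrow> near p \<epsilon> (F g)))"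

lemma nearable_avoidable:
  assumes "nearable p \<epsilon> F" "\<epsilon> < 1/4" "p > 4"
  shows "avoidable p (\<lambda>g. F g + t)"
proof -
  obtain S where S: "\<And>c. cover p (S c)" "\<And>g. (\<forall>c. g c \<in> S c) \<Longrightarrow> near p \<epsilon> (F g)"
    using assms(1) unfolding nearable_def by blast
  have "\<not> [F g + t = p div 2 + t] (mod p)" if "\<forall>c. g c \<in> S c" for g
    using near_avoids_half[OF S(2)[OF that] assms(2,3)] by (simp add: cong_add_rcancel)
  then show ?thesis using S(1) unfolding avoidable_def by blast
qed

text \<open>Steps of length \<open>p div N\<close> come within one step of every residue. As
  \<open>p \<ge> N * N\<close>, the remainder \<open>p mod N\<close> is shorter than a step, so
  \<open>N\<close> steps are enough to go once around.\<close>

lemma demand_digit: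
  fixes p r N :: int
  assumes "N > 0" "p \<ge> N * N"
  shows "\<exists>j. 0 \<le> j \<and> j \<le> N \<and> near p (1 / N) (r + j * (p div N))"
proof -
  define m where "m = p div N"
  have m: "m \<ge> N" unfolding m_def using assms by (simp add: zdiv_mono1[of "N*N" p N, simplified])
  have p0: "p > 0" using assms by (smt (verit) mult_pos_pos)
  define r0 where "r0 = (- r) mod p"
  define j where "j = r0 div m"
  have r0: "0 \<le> r0" "r0 < p" using p0 by (simp_all add: r0_def)
  have "p = m * N + p mod N" by (simp add: m_def)
  moreover have "p mod N < N" using assms by simp
  ultimately have "p < m * N + m" using m by linarith
  then have "r0 < m * (N + 1)" using r0 by (simp add: algebra_simps)
  have e: "r0 - j * m = r0 mod m" unfolding j_def by (simp add: minus_div_mult_eq_mod)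
  have rm: "0 \<le> r0 mod m" "r0 mod m < m" using m assms(1) by auto
  have "j * m \<le> r0" using e rm by linarith
  also have "r0 < (N + 1) * m" using \<open>r0 < m * (N + 1)\<close> by (simp only: mult.commute[of "N + 1" m])
  finally have "j * m < (N + 1) * m" .
  then have jN: "j < N + 1" using m assms(1) by (simp only: mult_less_cancel_right)
  have j0: "0 \<le> j" unfolding j_def using r0 m assms(1) by (simp add: pos_imp_zdiv_nonneg_iff)
  have "r + r0 = p * (- ((- r) div p))" unfolding r0_def using mult_div_mod_eq[of p "- r"] by (simp only: mult_minus_right)
  then have "r + j * m - (- (r0 mod m)) = p * (- ((- r) div p))" using e by linarith
  then have "[r + j * m = - (r0 mod m)] (mod p)" by (metis cong_iff_dvd_diff dvd_triv_left)
  moreover have "near p (1 / N) (- (r0 mod m))"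
  proof (rule near_bounded)
    have "m * N \<le> p" using \<open>p = m * N + p mod N\<close> assms(1) pos_mod_sign[of N p] by linarith
    then have "real_of_int m * N \<le> p" by (metis of_int_le_iff of_int_mult)
    then have "real_of_int m \<le> 1 / N * p" using assms(1) by (simp add: field_simps)
    then show "\<bar>real_of_int (- (r0 mod m))\<bar> \<le> 1 / N * p" using rm by linarith
  qed
  ultimately have "near p (1 / N) (r + j * (p div N))" using near_cong m_def by blast
  then show ?thesis using j0 jN by (intro exI[of _ j]) auto
qed

text \<open>The class \<open>h\<close> owns the numbers \<open>x\<close> and \<open>x - D\<close>,
  and \<open>x\<close> is sought in an interval on which all conditions from \<open>Q\<close> hold.
  If the coefficient of \<open>x^2\<close> is positive, \<open>quadratic_near_zero\<close> needs
  only about \<open>sqrt p\<close> of the interval; otherwise the linear term is one more digit,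
  read before those of \<open>Q\<close>. The case excluded by \<open>nd\<close>, no square term and
  \<open>a h + b h = 0\<close> with \<open>a h \<noteq> 0\<close>, turns the expression into
  \<open>a h * D\<close>, which no \<open>x\<close> can change.\<close>

lemma last_mover:
  fixes al be ga :: "'c \<Rightarrow> nat" and a b :: "'c \<Rightarrow> int" and Q :: "'q set" and S :: nat
  assumes "finite Q" "finite G" "\<epsilon> > 0"
    and nd: "\<forall>h\<in>G. al h + be h + ga h > 0 \<or> a h + b h \<noteq> 0 \<or> a h = 0 \<and> b h = 0"
  shows "\<exists>K::'q \<Rightarrow> nat. (\<forall>c. K c > 0) \<and> (\<forall>\<^sub>F p in at_top. \<forall>h\<in>G. \<forall>(D::int) (\<tau>::'q \<Rightarrow> int) (\<sigma>::'q \<Rightarrow> nat). (\<forall>c\<in>Q. \<sigma> c > 0 \<and> \<sigma> c \<le> S) \<longrightarrow>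
     (\<exists>x::int. near p \<epsilon> (int (al h) * x^2 + int (be h) * x * (x - D) + int (ga h) * (x - D)^2 + a h * x + b h * (x - D)) \<and>
        (\<forall>c\<in>Q. near p \<epsilon> (int (K c) * int (\<sigma> c) * x - \<tau> c))))"
proof -
  define Mmax where "Mmax = (\<Sum>h\<in>G. nat \<bar>a h + b h\<bar>)"
  have Mmax: "nat \<bar>a h + b h\<bar> \<le> Mmax" if "h \<in> G" for h
    unfolding Mmax_def using that assms(2) by (intro member_le_sum) auto
  obtain \<delta>0 p0 where d0: "\<delta>0 > 0" and 0: "\<forall>p\<ge>p0. \<forall>(M::nat) (a::real) (\<tau>::int).
     M > 0 \<and> M \<le> Mmax \<and> real M * 2 \<ge> 2 \<longrightarrow>
     (\<exists>a'::real. a \<le> a' \<and> a' + \<delta>0 * real_of_int p \<le> a + 2 * real_of_int p \<and>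
        (\<forall>x::int. a' \<le> x \<and> x \<le> a' + \<delta>0 * real_of_int p \<longrightarrow> near p \<epsilon> (int M * x - \<tau>)))"
    using one_digit[of 2 \<epsilon> Mmax, OF _ assms(3), simplified zero_less_numeral, OF TrueI] by (elim exE conjE)
  obtain K :: "'q \<Rightarrow> nat" and \<delta>1 where K: "\<forall>c. K c > 0" and d1: "\<delta>1 > 0"
      and 1: "\<forall>\<^sub>F p in at_top. controls Q S \<epsilon> \<delta>0 K \<delta>1 p"
    using digits[OF assms(1) d0 assms(3), of S] by (elim exE conjE)
  have "\<forall>\<^sub>F p in at_top. al h + be h + ga h > 0 \<longrightarrow> (\<forall>b c. \<exists>w::int. \<bar>real_of_int w\<bar> \<le> 2 * sqrt (real_of_int p) \<and> near p \<epsilon> (int (al h + be h + ga h) * w^2 + b * w + c))" for h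
  proof (cases "al h + be h + ga h > 0")
    case True
    then show ?thesis using quadratic_near_zero[OF assms(3) True] by (simp add: eventually_at_top_linorder)
  qed simp
  then have 2: "\<forall>\<^sub>F p in at_top. \<forall>h\<in>G. al h + be h + ga h > 0 \<longrightarrow> (\<forall>b c. \<exists>w::int. \<bar>real_of_int w\<bar> \<le> 2 * sqrt (real_of_int p) \<and> near p \<epsilon> (int (al h + be h + ga h) * w^2 + b * w + c))"
    using assms(2) by (simp add: eventually_ball_finite_distrib)
  have "\<forall>\<^sub>F x in at_top. 4 * sqrt x + 1 \<le> \<delta>1 * x"
    using d1 by real_asymp
  then have 3: "\<forall>\<^sub>F p :: int in at_top. 4 * sqrt p + 1 \<le> \<delta>1 * real_of_int p"
    using filterlim_real_of_int_at_top by (rule eventually_compose_filterlim)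
  have "\<forall>\<^sub>F p in at_top. \<forall>h\<in>G. \<forall>(D::int) (\<tau>::'q \<Rightarrow> int) (\<sigma>::'q \<Rightarrow> nat). (\<forall>c\<in>Q. \<sigma> c > 0 \<and> \<sigma> c \<le> S) \<longrightarrow>
     (\<exists>x::int. near p \<epsilon> (int (al h) * x^2 + int (be h) * x * (x - D) + int (ga h) * (x - D)^2 + a h * x + b h * (x - D)) \<and>
        (\<forall>c\<in>Q. near p \<epsilon> (int (K c) * int (\<sigma> c) * x - \<tau> c)))"
    using 2 3 eventually_ge_at_top[of p0] 1 eventually_ge_at_top[of 1]
  proof eventually_elim
    case (elim p)
    have s0: "sqrt p \<ge> 0" using elim(5) by simp
    show ?case
    proof (intro ballI allI impI)
      fix h D \<tau> and \<sigma> :: "'q \<Rightarrow> nat" assume h: "h \<in> G" and s: "\<forall>c\<in>Q. \<sigma> c > 0 \<and> \<sigma> c \<le> S"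
      define q where "q x = int (al h) * x^2 + int (be h) * x * (x - D) + int (ga h) * (x - D)^2 + a h * x + b h * (x - D)" for x
      consider "al h + be h + ga h > 0" | "al h + be h + ga h = 0" "a h + b h \<noteq> 0" | "al h + be h + ga h = 0" "a h = 0" "b h = 0"
        using bspec[OF nd h] by (metis neq0_conv)
      then have "\<exists>x. near p \<epsilon> (q x) \<and> (\<forall>c\<in>Q. near p \<epsilon> (int (K c) * int (\<sigma> c) * x - \<tau> c))"
      proof cases
        case 1
        obtain a1 :: real where a1: "\<And>x::int. a1 \<le> x \<Longrightarrow> x \<le> a1 + \<delta>1 * real_of_int p \<Longrightarrow> (\<forall>c\<in>Q. near p \<epsilon> (int (K c) * int (\<sigma> c) * x - \<tau> c))"
          by (rule controlsE[OF elim(4) s, where a = 0 and \<tau> = \<tau>]) (rule that)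
        \<comment> \<open>Starting \<open>2 * sqrt p\<close> beyond the left end leaves room for
          \<open>w\<close> of either sign.\<close>
        define x0 where "x0 = \<lceil>a1 + 2 * sqrt p\<rceil>"
        define m where "m = al h + be h + ga h"
        obtain w where w: "\<bar>real_of_int w\<bar> \<le> 2 * sqrt p" "near p \<epsilon> (int m * w^2 + (2 * int m * x0 - (be h + 2 * ga h) * D + a h + b h) * w + q x0)"
          using elim(1)[rule_format, OF h 1] m_def by blast
        have "q (x0 + w) = int m * w^2 + (2 * int m * x0 - (be h + 2 * ga h) * D + a h + b h) * w + q x0"
          unfolding q_def m_def by (simp add: power2_eq_square algebra_simps)
        moreover have "a1 \<le> real_of_int (x0 + w)" "real_of_int (x0 + w) \<le> a1 + \<delta>1 * p"
          using w(1) elim(2) unfolding x0_def by (simp_all add: abs_le_iff) linarith+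
        ultimately show ?thesis using w(2) a1[of "x0 + w"] by (intro exI[of _ "x0 + w"]) auto
      next
        case 2
        \<comment> \<open>\<open>one_digit\<close> takes a natural multiplier, so the sign of
          \<open>a h + b h\<close> is pulled out. It was prepared for intervals of length
          \<open>2 * p\<close>, which admit every multiplier from 1 on.\<close>
        define M where "M = nat \<bar>a h + b h\<bar>"
        have M: "M > 0" "M \<le> Mmax" using 2 Mmax[OF h] M_def by auto
        have "M > 0 \<and> M \<le> Mmax \<and> real M * 2 \<ge> 2" using M by simp
        from 0[rule_format, OF elim(3) this, of 0 "sgn (a h + b h) * b h * D"]
        obtain a0 :: real where a0: "\<forall>x::int. a0 \<le> x \<and> x \<le> a0 + \<delta>0 * real_of_int p \<longrightarrow> near p \<epsilon> (int M * x - sgn (a h + b h) * b h * D)"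
          by blast
        obtain a1 :: real where a1: "a0 \<le> a1" "a1 + \<delta>1 * real_of_int p \<le> a0 + \<delta>0 * real_of_int p" "\<And>x::int. a1 \<le> x \<Longrightarrow> x \<le> a1 + \<delta>1 * real_of_int p \<Longrightarrow> (\<forall>c\<in>Q. near p \<epsilon> (int (K c) * int (\<sigma> c) * x - \<tau> c))"
          by (rule controlsE[OF elim(4) s, where a = a0 and \<tau> = \<tau>]) (rule that)
        define x where "x = \<lceil>a1\<rceil>"
        have x: "a1 \<le> x" "x \<le> a1 + \<delta>1 * p" using elim(2) s0 unfolding x_def by linarith+
        then have "near p \<epsilon> (int M * x - sgn (a h + b h) * b h * D)" using a0[rule_format, of x] a1(1,2) by linarith
        then have n: "near p (\<bar>real_of_int (sgn (a h + b h))\<bar> * \<epsilon>) (sgn (a h + b h) * (int M * x - sgn (a h + b h) * b h * D))" by (rule near_mult)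
        have "q x = sgn (a h + b h) * (int M * x - sgn (a h + b h) * b h * D)"
        proof (cases "a h + b h > 0")
          case True then show ?thesis using 2(1) by (simp add: q_def M_def algebra_simps)
        next
          case False
          then have "a h + b h < 0" using 2 by simp
          then show ?thesis using 2(1) by (simp add: q_def M_def algebra_simps)
        qed
        moreover have "\<bar>real_of_int (sgn (a h + b h))\<bar> = 1" using 2(2) by (simp add: sgn_if)
        ultimately have "near p \<epsilon> (q x)" using n by simp
        then show ?thesis using a1(3)[OF x] by blast
      next
        case 3
        obtain a1 :: real where a1: "\<And>x::int. a1 \<le> x \<Longrightarrow> x \<le> a1 + \<delta>1 * real_of_int p \<Longrightarrow> (\<forall>c\<in>Q. near p \<epsilon> (int (K c) * int (\<sigma> c) * x - \<tau> c))"
          by (rule controlsE[OF elim(4) s, where a = 0 and \<tau> = \<tau>]) (rule that)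
        define x where "x = \<lceil>a1\<rceil>"
        have x: "a1 \<le> x" "x \<le> a1 + \<delta>1 * p" using elim(2) s0 unfolding x_def by linarith+
        moreover have "near p \<epsilon> (q x)" using 3 assms(3) elim(5) by (intro near_bounded) (simp add: q_def)
        ultimately show ?thesis using a1 by blast
      qed
      then show "\<exists>x. near p \<epsilon> (int (al h) * x^2 + int (be h) * x * (x - D) + int (ga h) * (x - D)^2 + a h * x + b h * (x - D)) \<and>
        (\<forall>c\<in>Q. near p \<epsilon> (int (K c) * int (\<sigma> c) * x - \<tau> c))" unfolding q_def .
    qed
  qed
  then show ?thesis using K by blast
qed


text \<open>No term couples two classes of \<open>G\<close>, so each of them moves on its own by
  \<open>last_mover\<close> and the errors simply add up. For \<open>c\<close> in \<open>Q\<close>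
  the multiplier of its move only has to be a known fraction of \<open>p\<close>, and one neighbour
  in \<open>G\<close> is enough to provide it.\<close>

lemma independent_movers:
  fixes al be ga :: "'c \<Rightarrow> nat" and a b :: "'c \<Rightarrow> int" and A B :: "'c \<Rightarrow> 'c \<Rightarrow> nat" and N :: int
  assumes "finite Q" "finite G" "\<epsilon> > 0" "G \<inter> Q = {}"
    and nd: "\<forall>h\<in>G. al h + be h + ga h > 0 \<or> a h + b h \<noteq> 0 \<or> a h = 0 \<and> b h = 0"
    and pi: "\<And>c. c \<in> Q \<Longrightarrow> \<pi> c \<in> G \<and> A c (\<pi> c) + B c (\<pi> c) > 0"
  shows "\<exists>K::'c \<Rightarrow> int. \<forall>\<^sub>F p in at_top. \<exists>S. (\<forall>c. cover p (S c)) \<and> (\<forall>g::'c \<Rightarrow> bool \<Rightarrow> int. (\<forall>c\<in>-Q. g c \<in> S c) \<longrightarrow>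
     near p \<epsilon> (\<Sum>h\<in>G. al h * (g h True)^2 + be h * g h True * g h False + ga h * (g h False)^2 + a h * g h True + b h * g h False) \<and>
     (\<forall>c\<in>Q. near p \<epsilon> (K c * (\<Sum>h\<in>G. A c h * g h True + B c h * g h False) - p div N)))"
proof -
  define \<epsilon>1 where "\<epsilon>1 = \<epsilon> / (card G + 1)"
  have e1: "\<epsilon>1 > 0" "card G * \<epsilon>1 \<le> \<epsilon>" using assms(3) by (simp_all add: \<epsilon>1_def field_simps)
  define S where "S = (\<Sum>c\<in>Q. \<Sum>h\<in>G. A c h + B c h) + 1"
  have S: "A c h + B c h \<le> S" if "c \<in> Q" "h \<in> G" for c h
  proof -
    have "A c h + B c h \<le> (\<Sum>h\<in>G. A c h + B c h)" using that assms by (intro member_le_sum[of _ _ "\<lambda>h. A c h + B c h"]) auto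
    also have "\<dots> \<le> (\<Sum>c\<in>Q. \<Sum>h\<in>G. A c h + B c h)" using that assms by (intro member_le_sum[of _ _ "\<lambda>c. \<Sum>h\<in>G. A c h + B c h"]) auto
    finally show ?thesis by (simp add: S_def)
  qed
  obtain K :: "'c \<Rightarrow> nat" where ev: "\<forall>\<^sub>F p in at_top. \<forall>h\<in>G. \<forall>(D::int) (\<tau>::'c \<Rightarrow> int) (\<sigma>::'c \<Rightarrow> nat). (\<forall>c\<in>Q. \<sigma> c > 0 \<and> \<sigma> c \<le> S) \<longrightarrow>
     (\<exists>x::int. near p \<epsilon>1 (int (al h) * x^2 + int (be h) * x * (x - D) + int (ga h) * (x - D)^2 + a h * x + b h * (x - D)) \<and>
        (\<forall>c\<in>Q. near p \<epsilon>1 (int (K c) * int (\<sigma> c) * x - \<tau> c)))"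
    using last_mover[OF assms(1,2) e1(1) nd, of S] by (elim exE conjE)
  define quad where "quad h f = al h * (f True)^2 + be h * f True * f False + ga h * (f False)^2 + a h * f True + b h * f False" for h and f :: "bool \<Rightarrow> int"
  show ?thesis
  proof (rule exI[of _ "\<lambda>c. int (K c)"], rule eventually_mono[OF eventually_conj[OF ev eventually_ge_at_top[of 1]]], elim conjE)
    fix p :: int
    assume p: "\<forall>h\<in>G. \<forall>(D::int) (\<tau>::'c \<Rightarrow> int) (\<sigma>::'c \<Rightarrow> nat). (\<forall>c\<in>Q. \<sigma> c > 0 \<and> \<sigma> c \<le> S) \<longrightarrow>
     (\<exists>x::int. near p \<epsilon>1 (int (al h) * x^2 + int (be h) * x * (x - D) + int (ga h) * (x - D)^2 + a h * x + b h * (x - D)) \<and>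
        (\<forall>c\<in>Q. near p \<epsilon>1 (int (K c) * int (\<sigma> c) * x - \<tau> c)))" and p1: "1 \<le> p"
    \<comment> \<open>Only \<open>\<pi> c\<close> aims at the target of \<open>c\<close>; the other
      classes of \<open>G\<close> aim at 0, so their sum has the right size.\<close>
    define tg where "tg c h = (if h = \<pi> c then p div N else 0)" for c h
    define T where "T h = (if h \<in> G then {f :: bool \<Rightarrow> int. near p \<epsilon>1 (quad h f) \<and> (\<forall>c\<in>Q. A c h + B c h > 0 \<longrightarrow> near p \<epsilon>1 (K c * (A c h * f True + B c h * f False) - tg c h))} else UNIV)" for h
    have "cover p (T h)" for h
      unfolding cover_def
    proof
      fix D
      show "\<exists>f\<in>T h. [f True - f False = D] (mod p)"
      proof (cases "h \<in> G")
        case False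
        then show ?thesis by (intro bexI[of _ "\<lambda>b. if b then D else 0"]) (auto simp: T_def)
      next
        case True
        \<comment> \<open>As \<open>f True = x\<close> and \<open>f False = x - D\<close>, the
          coefficient of \<open>x\<close> is \<open>A c h + B c h\<close>. The value 1 is a
          placeholder for classes \<open>c\<close> that do not meet \<open>h\<close>.\<close>
        define \<sigma> where "\<sigma> c = (if A c h + B c h > 0 then A c h + B c h else 1)" for c
        have "\<forall>c\<in>Q. \<sigma> c > 0 \<and> \<sigma> c \<le> S" using S True by (auto simp: \<sigma>_def S_def)
        then obtain x where x: "near p \<epsilon>1 (int (al h) * x^2 + int (be h) * x * (x - D) + int (ga h) * (x - D)^2 + a h * x + b h * (x - D))"
            "\<forall>c\<in>Q. near p \<epsilon>1 (int (K c) * int (\<sigma> c) * x - (K c * B c h * D + tg c h))"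
          using p[rule_format, OF True, of \<sigma> D "\<lambda>c. K c * B c h * D + tg c h"] by blast
        define f where "f b = (if b then x else x - D)" for b
        have "near p \<epsilon>1 (quad h f)" using x(1) by (simp add: quad_def f_def)
        moreover have "near p \<epsilon>1 (K c * (A c h * f True + B c h * f False) - tg c h)" if "c \<in> Q" "A c h + B c h > 0" for c
        proof -
          have "int (K c) * int (\<sigma> c) * x - (K c * B c h * D + tg c h) = K c * (A c h * f True + B c h * f False) - tg c h"
            using that(2) by (simp add: \<sigma>_def f_def algebra_simps)
          then show ?thesis using x(2) that(1) by metis
        qed
        ultimately have "f \<in> T h" using True by (simp add: T_def)
        then show ?thesis by (intro bexI[of _ f]) (simp_all add: f_def)
      qed
    qed
    moreover have "near p \<epsilon> (\<Sum>h\<in>G. quad h (g h)) \<and> (\<forall>c\<in>Q. near p \<epsilon> (K c * (\<Sum>h\<in>G. A c h * g h True + B c h * g h False) - p div N))"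
      if g: "\<forall>c\<in>-Q. g c \<in> T c" for g :: "'c \<Rightarrow> bool \<Rightarrow> int"
    proof
      have gT: "g h \<in> T h" if "h \<in> G" for h using g that assms(4) by auto
      have "near p (\<Sum>h\<in>G. \<epsilon>1) (\<Sum>h\<in>G. quad h (g h))" using gT by (intro near_sum assms) (auto simp: T_def)
      then show "near p \<epsilon> (\<Sum>h\<in>G. quad h (g h))" using e1 p1 by (auto elim: near_mono)
      show "\<forall>c\<in>Q. near p \<epsilon> (K c * (\<Sum>h\<in>G. A c h * g h True + B c h * g h False) - p div N)"
      proof
        fix c assume c: "c \<in> Q"
        have "near p \<epsilon>1 (K c * (A c h * g h True + B c h * g h False) - tg c h)" if "h \<in> G" for h
        proof (cases "A c h + B c h > 0")
          case True then show ?thesis using gT[OF that] that c by (auto simp: T_def)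
        next
          case False
          then have "h \<noteq> \<pi> c" using pi[OF c] by auto
          then show ?thesis using False e1 p1 by (intro near_bounded) (simp add: tg_def)
        qed
        then have "near p (\<Sum>h\<in>G. \<epsilon>1) (\<Sum>h\<in>G. K c * (A c h * g h True + B c h * g h False) - tg c h)" by (intro near_sum assms)
        moreover have "(\<Sum>h\<in>G. tg c h) = p div N" using pi[OF c] assms(2) by (simp add: tg_def)
        ultimately have "near p (card G * \<epsilon>1) (K c * (\<Sum>h\<in>G. A c h * g h True + B c h * g h False) - p div N)"
          by (simp add: sum_subtractf sum_distrib_left)
        then show "near p \<epsilon> (K c * (\<Sum>h\<in>G. A c h * g h True + B c h * g h False) - p div N)" using e1 p1 by (auto elim: near_mono)
      qed
    qed
    ultimately show "\<exists>S. (\<forall>c. cover p (S c)) \<and> (\<forall>g::'c \<Rightarrow> bool \<Rightarrow> int. (\<forall>c\<in>-Q. g c \<in> S c) \<longrightarrow>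
     near p \<epsilon> (\<Sum>h\<in>G. al h * (g h True)^2 + be h * g h True * g h False + ga h * (g h False)^2 + a h * g h True + b h * g h False) \<and>
     (\<forall>c\<in>Q. near p \<epsilon> (int (K c) * (\<Sum>h\<in>G. A c h * g h True + B c h * g h False) - p div N)))"
      unfolding quad_def by (intro exI[of _ T]) blast
  qed
qed

text \<open>The classes in \<open>Q\<close> choose multiples of \<open>K c\<close> for \<open>h c\<close>. Then \<open>h c * \<Lambda> c g\<close> moves in steps of about
  \<open>p / N\<close> and can cancel the demand \<open>\<rho> p c D\<close>, whatever the other classes do.\<close>

lemma assembly:
  fixes F base :: "('c \<Rightarrow> bool \<Rightarrow> int) \<Rightarrow> int" and \<Lambda> :: "'c \<Rightarrow> ('c \<Rightarrow> bool \<Rightarrow> int) \<Rightarrow> int"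
    and off :: "int \<Rightarrow> 'c \<Rightarrow> int \<Rightarrow> bool \<Rightarrow> int" and \<rho> :: "int \<Rightarrow> 'c \<Rightarrow> int \<Rightarrow> int" and W :: "('c \<Rightarrow> int) \<Rightarrow> int"
  assumes Q: "finite Q" and e: "\<epsilon> > 0"
    and off: "\<And>p c D. prime p \<Longrightarrow> odd p \<Longrightarrow> c \<in> Q \<Longrightarrow> [off p c D True - off p c D False = D] (mod p)"
    and F: "\<And>p g h D. prime p \<Longrightarrow> odd p \<Longrightarrow> (\<And>c b. c \<in> Q \<Longrightarrow> g c b = \<kappa> c + h c + off p c (D c) b) \<Longrightarrow> (\<And>c. c \<notin> Q \<Longrightarrow> h c = 0) \<Longrightarrow>
        [F g = base g + (\<Sum>c\<in>Q. h c * \<Lambda> c g + \<rho> p c (D c)) + W h] (mod p)"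
    and steer: "\<And>N \<epsilon>. N > 0 \<Longrightarrow> \<epsilon> > 0 \<Longrightarrow> \<exists>K::'c \<Rightarrow> int. \<forall>\<^sub>F p in at_top. \<exists>S. (\<forall>c. cover p (S c)) \<and>
        (\<forall>g. (\<forall>c\<in>-Q. g c \<in> S c) \<longrightarrow> near p \<epsilon> (base g) \<and> (\<forall>c\<in>Q. near p \<epsilon> (K c * \<Lambda> c g - p div N)))"
  shows "\<forall>\<^sub>F p in at_top. prime p \<longrightarrow> nearable p \<epsilon> F"
proof -
  define n where "n = real (card Q)"
  \<comment> \<open>The error is planned in three parts of at most \<open>\<epsilon> / 4\<close>:
    \<open>1 / N\<close> for every class that answers its demand, \<open>N * \<epsilon>'\<close> for
    every multiplier scaled by \<open>j \<le> N\<close> together with \<open>\<epsilon>'\<close> for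
    \<open>base\<close>, and finally \<open>W\<close>.\<close>
  define N where "N = \<lceil>4 * n / \<epsilon>\<rceil> + 1"
  have n0: "n \<ge> 0" by (simp add: n_def)
  have N: "N > 0" using divide_nonneg_pos[of "4 * n" \<epsilon>] e n0 unfolding N_def by linarith
  have "real_of_int N \<ge> 4 * n / \<epsilon>" unfolding N_def by linarith
  then have nN: "n / N \<le> \<epsilon> / 4" using N e by (simp add: field_simps)
  define \<epsilon>' where "\<epsilon>' = \<epsilon> / (4 * (1 + n * N))"
  have nN0: "1 + n * N > 0" using n0 N by (simp add: add_pos_nonneg)
  have e': "\<epsilon>' > 0" "\<epsilon>' + n * N * \<epsilon>' = \<epsilon> / 4"
  proof -
    show "\<epsilon>' > 0" unfolding \<epsilon>'_def using e nN0 by simp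
    have "\<epsilon>' + n * N * \<epsilon>' = (1 + n * N) * \<epsilon>'" by (simp add: algebra_simps)
    also have "\<dots> = \<epsilon> / 4" unfolding \<epsilon>'_def using nN0 by (simp add: field_simps)
    finally show "\<epsilon>' + n * N * \<epsilon>' = \<epsilon> / 4" .
  qed
  obtain K :: "'c \<Rightarrow> int" where K: "\<forall>\<^sub>F p in at_top. \<exists>S. (\<forall>c. cover p (S c)) \<and>
        (\<forall>g. (\<forall>c\<in>-Q. g c \<in> S c) \<longrightarrow> near p \<epsilon>' (base g) \<and> (\<forall>c\<in>Q. near p \<epsilon>' (K c * \<Lambda> c g - p div N)))"
    using steer[OF N e'(1)] by (elim exE)
  \<comment> \<open>All possible moves lie in this finite set, which does not depend on
    \<open>p\<close>. Hence \<open>W\<close> is bounded on it by a constant, whatever its form, and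
    becomes negligible for large \<open>p\<close>.\<close>
  define H where "H = {h. \<forall>c. (c \<in> Q \<longrightarrow> h c \<in> (\<Union>c\<in>Q. (\<lambda>j. j * K c) ` {0..N})) \<and> (c \<notin> Q \<longrightarrow> h c = 0)}"
  have "finite H" unfolding H_def using Q by (intro finite_set_of_finite_funs) auto
  define Bd where "Bd = (\<Sum>h\<in>H. \<bar>W h\<bar>)"
  have Bd: "\<bar>W h\<bar> \<le> Bd" if "h \<in> H" for h unfolding Bd_def using that \<open>finite H\<close> by (intro member_le_sum) auto
  define p0 where "p0 = max 3 (max (N * N) \<lceil>4 * Bd / \<epsilon>\<rceil>)"
  show ?thesis
  proof (rule eventually_mono[OF eventually_conj[OF K eventually_ge_at_top[of p0]]], elim conjE exE, intro impI)
    fix p S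
    assume S: "\<forall>c. cover p (S c)" and
      st: "\<forall>g. (\<forall>c\<in>-Q. g c \<in> S c) \<longrightarrow> near p \<epsilon>' (base g) \<and> (\<forall>c\<in>Q. near p \<epsilon>' (K c * \<Lambda> c g - p div N))"
      and p: "p0 \<le> p" "prime p"
    have p3: "p \<ge> 3" "p \<ge> N * N" "real_of_int p \<ge> 4 * Bd / \<epsilon>" using p(1) unfolding p0_def by linarith+
    have odd: "odd p" using p(2) p3(1) prime_odd_int by simp
    have eB: "Bd \<le> \<epsilon> / 4 * p" using p3(3) e by (simp add: field_simps)
    define T where "T c = (if c \<in> Q then {f. \<exists>j D. 0 \<le> j \<and> j \<le> N \<and> near p (1 / N) (\<rho> p c D + j * (p div N)) \<and> (\<forall>b. f b = \<kappa> c + j * K c + off p c D b)} else S c)" for c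
    have "cover p (T c)" for c
    proof (cases "c \<in> Q")
      case False then show ?thesis using S by (simp add: T_def)
    next
      case True
      show ?thesis unfolding cover_def
      proof
        fix D
        obtain j where j: "0 \<le> j \<and> j \<le> N \<and> near p (1 / N) (\<rho> p c D + j * (p div N))"
          using demand_digit[OF N p3(2)] by blast
        have "(\<lambda>b. \<kappa> c + j * K c + off p c D b) \<in> T c" using True j by (auto simp: T_def)
        moreover have "[(\<kappa> c + j * K c + off p c D True) - (\<kappa> c + j * K c + off p c D False) = D] (mod p)"
          using off[OF p(2) odd True] by simp
        ultimately show "\<exists>f\<in>T c. [f True - f False = D] (mod p)" by (intro bexI[of _ "\<lambda>b. \<kappa> c + j * K c + off p c D b"])
      qed
    qed
    moreover have "near p \<epsilon> (F g)" if g: "\<forall>c. g c \<in> T c" for g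
    proof -
      have "\<forall>c\<in>Q. \<exists>j D. 0 \<le> j \<and> j \<le> N \<and> near p (1 / N) (\<rho> p c D + j * (p div N)) \<and> (\<forall>b. g c b = \<kappa> c + j * K c + off p c D b)"
      proof
        fix c assume "c \<in> Q"
        then show "\<exists>j D. 0 \<le> j \<and> j \<le> N \<and> near p (1 / N) (\<rho> p c D + j * (p div N)) \<and> (\<forall>b. g c b = \<kappa> c + j * K c + off p c D b)"
          using g[rule_format, of c] by (simp add: T_def)
      qed
      then obtain j where "\<forall>c\<in>Q. \<exists>D. 0 \<le> j c \<and> j c \<le> N \<and> near p (1 / N) (\<rho> p c D + j c * (p div N)) \<and> (\<forall>b. g c b = \<kappa> c + j c * K c + off p c D b)"
        by (rule bchoice[THEN exE])
      then obtain D where jD: "\<forall>c\<in>Q. 0 \<le> j c \<and> j c \<le> N \<and> near p (1 / N) (\<rho> p c (D c) + j c * (p div N)) \<and> (\<forall>b. g c b = \<kappa> c + j c * K c + off p c (D c) b)"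
        by (rule bchoice[THEN exE])
      define h where "h c = (if c \<in> Q then j c * K c else 0)" for c
      have "h c \<in> (\<Union>c\<in>Q. (\<lambda>j. j * K c) ` {0..N})" if "c \<in> Q" for c
        using jD[rule_format, OF that] that by (intro UN_I[OF that] image_eqI[of _ _ "j c"]) (auto simp: h_def)
      then have hH: "h \<in> H" unfolding H_def by (simp add: h_def)
      have c: "[F g = base g + (\<Sum>c\<in>Q. h c * \<Lambda> c g + \<rho> p c (D c)) + W h] (mod p)"
        using jD by (intro F[OF p(2) odd]) (auto simp: h_def)
      have "g c \<in> S c" if "c \<in> -Q" for c using g[rule_format, of c] that by (simp add: T_def)
      then have "\<forall>c\<in>-Q. g c \<in> S c" by blast
      then have st': "near p \<epsilon>' (base g)" "\<forall>c\<in>Q. near p \<epsilon>' (K c * \<Lambda> c g - p div N)" using st by auto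
      have "near p (N * \<epsilon>' + 1 / N) (h c * \<Lambda> c g + \<rho> p c (D c))" if "c \<in> Q" for c
      proof -
        have "near p (\<bar>real_of_int (j c)\<bar> * \<epsilon>') (j c * (K c * \<Lambda> c g - p div N))" using st' that by (intro near_mult) auto
        moreover have "\<bar>real_of_int (j c)\<bar> * \<epsilon>' \<le> N * \<epsilon>'" using jD that e' by (intro mult_right_mono) auto
        ultimately have "near p (N * \<epsilon>') (j c * (K c * \<Lambda> c g - p div N))" using p3(1) by (auto elim: near_mono)
        from near_add[OF this] have "near p (N * \<epsilon>' + 1 / N) (j c * (K c * \<Lambda> c g - p div N) + (\<rho> p c (D c) + j c * (p div N)))"
          using jD that by blast
        moreover have "j c * (K c * \<Lambda> c g - p div N) + (\<rho> p c (D c) + j c * (p div N)) = h c * \<Lambda> c g + \<rho> p c (D c)"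
          using that by (simp add: h_def algebra_simps)
        ultimately show ?thesis by simp
      qed
      then have "near p (\<Sum>c\<in>Q. N * \<epsilon>' + 1 / N) (\<Sum>c\<in>Q. h c * \<Lambda> c g + \<rho> p c (D c))" by (intro near_sum Q)
      moreover have "near p (\<epsilon> / 4) (W h)" using Bd[OF hH] eB by (intro near_bounded) linarith
      ultimately have "near p (\<epsilon>' + (\<Sum>c\<in>Q. N * \<epsilon>' + 1 / N) + \<epsilon> / 4) (base g + (\<Sum>c\<in>Q. h c * \<Lambda> c g + \<rho> p c (D c)) + W h)"
        using st'(1) by (intro near_add)
      moreover have "\<epsilon>' + (\<Sum>c\<in>Q. N * \<epsilon>' + 1 / N) + \<epsilon> / 4 = (\<epsilon>' + n * N * \<epsilon>') + n / N + \<epsilon> / 4"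
        by (simp add: n_def algebra_simps)
      moreover have "(\<epsilon>' + n * N * \<epsilon>') + n / N + \<epsilon> / 4 \<le> \<epsilon>" using nN e'(2) e by linarith
      ultimately have "near p \<epsilon> (base g + (\<Sum>c\<in>Q. h c * \<Lambda> c g + \<rho> p c (D c)) + W h)"
        using p3(1) by (intro near_mono[of p "\<epsilon>' + (\<Sum>c\<in>Q. N * \<epsilon>' + 1 / N) + \<epsilon> / 4" _ \<epsilon>]) auto
      then show ?thesis using near_cong[OF c] by blast
    qed
    ultimately show "nearable p \<epsilon> F" unfolding nearable_def by (intro exI[of _ T]) blast
  qed
qed

section \<open>Squares modulo a prime\<close>

lemma QuadRes_iff: "QuadRes p a \<longleftrightarrow> (\<exists>t. [t * t = a] (mod p))"
  by (simp add: QuadRes_def power2_eq_square)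

lemma QuadRes_cong: "[a = b] (mod p) \<Longrightarrow> QuadRes p a \<longleftrightarrow> QuadRes p b"
  unfolding QuadRes_iff by (meson cong_sym cong_trans)

lemma QuadRes_mult: "QuadRes p a \<Longrightarrow> QuadRes p b \<Longrightarrow> QuadRes p (a * b)"
proof -
  assume "QuadRes p a" "QuadRes p b"
  then obtain s t where "[s * s = a] (mod p)" "[t * t = b] (mod p)" unfolding QuadRes_iff by blast
  then have "[(s * s) * (t * t) = a * b] (mod p)" by (rule cong_mult)
  then have "[(s * t) * (s * t) = a * b] (mod p)" by (simp add: ac_simps)
  then show ?thesis unfolding QuadRes_iff by blast
qed

lemma QuadRes_square [simp]: "QuadRes p (a * a)"
  unfolding QuadRes_iff by (meson cong_refl)

lemma QuadRes_0 [simp]: "QuadRes p 0" and QuadRes_1 [simp]: "QuadRes p 1"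
  using QuadRes_square[of p 0] QuadRes_square[of p 1] by simp_all

lemma QuadRes_dvd: "p dvd a \<Longrightarrow> QuadRes p a"
  using QuadRes_cong[of a 0 p] by (simp add: cong_0_iff)

lemma inverse_mod:
  fixes p a :: int
  assumes "prime p" "\<not> p dvd a"
  obtains b where "[a * b = 1] (mod p)" "\<not> p dvd b"
proof -
  have "coprime a p" using assms by (metis coprime_commute prime_imp_coprime)
  then obtain b where b: "[a * b = 1] (mod p)" using cong_solve_coprime_int by blast
  have "\<not> p dvd b"
  proof
    assume "p dvd b"
    then have "[a * b = 0] (mod p)" by (simp add: cong_0_iff)
    then have "[1 = 0] (mod p)" using b cong_trans cong_sym by blast
    then have "p dvd 1" by (simp add: cong_0_iff)
    then show False using assms(1) by (simp add: not_prime_unit)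
  qed
  then show ?thesis using b that by blast
qed

lemma QuadRes_cancel:
  assumes "prime p" "\<not> p dvd a" "QuadRes p a" "QuadRes p (a * b)"
  shows "QuadRes p b"
proof -
  obtain s where s: "[s * s = a] (mod p)" using assms(3) QuadRes_iff by blast
  have "\<not> p dvd s"
  proof
    assume "p dvd s"
    then have "[s * s = 0] (mod p)" by (simp add: cong_0_iff)
    then have "p dvd a" using s by (metis cong_0_iff cong_sym cong_trans)
    then show False using assms(2) by blast
  qed
  then obtain r where r: "[s * r = 1] (mod p)" using inverse_mod[OF assms(1)] by blast
  have "[(r * r) * (a * b) = (r * r) * (s * s * b)] (mod p)"
    by (intro cong_mult cong_refl cong_sym[OF s])
  also have "(r * r) * (s * s * b) = (s * r) * (s * r) * b" by (simp add: ac_simps)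
  also have "[\<dots> = 1 * 1 * b] (mod p)" using r by (intro cong_mult cong_refl)
  finally have "[(r * r) * (a * b) = b] (mod p)" by simp
  moreover have "QuadRes p ((r * r) * (a * b))" using QuadRes_mult[OF QuadRes_square assms(4)] .
  ultimately show ?thesis using QuadRes_cong by blast
qed

text \<open>\<open>1\<close> and \<open>p - 1\<close> have the same square, so squaring is not
  injective on the residues and therefore not onto.\<close>

lemma nonsquare_exists:
  assumes "prime p" "p > 2"
  shows "\<exists>n. \<not> QuadRes p n"
proof (rule ccontr)
  assume "\<not> ?thesis"
  then have all: "QuadRes p n" for n by blast
  let ?f = "\<lambda>t. t * t mod p"
  have "{0..<p} \<subseteq> ?f ` {0..<p}"
  proof
    fix n assume n: "n \<in> {0..<p}"
    obtain t where "[t * t = n] (mod p)" using all QuadRes_iff by blast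
    then have "t * t mod p = n mod p" by (simp only: unique_euclidean_semiring_class.cong_def)
    then have "(t mod p) * (t mod p) mod p = n" using n by (simp add: mod_mult_eq)
    then show "n \<in> ?f ` {0..<p}" using assms(2) by (intro image_eqI[of _ _ "t mod p"]) auto
  qed
  moreover have "?f ` {0..<p} \<subseteq> {0..<p}" using assms(2) by auto
  ultimately have "?f ` {0..<p} = {0..<p}" by blast
  then have "inj_on ?f {0..<p}" by (intro eq_card_imp_inj_on) auto
  moreover have "(p - 1) * (p - 1) = 1 * 1 + p * (p - 2)" by (simp add: algebra_simps)
  then have "?f (p - 1) = ?f 1" by (metis mod_mult_self2)
  ultimately have "p - 1 = 1" using assms(2) inj_onD[of ?f "{0..<p}" "p - 1" 1] by simp
  then show False using assms(2) by simp
qed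

lemma nonsquare_mult:
  fixes p :: int
  assumes "prime p" "p > 2" "\<not> QuadRes p a" "\<not> QuadRes p b"
  shows "QuadRes p (a * b)"
proof (rule ccontr)
  assume ab: "\<not> QuadRes p (a * b)"
  define m where "m = (nat p - 1) div 2"
  have p: "prime (nat p)" "2 < nat p" "int (nat p) = p" using assms by auto
  have euler: "[x ^ m = - 1] (mod p)" if x: "\<not> QuadRes p x" for x
  proof -
    have "\<not> [x = 0] (mod p)" using x QuadRes_dvd cong_0_iff by blast
    then have "Legendre x p = - 1" using x by (simp add: Legendre_def)
    then show ?thesis using euler_criterion[OF p(1,2), of x] p(3) unfolding m_def by (metis cong_sym)
  qed
  have "[a ^ m * b ^ m = - 1 * - 1] (mod p)" by (intro cong_mult euler assms)
  then have "[(a * b) ^ m = 1] (mod p)" by (simp add: power_mult_distrib)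
  then have "[- 1 = 1] (mod p)" using euler[OF ab] cong_sym cong_trans by blast
  then have "p dvd 2" by (simp add: cong_iff_dvd_diff)
  then show False using assms(2) zdvd_not_zless by fastforce
qed

text \<open>One of 2, 5 and 10 = 2 * 5 is a square, and 1, 4 and 9 are the squares just below
  them.\<close>

lemma consecutive_squares:
  assumes "prime p" "p > 10"
  shows "\<exists>r. QuadRes p r \<and> QuadRes p (r + 1) \<and> \<not> p dvd r \<and> \<not> p dvd r + 1"
proof -
  have nd: "\<not> p dvd x" if "0 < x" "x < p" for x using that zdvd_not_zless by blast
  have sq: "QuadRes p 4" "QuadRes p 9" using QuadRes_square[of p 2] QuadRes_square[of p 3] by simp_all
  consider "QuadRes p 2" | "QuadRes p 5" | "\<not> QuadRes p 2" "\<not> QuadRes p 5" by blast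
  then show ?thesis
  proof cases
    case 1 then show ?thesis using nd[of 1] nd[of 2] assms(2) by (intro exI[of _ 1]) simp
  next
    case 2 then show ?thesis using nd[of 4] nd[of 5] sq assms(2) by (intro exI[of _ 4]) simp
  next
    case 3 then have "QuadRes p (2 * 5)" using assms by (intro nonsquare_mult) auto
    then show ?thesis using nd[of 9] nd[of 10] sq assms(2) by (intro exI[of _ 9]) simp
  qed
qed

text \<open>Otherwise nonsquares propagate upwards as far as \<open>p - 1\<close>. If 2 is a
  nonsquare, so are 3 and 4, which is absurd. If 2 is a square, then \<open>(p - 1) div 2\<close> is
  a nonsquare because -1 is one, whereas its successor is the inverse of 2 and hence a nonzero
  square.\<close>

lemma nonsquare_then_square:
  assumes "prime p" "p > 10"
  shows "\<exists>v. \<not> QuadRes p v \<and> QuadRes p (v + 1) \<and> \<not> p dvd v + 1"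
proof (rule ccontr)
  assume neg: "\<not> ?thesis"
  have step: "\<not> QuadRes p (v + 1)" if "\<not> QuadRes p v" "\<not> p dvd v + 1" for v using neg that by blast
  have nd: "\<not> p dvd x" if "0 < x" "x < p" for x using that zdvd_not_zless by blast
  obtain n0 where n0: "\<not> QuadRes p n0" using nonsquare_exists assms by force
  define n where "n = n0 mod p"
  have n: "\<not> QuadRes p n" using n0 QuadRes_cong[of n n0 p] by (simp add: n_def)
  have np: "0 < n" "n < p" using n QuadRes_0[of p] pos_mod_bound[of p n0] pos_mod_sign[of p n0] assms(2) by (auto simp: n_def order_less_le)
  have up: "\<not> QuadRes p (n + int k)" if "n + int k < p" for k
    using that
  proof (induction k)
    case (Suc k)
    then have "\<not> QuadRes p (n + int k)" by simp
    then have "\<not> QuadRes p (n + int k + 1)" using Suc.prems np by (intro step nd) auto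
    then show ?case by (simp add: ac_simps)
  qed (use n in simp)
  have up': "\<not> QuadRes p m" if "n \<le> m" "m < p" for m using up[of "nat (m - n)"] that by simp
  have m1: "\<not> QuadRes p (p - 1)" using np by (intro up') auto
  show False
  proof (cases "QuadRes p 2")
    case True
    define h where "h = (p - 1) div 2"
    have "odd p" using assms prime_odd_int by simp
    then have h: "2 * h = p - 1" by (auto simp: h_def elim: oddE)
    have "\<not> QuadRes p h" using QuadRes_mult[OF True, of h] m1 h by metis
    moreover have "QuadRes p (2 * (h + 1))"
      using QuadRes_cong[of "2 * (h + 1)" 1 p] h by (simp add: cong_iff_dvd_diff)
    then have "QuadRes p (h + 1)" using QuadRes_cancel[OF assms(1) _ True] nd[of 2] assms(2) by simp
    moreover have "\<not> p dvd h + 1" using nd[of "h + 1"] h assms(2) by linarith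
    ultimately show False using neg by blast
  next
    case False
    then have "\<not> QuadRes p 3" using step[of 2] nd[of 3] assms(2) by simp
    then have "\<not> QuadRes p 4" using step[of 3] nd[of 4] assms(2) by simp
    then show False using QuadRes_square[of p 2] by simp
  qed
qed

text \<open>Scaling by \<open>c\<close> reduces to distance 1. A nonsquare \<open>c\<close> is
  multiplied by two consecutive nonzero squares. For a square \<open>c\<close> two consecutive
  nonsquares are needed: if \<open>v\<close> is a nonsquare and \<open>v + 1\<close> a nonzero
  square, these are \<open>w = 1 / v\<close> and \<open>w + 1 = (v + 1) / v\<close>.\<close>

lemma nonsquares_at_distance:
  assumes "prime p" "p > 10" "\<not> p dvd c"
  shows "\<exists>s. \<not> QuadRes p s \<and> \<not> QuadRes p (s - c)"
proof (cases "QuadRes p c")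
  case True
  obtain v where v: "\<not> QuadRes p v" "QuadRes p (v + 1)" "\<not> p dvd v + 1" using nonsquare_then_square[OF assms(1,2)] by blast
  obtain w where w: "[v * w = 1] (mod p)" "\<not> p dvd w" using inverse_mod[OF assms(1)] v(1) QuadRes_dvd by blast
  have w1: "\<not> QuadRes p w"
  proof
    assume "QuadRes p w"
    moreover have "QuadRes p (w * v)" using QuadRes_cong[OF w(1)] by (simp add: mult.commute)
    ultimately show False using QuadRes_cancel[OF assms(1) w(2)] v(1) by blast
  qed
  have w2: "\<not> QuadRes p (w + 1)"
  proof
    assume "QuadRes p (w + 1)"
    moreover have "[(v + 1) * w = w + 1] (mod p)" using cong_add[OF w(1) cong_refl[of w]] by (simp add: algebra_simps)
    ultimately have "QuadRes p ((v + 1) * w)" using QuadRes_cong by blast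
    then show False using QuadRes_cancel[OF assms(1) v(3,2)] w1 by blast
  qed
  have "\<not> QuadRes p (c * (w + 1))" "\<not> QuadRes p (c * w)"
    using QuadRes_cancel[OF assms(1,3) True] w1 w2 by blast+
  moreover have "c * (w + 1) - c = c * w" by (simp add: algebra_simps)
  ultimately show ?thesis by metis
next
  case False
  obtain r where r: "QuadRes p r" "QuadRes p (r + 1)" "\<not> p dvd r" "\<not> p dvd r + 1" using consecutive_squares[OF assms(1,2)] by blast
  have "\<not> QuadRes p ((r + 1) * c)" "\<not> QuadRes p (r * c)"
    using QuadRes_cancel[OF assms(1) r(3,1)] QuadRes_cancel[OF assms(1) r(4,2)] False by blast+
  moreover have "(r + 1) * c - c = r * c" by (simp add: algebra_simps)
  ultimately show ?thesis by metis
qed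

text \<open>\<open>n * (D - n * z)\<close> is \<open>n * n\<close> times \<open>D / n - z\<close>.
  So \<open>D - z\<close> and \<open>D / n - z\<close> have to be nonsquares, two numbers whose
  distance does not depend on \<open>z\<close>; if the distance is 0, any nonsquare will do.\<close>

lemma nonsquare_pair_shift:
  fixes p :: int
  assumes "prime p" "p > 10" "\<not> QuadRes p n"
  shows "\<exists>z. \<not> QuadRes p (D - z) \<and> \<not> QuadRes p (n * (D - n * z))"
proof -
  have nn: "\<not> p dvd n" using assms(3) QuadRes_dvd by blast
  obtain m where m: "[n * m = 1] (mod p)" "\<not> p dvd m" using inverse_mod[OF assms(1) nn] by blast
  have "\<exists>z. \<not> QuadRes p (D - z) \<and> \<not> QuadRes p (m * D - z)"
  proof (cases "p dvd D - m * D")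
    case False
    then obtain s where s: "\<not> QuadRes p s" "\<not> QuadRes p (s - (D - m * D))" using nonsquares_at_distance[OF assms(1,2)] by blast
    have "D - (D - s) = s" "m * D - (D - s) = s - (D - m * D)" by simp_all
    then show ?thesis using s by metis
  next
    case True
    then have "[D = m * D] (mod p)" by (simp add: cong_iff_dvd_diff)
    then have "[D - (D - n) = m * D - (D - n)] (mod p)" by (intro cong_diff cong_refl)
    then show ?thesis using assms(3) QuadRes_cong by (metis diff_diff_eq2 add_diff_cancel_left')
  qed
  then obtain z where z: "\<not> QuadRes p (D - z)" "\<not> QuadRes p (m * D - z)" by blast
  have "\<not> QuadRes p (n * (D - n * z))"
  proof
    assume a: "QuadRes p (n * (D - n * z))"
    have "[(n * n) * (m * D - z) = n * (1 * D - n * z)] (mod p)"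
    proof -
      have "[n * ((n * m) * D - n * z) = n * (1 * D - n * z)] (mod p)" using m(1) by (intro cong_mult cong_diff cong_refl)
      then show ?thesis by (simp add: algebra_simps)
    qed
    then have "QuadRes p ((n * n) * (m * D - z))" using a QuadRes_cong by fastforce
    moreover have "\<not> p dvd n * n" using nn assms(1) by (simp add: prime_dvd_mult_iff)
    ultimately show False using QuadRes_cancel[OF assms(1) _ QuadRes_square] z(2) by blast
  qed
  then show ?thesis using z by blast
qed

text \<open>The congruence would make \<open>X * (X * x + Y * y)\<close> congruent to
  \<open>X * (D - X * z)\<close>. Under \<open>R1\<close> and \<open>R2\<close> the former is always
  a square, and under \<open>R3\<close> the latter is a nonsquare for both values 1 and
  \<open>n\<close> of \<open>X\<close>, so that \<open>z\<close> can be chosen without knowing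
  \<open>X\<close>. Two values of \<open>X\<close> are enough because multiplication by
  \<open>n\<close> turns a nonsquare \<open>2 * n * E\<close> into a square.\<close>

lemma square_class_game:
  fixes p :: int
  assumes "prime p" "p > 10"
  shows "\<exists>R1 R2 R3. (\<forall>E. \<exists>X Y. R1 X Y \<and> [X - Y = E] (mod p)) \<and> (\<forall>E. \<exists>x y. R2 x y \<and> [x - y = E] (mod p)) \<and>
    (\<forall>D. \<exists>z. R3 D z) \<and> (\<forall>X Y x y z D. R1 X Y \<longrightarrow> R2 x y \<longrightarrow> R3 D z \<longrightarrow> \<not> [X * (x + z) + Y * y = D] (mod p))"
proof -
  obtain n where n: "\<not> QuadRes p n" using nonsquare_exists assms by force
  have nn: "\<not> p dvd n" using n QuadRes_dvd by blast
  have p2: "p > 2" using assms by simp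
  have n2: "\<not> p dvd 2" using assms zdvd_not_zless[of 2 p] by simp
  define R1 where "R1 X Y \<longleftrightarrow> (X = 1 \<or> X = n) \<and> QuadRes p (2 * n * X * (X - Y))" for X Y
  define R2 where "R2 x y \<longleftrightarrow> y = 0 \<and> QuadRes p x \<or> y = - x \<and> \<not> QuadRes p (2 * x)" for x y
  define R3 where "R3 D z \<longleftrightarrow> \<not> QuadRes p (D - z) \<and> \<not> QuadRes p (n * (D - n * z))" for D z
  have "\<exists>X Y. R1 X Y \<and> [X - Y = E] (mod p)" for E
  proof (cases "QuadRes p (2 * n * E)")
    case True
    then show ?thesis by (intro exI[of _ 1] exI[of _ "1 - E"]) (simp add: R1_def)
  next
    case False
    then have "QuadRes p (n * (2 * n * E))" using nonsquare_mult[OF assms(1) p2 n] by blast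
    then show ?thesis by (intro exI[of _ n] exI[of _ "n - E"]) (simp add: R1_def ac_simps)
  qed
  moreover have "\<exists>x y. R2 x y \<and> [x - y = E] (mod p)" for E
  proof (cases "QuadRes p E")
    case True
    then show ?thesis by (intro exI[of _ E] exI[of _ 0]) (simp add: R2_def)
  next
    case False
    obtain h where h: "[2 * h = 1] (mod p)" using inverse_mod[OF assms(1) n2] by blast
    have "[2 * (h * E) = E] (mod p)" using cong_mult[OF h cong_refl[of E]] by (simp add: mult.assoc)
    moreover have "h * E - - (h * E) = 2 * (h * E)" by (simp only: diff_minus_eq_add mult_2)
    ultimately have "\<not> QuadRes p (2 * (h * E))" "[h * E - - (h * E) = E] (mod p)" using False QuadRes_cong by (blast, metis)
    then show ?thesis unfolding R2_def by blast
  qed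
  moreover have "\<exists>z. R3 D z" for D using nonsquare_pair_shift[OF assms n] R3_def by blast
  moreover have "\<not> [X * (x + z) + Y * y = D] (mod p)" if r: "R1 X Y" "R2 x y" "R3 D z" for X Y x y z D
  proof
    assume c: "[X * (x + z) + Y * y = D] (mod p)"
    have X: "X = 1 \<or> X = n" using r(1) R1_def by simp
    then have ns: "\<not> QuadRes p (X * (D - X * z))" using r(3) R3_def by auto
    have "[X * (X * (x + z) + Y * y - X * z) = X * (D - X * z)] (mod p)" using c by (intro cong_mult cong_diff cong_refl)
    then have ns2: "\<not> QuadRes p (X * (X * x + Y * y))" using ns QuadRes_cong by (simp add: algebra_simps)
    consider "y = 0" "QuadRes p x" | "y = - x" "\<not> QuadRes p (2 * x)" using r(2) R2_def by auto
    then show False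
    proof cases
      case 1
      then have "QuadRes p ((X * X) * x)" using QuadRes_mult[OF QuadRes_square] by blast
      then show False using ns2 1 by (simp add: mult.assoc)
    next
      case 2
      have "QuadRes p ((2 * x) * n)" using nonsquare_mult[OF assms(1) p2 2(2) n] .
      moreover have "QuadRes p (2 * n * X * (X - Y))" using r(1) R1_def by simp
      ultimately have "QuadRes p (((2 * x) * n) * (2 * n * X * (X - Y)))" by (rule QuadRes_mult)
      moreover have "((2 * x) * n) * (2 * n * X * (X - Y)) = ((2 * n) * (2 * n)) * (X * (X * x + Y * y))"
        using 2(1) by (simp add: algebra_simps)
      ultimately have "QuadRes p (((2 * n) * (2 * n)) * (X * (X * x + Y * y)))" by simp
      moreover have "\<not> p dvd (2 * n) * (2 * n)" using nn n2 assms(1) by (metis prime_dvd_multD)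
      ultimately show False using QuadRes_cancel[OF assms(1) _ QuadRes_square] ns2 by blast
    qed
  qed
  ultimately show ?thesis by (intro exI[of _ R1] exI[of _ R2] exI[of _ R3]) blast
qed

lemma quadratic_misses:
  fixes p :: int
  assumes "prime p" "p > 2"
  shows "\<exists>s. \<forall>y. \<not> [y * y + a * y + b = s] (mod p)"
proof -
  obtain n where n: "\<not> QuadRes p n" using nonsquare_exists assms by blast
  have "\<not> p dvd 2" using assms zdvd_not_zless[of 2 p] by simp
  then have "\<not> p dvd 4" using assms(1) prime_dvd_multD[of p 2 2] by auto
  then obtain q where q: "[4 * q = 1] (mod p)" using inverse_mod[OF assms(1)] by blast
  \<comment> \<open>\<open>q\<close> is the inverse of 4; completing the square turns a hit of
    \<open>s\<close> into the statement that the nonsquare \<open>n\<close> is the square of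
    \<open>2 * y + a\<close>.\<close>
  define s where "s = b + q * (n - a * a)"
  have "\<not> [y * y + a * y + b = s] (mod p)" for y
  proof
    assume "[y * y + a * y + b = s] (mod p)"
    then have "[4 * (y * y + a * y + b) - 4 * b + a * a = 4 * s - 4 * b + a * a] (mod p)" by (intro cong_mult cong_add cong_diff cong_refl)
    moreover have "4 * (y * y + a * y + b) - 4 * b + a * a = (2 * y + a) * (2 * y + a)" by (simp add: algebra_simps)
    moreover have "4 * s - 4 * b + a * a = 4 * q * (n - a * a) + a * a" by (simp add: s_def algebra_simps)
    ultimately have "[(2 * y + a) * (2 * y + a) = 4 * q * (n - a * a) + a * a] (mod p)" by simp
    also have "[4 * q * (n - a * a) + a * a = 1 * (n - a * a) + a * a] (mod p)" using q by (intro cong_add cong_mult cong_refl)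
    finally have "[(2 * y + a) * (2 * y + a) = n] (mod p)" by simp
    then show False using n QuadRes_iff by blast
  qed
  then show ?thesis by blast
qed

text \<open>Two classes shall supply their vertices \<open>X - D\<close> as multipliers although
  their other vertices are joined by an edge. A multiple \<open>n * w\<close> of size at most
  \<open>p / K\<close> times a rounded multiple of \<open>p / n\<close> is nearly a multiple of
  \<open>p\<close>, which suggests \<open>A1\<close> and \<open>A2\<close>. Nevertheless
  \<open>K\<close> times \<open>A1\<close> runs through a whole period in steps of
  \<open>K * n\<close>, and \<open>A2\<close> comes within about \<open>p / n\<close> of every
  residue.\<close>

lemma adjacent_movers:
  fixes N V :: int and \<epsilon> :: real
  assumes "N > 0" "\<epsilon> > 0"
  shows "\<exists>K::int. \<forall>\<^sub>F p in at_top. \<exists>A1 A2. (\<forall>t D. \<exists>X\<in>A1. near p \<epsilon> (K * (X - D) - t)) \<and>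
    (\<forall>D. \<exists>X\<in>A2. near p \<epsilon> (V * (X - D)) \<and> near p \<epsilon> (K * (X - D) - p div N)) \<and>
    (\<forall>X\<in>A1. \<forall>X'\<in>A2. near p \<epsilon> (X * X'))"
proof -
  \<comment> \<open>\<open>K \<ge> 1 / \<epsilon>\<close> bounds the error of the products, and
    \<open>K \<ge> 4 * \<bar>V\<bar> / \<epsilon>\<close> makes a shift of size
    \<open>p / (N * K)\<close> harmless after multiplication by \<open>V\<close>. The choice of
    \<open>n\<close> does the same for the gaps of about \<open>p / n\<close> in \<open>A2\<close>,
    multiplied by \<open>K\<close> or \<open>V\<close>.\<close>
  define K where "K = max 1 (max \<lceil>1 / \<epsilon>\<rceil> \<lceil>4 * \<bar>V\<bar> / \<epsilon>\<rceil>)"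
  define n where "n = max 1 (max \<lceil>8 * K / \<epsilon>\<rceil> \<lceil>8 * \<bar>V\<bar> / \<epsilon>\<rceil>)"
  have K: "K > 0" "K \<ge> \<lceil>1 / \<epsilon>\<rceil>" "K \<ge> \<lceil>4 * \<bar>V\<bar> / \<epsilon>\<rceil>" by (simp_all add: K_def)
  have n: "n > 0" "n \<ge> \<lceil>8 * K / \<epsilon>\<rceil>" "n \<ge> \<lceil>8 * \<bar>V\<bar> / \<epsilon>\<rceil>" by (simp_all add: n_def)
  have K': "\<epsilon> * K \<ge> 1" "\<epsilon> * K \<ge> 4 * \<bar>V\<bar>"
    using K(2,3) assms(2) by (simp_all add: ceiling_le_iff field_simps)
  have n': "\<epsilon> * n \<ge> 8 * K" "\<epsilon> * n \<ge> 8 * \<bar>V\<bar>"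
    using n(2,3) assms(2) by (simp_all add: ceiling_le_iff field_simps)
  define p0 where "p0 = max n (max \<lceil>K * n / \<epsilon>\<rceil> (max \<lceil>4 * K / \<epsilon>\<rceil> \<lceil>4 * \<bar>V\<bar> / \<epsilon>\<rceil>))"
  show ?thesis
  proof (rule exI[of _ K], rule eventually_mono[OF eventually_ge_at_top[of p0]])
    fix p assume "p0 \<le> p"
    then have "n \<le> p" "\<lceil>K * n / \<epsilon>\<rceil> \<le> p" "\<lceil>4 * K / \<epsilon>\<rceil> \<le> p" "\<lceil>4 * \<bar>V\<bar> / \<epsilon>\<rceil> \<le> p" by (simp_all add: p0_def)
    then have p: "p \<ge> n" "\<epsilon> * p \<ge> K * n" "\<epsilon> * p \<ge> 4 * K" "\<epsilon> * p \<ge> 4 * \<bar>V\<bar>"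
      using assms(2) by (simp_all add: ceiling_le_iff field_simps)
    have p1: "p \<ge> 1" using p(1) n(1) by simp
    define A1 where "A1 = {n * w | w. 0 \<le> w \<and> K * n * w \<le> p}"
    define A2 where "A2 = {(i * p) div n | i. 0 \<le> i \<and> i < n}"
    have "\<exists>X\<in>A1. near p \<epsilon> (K * (X - D) - t)" for t D
    proof -
      define r where "r = (t + K * D) mod p"
      define w where "w = r div (K * n)"
      have Kn: "K * n > 0" using K n by simp
      have r: "0 \<le> r" "r < p" using p1 by (simp_all add: r_def)
      have w: "K * n * w + r mod (K * n) = r" unfolding w_def by simp
      have rm: "0 \<le> r mod (K * n)" "r mod (K * n) < K * n" using Kn by simp_all
      have "w \<ge> 0" unfolding w_def using r Kn by (simp add: pos_imp_zdiv_nonneg_iff)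
      then have "n * w \<in> A1" unfolding A1_def using w rm r by auto
      moreover have "near p \<epsilon> (K * (n * w - D) - t)"
      proof -
        have "t + K * D = p * ((t + K * D) div p) + r" unfolding r_def by simp
        then have "K * (n * w - D) - t - p * (- ((t + K * D) div p)) = - (r mod (K * n))"
          using w by (simp add: algebra_simps)
        then have "\<bar>real_of_int (K * (n * w - D) - t - p * (- ((t + K * D) div p)))\<bar> = real_of_int (r mod (K * n))"
          using rm by simp
        also have "\<dots> \<le> real_of_int (K * n)" using rm by linarith
        also have "\<dots> \<le> \<epsilon> * p" using p by simp
        finally show ?thesis by (rule nearI)
      qed
      ultimately show ?thesis by blast
    qed
    moreover have "\<exists>X\<in>A2. near p \<epsilon> (V * (X - D)) \<and> near p \<epsilon> (K * (X - D) - p div N)" for D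
    proof -
      \<comment> \<open>\<open>X\<close> will be close to \<open>D + b\<close>, so that
        \<open>X - D\<close> is about \<open>p / (N * K)\<close>: small after multiplication by
        \<open>V\<close>, but about \<open>p / N\<close> after multiplication by
        \<open>K\<close>.\<close>
      define b where "b = p div (N * K)"
      define \<theta> where "\<theta> = (D + b) mod p"
      define i where "i = (\<theta> * n) div p"
      define X where "X = (i * p) div n"
      define e where "e = \<theta> - X"
      have t: "0 \<le> \<theta>" "\<theta> < p" using p1 by (simp_all add: \<theta>_def)
      have i1: "p * i + (\<theta> * n) mod p = \<theta> * n" unfolding i_def by simp
      have i2: "0 \<le> (\<theta> * n) mod p" "(\<theta> * n) mod p < p" using p1 by simp_all
      have "i \<ge> 0" unfolding i_def using t n p1 by (simp add: pos_imp_zdiv_nonneg_iff)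
      have "p * i < p * n"
      proof -
        have "\<theta> * n < p * n" using t n by simp
        then show ?thesis using i1 i2 by linarith
      qed
      then have "i < n" using p1 by simp
      then have XA: "X \<in> A2" unfolding A2_def X_def using \<open>i \<ge> 0\<close> by auto
      have X1: "n * X + (i * p) mod n = i * p" unfolding X_def by simp
      have X2: "0 \<le> (i * p) mod n" "(i * p) mod n < n" using n by simp_all
      have ne: "n * e = (\<theta> * n) mod p + (i * p) mod n" unfolding e_def using i1 X1 by (simp add: algebra_simps)
      have "n * e \<ge> 0" using ne i2 X2 by linarith
      then have e0: "e \<ge> 0" using n(1) by (simp add: zero_le_mult_iff)
      have "n * e \<le> 2 * p" using ne i2 X2 p(1) by linarith
      then have "real_of_int (n * e) \<le> real_of_int (2 * p)" by (simp only: of_int_le_iff)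
      then have ne': "real_of_int n * e \<le> 2 * real_of_int p" by simp
      have "D + b = p * ((D + b) div p) + \<theta>" unfolding \<theta>_def by simp
      then have XD: "X - D = b - e - p * ((D + b) div p)" unfolding e_def by simp
      have NK: "N * K > 0" using assms K by simp
      have b: "b \<ge> 0" "N * K * b \<le> p" "p - N * K * b < N * K"
      proof -
        show "b \<ge> 0" unfolding b_def using p1 NK by (simp add: pos_imp_zdiv_nonneg_iff)
        have "N * K * b + p mod (N * K) = p" unfolding b_def by simp
        then show "N * K * b \<le> p" "p - N * K * b < N * K" using pos_mod_bound[OF NK, of p] pos_mod_sign[OF NK, of p] by linarith+
      qed
      have Kb: "K * b \<le> p"
      proof -
        have "1 * (K * b) \<le> N * (K * b)" using assms K b by (intro mult_right_mono) auto
        then show ?thesis using b by (simp add: mult.assoc)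
      qed
      have pN: "\<bar>K * b - p div N\<bar> \<le> K"
      proof -
        have "N * (p div N) + p mod N = p" by simp
        moreover have "0 \<le> p mod N" "p mod N < N" using assms by simp_all
        ultimately have "N * K * b - N * (p div N) < N" "N * K * b - N * (p div N) > - (N * K)" using b(2,3) by linarith+
        moreover have "N * K * b - N * (p div N) = N * (K * b - p div N)" by (simp only: right_diff_distrib mult.assoc)
        ultimately have "N * (K * b - p div N) < N * 1" "N * (- K) < N * (K * b - p div N)" by simp_all
        then have "K * b - p div N < 1" "K * b - p div N > - K" 
          using assms(1) by (simp_all only: mult_less_cancel_left_pos)
        then show ?thesis using K by simp
      qed
      have le: "real_of_int c * e \<le> \<epsilon> / 4 * p" if c: "8 * c \<le> \<epsilon> * n" for c :: int
      proof -
        have "8 * real_of_int c * e \<le> \<epsilon> * n * e" using c e0 by (intro mult_right_mono) auto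
        also have "\<dots> = \<epsilon> * (real_of_int n * e)" by simp
        also have "\<dots> \<le> \<epsilon> * (2 * p)" using ne' assms by (intro mult_left_mono) auto
        finally show ?thesis by simp
      qed
      have Ve: "real_of_int (\<bar>V\<bar> * e) \<le> \<epsilon> / 4 * p" using le[of "\<bar>V\<bar>"] n'(2) by simp
      have Ke: "real_of_int (K * e) \<le> \<epsilon> / 4 * p" using le[of K] n'(1) by simp
      have Vb: "real_of_int (\<bar>V\<bar> * b) \<le> \<epsilon> / 4 * p"
      proof -
        have "4 * real_of_int \<bar>V\<bar> * b \<le> \<epsilon> * K * b" using K'(2) b by (intro mult_right_mono) auto
        also have "\<dots> = \<epsilon> * real_of_int (K * b)" by simp
        also have "\<dots> \<le> \<epsilon> * p" using Kb assms(2) by (intro mult_left_mono) (auto simp only: of_int_le_iff)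
        finally show ?thesis by simp
      qed
      have "near p \<epsilon> (V * (X - D))"
      proof (rule nearI)
        have "V * (X - D) - p * (- (V * ((D + b) div p))) = V * b - V * e" unfolding XD by (simp add: algebra_simps)
        moreover have "\<bar>V * b - V * e\<bar> \<le> \<bar>V\<bar> * b + \<bar>V\<bar> * e"
          using abs_triangle_ineq4[of "V * b" "V * e"] e0 b(1) by (simp add: abs_mult)
        ultimately have "\<bar>V * (X - D) - p * (- (V * ((D + b) div p)))\<bar> \<le> \<bar>V\<bar> * b + \<bar>V\<bar> * e" by simp
        then have "real_of_int \<bar>V * (X - D) - p * (- (V * ((D + b) div p)))\<bar> \<le> real_of_int (\<bar>V\<bar> * b + \<bar>V\<bar> * e)" by (simp only: of_int_le_iff)
        also have "\<dots> \<le> \<epsilon> / 4 * p + \<epsilon> / 4 * p" using Vb Ve unfolding of_int_add by linarith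
        also have "\<dots> \<le> \<epsilon> * p" using assms(2) p1 by simp
        finally show "\<bar>real_of_int (V * (X - D) - p * (- (V * ((D + b) div p))))\<bar> \<le> \<epsilon> * p" by (simp only: of_int_abs)
      qed
      moreover have "near p \<epsilon> (K * (X - D) - p div N)"
      proof (rule nearI)
        have "K * (X - D) - p div N - p * (- (K * ((D + b) div p))) = (K * b - p div N) - K * e" unfolding XD by (simp add: algebra_simps)
        moreover have "\<bar>(K * b - p div N) - K * e\<bar> \<le> K + K * e"
          using abs_triangle_ineq4[of "K * b - p div N" "K * e"] pN e0 K(1) by (simp add: abs_mult)
        ultimately have "\<bar>K * (X - D) - p div N - p * (- (K * ((D + b) div p)))\<bar> \<le> K + K * e" by simp
        then have "real_of_int \<bar>K * (X - D) - p div N - p * (- (K * ((D + b) div p)))\<bar> \<le> real_of_int (K + K * e)" by (simp only: of_int_le_iff)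
        also have "\<dots> \<le> \<epsilon> / 4 * p + \<epsilon> / 4 * p" using Ke p(3) unfolding of_int_add by linarith
        also have "\<dots> \<le> \<epsilon> * p" using assms(2) p1 by simp
        finally show "\<bar>real_of_int (K * (X - D) - p div N - p * (- (K * ((D + b) div p))))\<bar> \<le> \<epsilon> * p" by (simp only: of_int_abs)
      qed
      ultimately show ?thesis using XA by blast
    qed
    moreover have "near p \<epsilon> (X * X')" if "X \<in> A1" "X' \<in> A2" for X X'
    proof -
      obtain w i where w: "X = n * w" "0 \<le> w" "K * n * w \<le> p" and i: "X' = (i * p) div n"
        using \<open>X \<in> A1\<close> \<open>X' \<in> A2\<close> unfolding A1_def A2_def by blast
      have X1: "n * X' + (i * p) mod n = i * p" unfolding i by simp
      have X2: "0 \<le> (i * p) mod n" "(i * p) mod n < n" using n by simp_all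
      show ?thesis
      proof (rule nearI)
        have "n * w * X' = w * (n * X')" by simp
        also have "n * X' = i * p - (i * p) mod n" using X1 by linarith
        finally have "X * X' - p * (w * i) = - (w * ((i * p) mod n))" unfolding w(1) by (simp add: algebra_simps)
        moreover have "w * ((i * p) mod n) \<le> w * n" "0 \<le> w * ((i * p) mod n)" using X2 w(2) by (simp_all add: mult_left_mono)
        ultimately have "\<bar>X * X' - p * (w * i)\<bar> \<le> w * n" by simp
        then have "real_of_int \<bar>X * X' - p * (w * i)\<bar> \<le> real_of_int (w * n)" by (simp only: of_int_le_iff)
        also have "\<dots> \<le> (\<epsilon> * K) * real_of_int (w * n)"
          using K'(1) w(2) n(1) mult_right_mono[of 1 "\<epsilon> * K" "real_of_int (w * n)"] by simp
        also have "\<dots> = \<epsilon> * real_of_int (K * n * w)" by simp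
        also have "\<dots> \<le> \<epsilon> * p" using w(3) assms(2) by (intro mult_left_mono) (auto simp only: of_int_le_iff)
        finally show "\<bar>real_of_int (X * X' - p * (w * i))\<bar> \<le> \<epsilon> * p" by (simp only: of_int_abs)
      qed
    qed
    ultimately show "\<exists>A1 A2. (\<forall>t D. \<exists>X\<in>A1. near p \<epsilon> (K * (X - D) - t)) \<and>
    (\<forall>D. \<exists>X\<in>A2. near p \<epsilon> (V * (X - D)) \<and> near p \<epsilon> (K * (X - D) - p div N)) \<and>
    (\<forall>X\<in>A1. \<forall>X'\<in>A2. near p \<epsilon> (X * X'))" by blast
  qed
qed

section \<open>Configurations\<close>

lemma cover_iff: "cover p S \<longleftrightarrow> (\<forall>D. \<exists>f\<in>S. [f b - f (\<not> b) = D] (mod p))"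
proof (cases b)
  case False
  have flip: "[f False - f True = D] (mod p) \<longleftrightarrow> [f True - f False = - D] (mod p)" for D :: int and f :: "bool \<Rightarrow> int"
    using cong_minus_minus_iff[of "f True - f False" "- D" p] by simp
  show ?thesis
  proof
    assume "cover p S"
    then have "\<exists>f\<in>S. [f True - f False = - D] (mod p)" for D unfolding cover_def by blast
    then show "\<forall>D. \<exists>f\<in>S. [f b - f (\<not> b) = D] (mod p)" using False by (simp add: flip)
  next
    assume "\<forall>D. \<exists>f\<in>S. [f b - f (\<not> b) = D] (mod p)"
    then have "\<exists>f\<in>S. [f True - f False = - D] (mod p)" for D using False by (simp add: flip)
    from this[of "- _"] show "cover p S" unfolding cover_def by simp
  qed
qed (simp add: cover_def)

lemma cover_UNIV: "cover p UNIV"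
  unfolding cover_def
proof
  fix D
  show "\<exists>f\<in>UNIV. [f True - f False = D] (mod p)" by (rule bexI[of _ "\<lambda>b. if b then D else 0"]) simp_all
qed

lemma coverI:
  assumes "\<And>D. P (h D) (h D - D)"
  shows "cover p {f. P (f b) (f (\<not> b))}"
  unfolding cover_iff[of _ _ b]
proof
  fix D
  have "(\<lambda>b'. if b' = b then h D else h D - D) \<in> {f. P (f b) (f (\<not> b))}" using assms[of D] by simp
  then show "\<exists>f\<in>{f. P (f b) (f (\<not> b))}. [f b - f (\<not> b) = D] (mod p)" by (rule bexI[rotated]) simp
qed

lemma cover_fixed: "cover p {f. f b = a}"
  using coverI[of "\<lambda>x y. x = a" "\<lambda>_. a" p b] by simp

text \<open>For the difference \<open>D\<close> the condition reads
  \<open>(a + a') * x = a' * D\<close>, and \<open>a + a'\<close> is invertible.\<close>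

lemma cover_kernel:
  assumes "prime p" "\<not> p dvd a + a'"
  shows "cover p {f. [a * f b + a' * f (\<not> b) = 0] (mod p)}"
proof -
  obtain r where r: "[(a + a') * r = 1] (mod p)" using inverse_mod[OF assms] by blast
  have "[a * (r * a' * D) + a' * (r * a' * D - D) = 0] (mod p)" for D
  proof -
    have "[(a + a') * r * (a' * D) - a' * D = 1 * (a' * D) - a' * D] (mod p)" using r by (intro cong_diff cong_mult cong_refl)
    then show ?thesis by (simp add: algebra_simps)
  qed
  then show ?thesis using coverI[of "\<lambda>x y. [a * x + a' * y = 0] (mod p)" "\<lambda>D. r * a' * D" p b] by simp
qed

text \<open>The classes in \<open>A\<close> commit themselves to \<open>T\<close> and thereby drop
  out of the game: for such choices \<open>F'\<close> is a constant shift of \<open>F\<close>, and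
  \<open>F\<close> does not look at \<open>A\<close>.\<close>

lemma avoidable_restrict:
  assumes "avoidable p F" "\<And>c. c \<in> A \<Longrightarrow> cover p (T c)"
    and E: "\<And>g. (\<And>c. c \<in> A \<Longrightarrow> g c \<in> T c) \<Longrightarrow> [F' g = F g + t] (mod p)"
    and dep: "\<And>g g'. (\<And>c. c \<notin> A \<Longrightarrow> g c = g' c) \<Longrightarrow> F g = F g'"
  shows "avoidable p F'"
proof -
  obtain S s where S: "\<forall>c. cover p (S c)" "\<forall>g. (\<forall>c. g c \<in> S c) \<longrightarrow> \<not> [F g = s] (mod p)"
    using assms(1) unfolding avoidable_def by blast
  define S' where "S' c = (if c \<in> A then T c else S c)" for c
  have "\<not> [F' g = s + t] (mod p)" if g: "\<forall>c. g c \<in> S' c" for g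
  proof
    assume a: "[F' g = s + t] (mod p)"
    have "\<exists>f. f \<in> S c" for c using S(1) unfolding cover_def by blast
    then obtain f where f: "\<And>c. f c \<in> S c" by metis
    define g' where "g' c = (if c \<in> A then f c else g c)" for c
    have "g' c \<in> S c" for c using f g by (metis S'_def g'_def)
    moreover have "F g = F g'" by (rule dep) (simp add: g'_def)
    moreover have "[F' g = F g + t] (mod p)" using g by (intro E) (metis S'_def)
    then have "[F g + t = s + t] (mod p)" using a cong_sym cong_trans by blast
    then have "[F g = s] (mod p)" by (simp add: cong_add_rcancel)
    ultimately show False using S(2) by simp
  qed
  moreover have "\<forall>c. cover p (S' c)" using S(1) assms(2) by (simp add: S'_def)
  ultimately show ?thesis unfolding avoidable_def by blast
qed

lemma avoidable_add_constant:
  assumes "avoidable p F" "\<And>c. c \<in> A \<Longrightarrow> cover p (T c)"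
    and E: "\<And>g. (\<And>c. c \<in> A \<Longrightarrow> g c \<in> T c) \<Longrightarrow> [E g = t] (mod p)"
    and dep: "\<And>g g'. (\<And>c. c \<notin> A \<Longrightarrow> g c = g' c) \<Longrightarrow> F g = F g'"
  shows "avoidable p (\<lambda>g. F g + E g)"
proof (rule avoidable_restrict[of p F A T, OF assms(1,2)])
  show "[F g + E g = F g + t] (mod p)" if "\<And>c. c \<in> A \<Longrightarrow> g c \<in> T c" for g
    using E[OF that] by (intro cong_add cong_refl)
qed (use dep in blast)+

section \<open>Linear parts and primes that are large for their coefficients\<close>

definition linear_part :: "'c set \<Rightarrow> ('c \<Rightarrow> bool \<Rightarrow> nat) \<Rightarrow> ('c \<Rightarrow> bool \<Rightarrow> int) \<Rightarrow> int" where
  "linear_part C U g = (\<Sum>c\<in>C. int (U c True) * g c True + int (U c False) * g c False)"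

lemma linear_part_remove:
  assumes "finite C" "c \<in> C"
  shows "linear_part C U g = int (U c b) * g c b + int (U c (\<not> b)) * g c (\<not> b) + linear_part (C - {c}) U g"
  unfolding linear_part_def using assms by (cases b) (simp_all add: sum.remove[of C c])

text \<open>The bound 10 comes from the lemmas on squares. The other bound keeps a positive sum of
  the two coefficients of a class invertible, even after 1 has been added to each because a
  neighbouring vertex was fixed at 1.\<close>

definition large_for :: "'c set \<Rightarrow> ('c \<Rightarrow> bool \<Rightarrow> nat) \<Rightarrow> int \<Rightarrow> bool" where
  "large_for C U p \<longleftrightarrow> prime p \<and> p > 10 \<and> (\<forall>c\<in>C. int (U c True) + int (U c False) + 2 < p)"

lemma eventually_large_for:
  assumes "finite C" shows "\<forall>\<^sub>F p in at_top. prime p \<longrightarrow> large_for C U p"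
proof -
  define B where "B = (\<Sum>c\<in>C. int (U c True) + int (U c False))"
  have le: "int (U c True) + int (U c False) \<le> B" if "c \<in> C" for c
    unfolding B_def using that assms by (intro member_le_sum[of _ _ "\<lambda>c. int (U c True) + int (U c False)"]) auto
  then have "prime p \<longrightarrow> large_for C U p" if "p \<ge> max 11 (B + 3)" for p
    unfolding large_for_def
  proof (intro impI conjI ballI)
    fix c assume "c \<in> C"
    from le[OF this] show "int (U c True) + int (U c False) + 2 < p" using that by linarith
  qed (use that in auto)
  then show ?thesis unfolding eventually_at_top_linorder by blast
qed

lemma large_forD:
  assumes "large_for C U p"
  shows "prime p" "p > 10" "p > 2" "\<not> p dvd 2" "c \<in> C \<Longrightarrow> int (U c b) + int (U c (\<not> b)) + 2 < p"
proof -
  show "prime p" "p > 10" "p > 2" "\<not> p dvd 2" using assms zdvd_not_zless[of 2 p] unfolding large_for_def by auto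
  assume "c \<in> C"
  then have "int (U c True) + int (U c False) + 2 < p" using assms unfolding large_for_def by blast
  then show "int (U c b) + int (U c (\<not> b)) + 2 < p" by (cases b) simp_all
qed

lemma avoidable_add_linear_part:
  assumes "avoidable p F" "large_for C U p" "finite C" "C' \<subseteq> C"
    and dep: "\<And>g g'. (\<And>c. c \<notin> C' \<Longrightarrow> g c = g' c) \<Longrightarrow> F g = F g'"
  shows "avoidable p (\<lambda>g. F g + linear_part C' U g)"
proof (rule avoidable_add_constant[OF assms(1), where A = C' and t = 0
      and T = "\<lambda>c. {f. [int (U c True) * f True + int (U c False) * f False = 0] (mod p)}"])
  fix c assume c: "c \<in> C'"
  show "cover p {f. [int (U c True) * f True + int (U c False) * f False = 0] (mod p)}"
  proof (cases "U c True + U c False = 0")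
    case True then show ?thesis using cover_UNIV by simp
  next
    case False
    then have "0 < int (U c True) + int (U c False)" by linarith
    moreover have "c \<in> C" using c assms(4) by blast
    then have "int (U c True) + int (U c False) + 2 < p" using assms(2) unfolding large_for_def by blast
    then have "int (U c True) + int (U c False) < p" by linarith
    ultimately have "\<not> p dvd int (U c True) + int (U c False)" using zdvd_not_zless by blast
    then show ?thesis using cover_kernel[of p "int (U c True)" "int (U c False)" True] assms(2) by (simp add: large_for_def)
  qed
next
  fix g assume "\<And>c. c \<in> C' \<Longrightarrow> g c \<in> {f. [int (U c True) * f True + int (U c False) * f False = 0] (mod p)}"
  then have "[linear_part C' U g = (\<Sum>c\<in>C'. 0)] (mod p)" unfolding linear_part_def by (intro cong_sum) auto
  then show "[linear_part C' U g = 0] (mod p)" by simp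
qed (rule dep)

text \<open>All other classes occur only linearly and can keep their contribution at 0 modulo
  \<open>p\<close>, so the game is decided by the two classes that \<open>P\<close>
  involves.\<close>

lemma avoid2:
  assumes C: "finite C" "c1 \<in> C" "c2 \<in> C" "c1 \<noteq> c2" and p: "large_for C U p"
    and T: "cover p T1" "cover p T2"
    and main: "\<And>f1 f2. f1 \<in> T1 \<Longrightarrow> f2 \<in> T2 \<Longrightarrow> \<not> [P f1 f2 + (int (U c1 b1) * f1 b1 + int (U c1 (\<not> b1)) * f1 (\<not> b1))
        + (int (U c2 b2) * f2 b2 + int (U c2 (\<not> b2)) * f2 (\<not> b2)) = s] (mod p)"
    and F: "\<And>g. F g = P (g c1) (g c2) + linear_part C U g"
  shows "avoidable p F"
proof -
  define F' where "F' g = P (g c1) (g c2) + (int (U c1 b1) * g c1 b1 + int (U c1 (\<not> b1)) * g c1 (\<not> b1))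
        + (int (U c2 b2) * g c2 b2 + int (U c2 (\<not> b2)) * g c2 (\<not> b2))" for g
  have "avoidable p F'"
    unfolding avoidable_def
  proof (intro exI[of _ "\<lambda>c. if c = c1 then T1 else if c = c2 then T2 else UNIV"] exI[of _ s] conjI allI impI)
    fix g assume g: "\<forall>c. g c \<in> (if c = c1 then T1 else if c = c2 then T2 else UNIV)"
    have "g c1 \<in> T1" "g c2 \<in> T2" using g[rule_format, of c1] g[rule_format, of c2] C by simp_all
    then show "\<not> [F' g = s] (mod p)" unfolding F'_def by (rule main)
  qed (use T cover_UNIV in simp)
  then have "avoidable p (\<lambda>g. F' g + linear_part (C - {c1} - {c2}) U g)"
    by (rule avoidable_add_linear_part[OF _ p C(1)]) (auto simp: F'_def)
  moreover have "F g = F' g + linear_part (C - {c1} - {c2}) U g" for g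
    unfolding F F'_def using C by (simp add: linear_part_remove[of C c1 U g b1] linear_part_remove[of "C - {c1}" c2 U g b2])
  ultimately show ?thesis by presburger
qed

lemma avoid3:
  assumes C: "finite C" "c1 \<in> C" "c2 \<in> C" "c3 \<in> C" "c1 \<noteq> c2" "c1 \<noteq> c3" "c2 \<noteq> c3" and p: "large_for C U p"
    and T: "cover p T1" "cover p T2" "cover p T3"
    and main: "\<And>f1 f2 f3. f1 \<in> T1 \<Longrightarrow> f2 \<in> T2 \<Longrightarrow> f3 \<in> T3 \<Longrightarrow> \<not> [P f1 f2 f3 + (int (U c1 b1) * f1 b1 + int (U c1 (\<not> b1)) * f1 (\<not> b1))
        + (int (U c2 b2) * f2 b2 + int (U c2 (\<not> b2)) * f2 (\<not> b2)) + (int (U c3 b3) * f3 b3 + int (U c3 (\<not> b3)) * f3 (\<not> b3)) = s] (mod p)"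
    and F: "\<And>g. F g = P (g c1) (g c2) (g c3) + linear_part C U g"
  shows "avoidable p F"
proof -
  define F' where "F' g = P (g c1) (g c2) (g c3) + (int (U c1 b1) * g c1 b1 + int (U c1 (\<not> b1)) * g c1 (\<not> b1))
        + (int (U c2 b2) * g c2 b2 + int (U c2 (\<not> b2)) * g c2 (\<not> b2)) + (int (U c3 b3) * g c3 b3 + int (U c3 (\<not> b3)) * g c3 (\<not> b3))" for g
  have "avoidable p F'"
    unfolding avoidable_def
  proof (intro exI[of _ "\<lambda>c. if c = c1 then T1 else if c = c2 then T2 else if c = c3 then T3 else UNIV"] exI[of _ s] conjI allI impI)
    fix g assume g: "\<forall>c. g c \<in> (if c = c1 then T1 else if c = c2 then T2 else if c = c3 then T3 else UNIV)"
    have "g c1 \<in> T1" "g c2 \<in> T2" "g c3 \<in> T3" using g[rule_format, of c1] g[rule_format, of c2] g[rule_format, of c3] C by simp_all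
    then show "\<not> [F' g = s] (mod p)" unfolding F'_def by (rule main)
  qed (use T cover_UNIV in simp)
  then have "avoidable p (\<lambda>g. F' g + linear_part (C - {c1} - {c2} - {c3}) U g)"
    by (rule avoidable_add_linear_part[OF _ p C(1)]) (auto simp: F'_def)
  moreover have "F g = F' g + linear_part (C - {c1} - {c2} - {c3}) U g" for g
    unfolding F F'_def using C
    by (simp add: linear_part_remove[of C c1 U g b1] linear_part_remove[of "C - {c1}" c2 U g b2] linear_part_remove[of "C - {c1} - {c2}" c3 U g b3])
  ultimately show ?thesis by presburger
qed

lemma not_cong_succ: "p > 1 \<Longrightarrow> a = b \<Longrightarrow> \<not> [a = b + 1] (mod p)" for p :: int
  by (auto simp: cong_iff_dvd_diff zdvd_not_zless)

lemma not_cong_transfer: "[a = 0 + b] (mod p) \<Longrightarrow> a = c \<Longrightarrow> \<not> [b = s] (mod p) \<Longrightarrow> \<not> [c = s] (mod p)" for p :: int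
  by (metis add_0 cong_sym cong_trans)

lemma not_cong_succ': "p > 1 \<Longrightarrow> [a = b] (mod p) \<Longrightarrow> \<not> [a = b + 1] (mod p)" for p :: int
  by (metis cong_sym cong_trans not_cong_succ)

text \<open>Below \<open>x\<^sub>i = g c\<^sub>i b\<^sub>i\<close> and \<open>y\<^sub>i = g c\<^sub>i (\<not> b\<^sub>i)\<close>.\<close>

lemma loops_at_both_ends:
  assumes "finite C" "c1 \<in> C" "c2 \<in> C" "c1 \<noteq> c2" "large_for C U p"
    and F: "\<And>g. F g = g c1 b1 * g c2 b2 + g c1 (\<not> b1) * g c1 b1 + g c2 (\<not> b2) * g c2 b2 + linear_part C U g"
  shows "avoidable p F"
proof (rule avoid2[OF assms(1-5), where ?b1.0 = b1 and ?b2.0 = b2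
      and P = "\<lambda>f1 f2. f1 b1 * f2 b2 + f1 (\<not> b1) * f1 b1 + f2 (\<not> b2) * f2 b2"
      and s = "int (U c1 (\<not> b1)) * U c2 (\<not> b2) - U c1 b1 * U c1 (\<not> b1) - U c2 b2 * U c2 (\<not> b2) + 1",
      OF cover_fixed[of p b1 "- int (U c1 (\<not> b1))"] cover_fixed[of p b2 "- int (U c2 (\<not> b2))"]])
  fix f1 f2 :: "bool \<Rightarrow> int"
  assume "f1 \<in> {f. f b1 = - int (U c1 (\<not> b1))}" "f2 \<in> {f. f b2 = - int (U c2 (\<not> b2))}"
  then show "\<not> [f1 b1 * f2 b2 + f1 (\<not> b1) * f1 b1 + f2 (\<not> b2) * f2 b2 + (int (U c1 b1) * f1 b1 + int (U c1 (\<not> b1)) * f1 (\<not> b1)) +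
      (int (U c2 b2) * f2 b2 + int (U c2 (\<not> b2)) * f2 (\<not> b2)) =
      int (U c1 (\<not> b1)) * U c2 (\<not> b2) - U c1 b1 * U c1 (\<not> b1) - U c2 b2 * U c2 (\<not> b2) + 1] (mod p)"
    using large_forD(3)[OF assms(5)] by (intro not_cong_succ) (auto simp: algebra_simps)
qed (rule F)

text \<open>Let u1, v1, u2, v2 be the linear coefficients of x1, y1, x2, y2. With x1 = -v2 and x2 =
  -v1 the coefficients of y1 and y2 vanish, so the value is constant and its successor is
  avoided.\<close>

lemma crossed_three:
  assumes "finite C" "c1 \<in> C" "c2 \<in> C" "c1 \<noteq> c2" "large_for C U p"
    and F: "\<And>g. F g = g c1 b1 * g c2 b2 + g c1 (\<not> b1) * g c2 b2 + g c2 (\<not> b2) * g c1 b1 + linear_part C U g"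
  shows "avoidable p F"
proof (rule avoid2[OF assms(1-5), where ?b1.0 = b1 and ?b2.0 = b2
      and P = "\<lambda>f1 f2. f1 b1 * f2 b2 + f1 (\<not> b1) * f2 b2 + f2 (\<not> b2) * f1 b1"
      and s = "int (U c1 (\<not> b1)) * U c2 (\<not> b2) - U c1 b1 * U c2 (\<not> b2) - U c2 b2 * U c1 (\<not> b1) + 1",
      OF cover_fixed[of p b1 "- int (U c2 (\<not> b2))"] cover_fixed[of p b2 "- int (U c1 (\<not> b1))"]])
  fix f1 f2 :: "bool \<Rightarrow> int"
  assume "f1 \<in> {f. f b1 = - int (U c2 (\<not> b2))}" "f2 \<in> {f. f b2 = - int (U c1 (\<not> b1))}"
  then show "\<not> [f1 b1 * f2 b2 + f1 (\<not> b1) * f2 b2 + f2 (\<not> b2) * f1 b1 + (int (U c1 b1) * f1 b1 + int (U c1 (\<not> b1)) * f1 (\<not> b1)) +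
      (int (U c2 b2) * f2 b2 + int (U c2 (\<not> b2)) * f2 (\<not> b2)) =
      int (U c1 (\<not> b1)) * U c2 (\<not> b2) - U c1 b1 * U c2 (\<not> b2) - U c2 b2 * U c1 (\<not> b1) + 1] (mod p)"
    using large_forD(3)[OF assms(5)] by (intro not_cong_succ) (auto simp: algebra_simps)
qed (rule F)

text \<open>x1 = -v1 removes y1; with x2 fixed as well, a quadratic polynomial in y2 is left, which
  misses a residue.\<close>

lemma loop_and_square:
  assumes "finite C" "c1 \<in> C" "c2 \<in> C" "c1 \<noteq> c2" "large_for C U p"
    and F: "\<And>g. F g = g c1 b1 * g c2 b2 + g c1 (\<not> b1) * g c1 b1 + g c2 (\<not> b2) * g c2 (\<not> b2) + linear_part C U g"
  shows "avoidable p F"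
proof -
  obtain s where s: "\<And>y. \<not> [y * y + int (U c2 (\<not> b2)) * y + - int (U c1 b1) * int (U c1 (\<not> b1)) = s] (mod p)"
    using quadratic_misses large_forD[OF assms(5)] by metis
  show ?thesis
  proof (rule avoid2[OF assms(1-5), where ?b1.0 = b1 and ?b2.0 = b2
      and P = "\<lambda>f1 f2. f1 b1 * f2 b2 + f1 (\<not> b1) * f1 b1 + f2 (\<not> b2) * f2 (\<not> b2)" and s = s,
      OF cover_fixed[of p b1 "- int (U c1 (\<not> b1))"] cover_fixed[of p b2 0]])
    fix f1 f2 :: "bool \<Rightarrow> int"
    assume "f1 \<in> {f. f b1 = - int (U c1 (\<not> b1))}" "f2 \<in> {f. f b2 = 0}"
    then show "\<not> [f1 b1 * f2 b2 + f1 (\<not> b1) * f1 b1 + f2 (\<not> b2) * f2 (\<not> b2) + (int (U c1 b1) * f1 b1 + int (U c1 (\<not> b1)) * f1 (\<not> b1)) +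
      (int (U c2 b2) * f2 b2 + int (U c2 (\<not> b2)) * f2 (\<not> b2)) = s] (mod p)"
      using s[of "f2 (\<not> b2)"] by (simp add: algebra_simps)
  qed (rule F)
qed

text \<open>x2 = -u1 removes x1; with y1 fixed as well, a quadratic polynomial in y2 is
  left.\<close>

lemma squares_at_both_ends:
  assumes "finite C" "c1 \<in> C" "c2 \<in> C" "c1 \<noteq> c2" "large_for C U p"
    and F: "\<And>g. F g = g c1 b1 * g c2 b2 + g c1 (\<not> b1) * g c1 (\<not> b1) + g c2 (\<not> b2) * g c2 (\<not> b2) + linear_part C U g"
  shows "avoidable p F"
proof -
  obtain s where s: "\<And>y. \<not> [y * y + int (U c2 (\<not> b2)) * y + - int (U c2 b2) * int (U c1 b1) = s] (mod p)"
    using quadratic_misses large_forD[OF assms(5)] by metis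
  show ?thesis
  proof (rule avoid2[OF assms(1-5), where ?b1.0 = b1 and ?b2.0 = b2
      and P = "\<lambda>f1 f2. f1 b1 * f2 b2 + f1 (\<not> b1) * f1 (\<not> b1) + f2 (\<not> b2) * f2 (\<not> b2)" and s = s,
      OF cover_fixed[of p "\<not> b1" 0] cover_fixed[of p b2 "- int (U c1 b1)"]])
    fix f1 f2 :: "bool \<Rightarrow> int"
    assume "f1 \<in> {f. f (\<not> b1) = 0}" "f2 \<in> {f. f b2 = - int (U c1 b1)}"
    then show "\<not> [f1 b1 * f2 b2 + f1 (\<not> b1) * f1 (\<not> b1) + f2 (\<not> b2) * f2 (\<not> b2) + (int (U c1 b1) * f1 b1 + int (U c1 (\<not> b1)) * f1 (\<not> b1)) +
      (int (U c2 b2) * f2 b2 + int (U c2 (\<not> b2)) * f2 (\<not> b2)) = s] (mod p)"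
      using s[of "f2 (\<not> b2)"] by (simp add: algebra_simps)
  qed (rule F)
qed

text \<open>At x1 = 1 the second class enters as (1 + u2) * x2 + (1 + v2) * y2, which it can keep at
  0. A quadratic polynomial in y1 is left.\<close>

lemma double_edge_and_square:
  assumes "finite C" "c1 \<in> C" "c2 \<in> C" "c1 \<noteq> c2" "large_for C U p"
    and F: "\<And>g. F g = g c1 b1 * g c2 b2 + g c1 (\<not> b1) * g c1 (\<not> b1) + g c2 (\<not> b2) * g c1 b1 + linear_part C U g"
  shows "avoidable p F"
proof -
  obtain s where s: "\<And>y. \<not> [y * y + int (U c1 (\<not> b1)) * y + int (U c1 b1) = s] (mod p)"
    using quadratic_misses large_forD[OF assms(5)] by metis
  have "\<not> p dvd (1 + int (U c2 b2)) + (1 + int (U c2 (\<not> b2)))"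
    using large_forD(5)[OF assms(5,3), of b2] zdvd_not_zless[of "(1 + int (U c2 b2)) + (1 + int (U c2 (\<not> b2)))" p] by simp
  note k = cover_kernel[OF large_forD(1)[OF assms(5)] this, of b2]
  show ?thesis
  proof (rule avoid2[OF assms(1-5), where ?b1.0 = b1 and ?b2.0 = b2
      and P = "\<lambda>f1 f2. f1 b1 * f2 b2 + f1 (\<not> b1) * f1 (\<not> b1) + f2 (\<not> b2) * f1 b1" and s = s,
      OF cover_fixed[of p b1 1] k])
    fix f1 f2 :: "bool \<Rightarrow> int"
    assume f: "f1 \<in> {f. f b1 = 1}" "f2 \<in> {f. [(1 + int (U c2 b2)) * f b2 + (1 + int (U c2 (\<not> b2))) * f (\<not> b2) = 0] (mod p)}"
    define y where "y = f1 (\<not> b1)"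
    have "[(1 + int (U c2 b2)) * f2 b2 + (1 + int (U c2 (\<not> b2))) * f2 (\<not> b2) + (y * y + int (U c1 (\<not> b1)) * y + int (U c1 b1))
        = 0 + (y * y + int (U c1 (\<not> b1)) * y + int (U c1 b1))] (mod p)" using f by (intro cong_add cong_refl) simp
    moreover have "(1 + int (U c2 b2)) * f2 b2 + (1 + int (U c2 (\<not> b2))) * f2 (\<not> b2) + (y * y + int (U c1 (\<not> b1)) * y + int (U c1 b1))
      = f1 b1 * f2 b2 + f1 (\<not> b1) * f1 (\<not> b1) + f2 (\<not> b2) * f1 b1 + (int (U c1 b1) * f1 b1 + int (U c1 (\<not> b1)) * f1 (\<not> b1)) +
      (int (U c2 b2) * f2 b2 + int (U c2 (\<not> b2)) * f2 (\<not> b2))" using f unfolding y_def by (simp add: algebra_simps)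
    ultimately show "\<not> [f1 b1 * f2 b2 + f1 (\<not> b1) * f1 (\<not> b1) + f2 (\<not> b2) * f1 b1 + (int (U c1 b1) * f1 b1 + int (U c1 (\<not> b1)) * f1 (\<not> b1)) +
      (int (U c2 b2) * f2 b2 + int (U c2 (\<not> b2)) * f2 (\<not> b2)) = s] (mod p)"
      by (rule not_cong_transfer) (rule s)
  qed (rule F)
qed

text \<open>x1 = -u2 removes x2, and y2 = 1 gives the third class the coefficients 1 + u3 and v3,
  whose sum is positive in any case, so that it can keep its contribution at 0. A quadratic
  polynomial in y1 is left.\<close>

lemma square_and_leaf:
  assumes "finite C" "c1 \<in> C" "c2 \<in> C" "c3 \<in> C" "c1 \<noteq> c2" "c1 \<noteq> c3" "c2 \<noteq> c3" "large_for C U p"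
    and F: "\<And>g. F g = g c1 b1 * g c2 b2 + g c1 (\<not> b1) * g c1 (\<not> b1) + g c2 (\<not> b2) * g c3 b3 + linear_part C U g"
  shows "avoidable p F"
proof -
  obtain s where s: "\<And>y. \<not> [y * y + int (U c1 (\<not> b1)) * y + (int (U c2 (\<not> b2)) - int (U c1 b1) * int (U c2 b2)) = s] (mod p)"
    using quadratic_misses large_forD[OF assms(8)] by metis
  have "\<not> p dvd (1 + int (U c3 b3)) + int (U c3 (\<not> b3))"
    using large_forD(5)[OF assms(8,4), of b3] zdvd_not_zless[of "(1 + int (U c3 b3)) + int (U c3 (\<not> b3))" p] by simp
  note k = cover_kernel[OF large_forD(1)[OF assms(8)] this, of b3]
  show ?thesis
  proof (rule avoid3[OF assms(1-8), where ?b1.0 = b1 and ?b2.0 = b2 and ?b3.0 = b3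
      and P = "\<lambda>f1 f2 f3. f1 b1 * f2 b2 + f1 (\<not> b1) * f1 (\<not> b1) + f2 (\<not> b2) * f3 b3" and s = s,
      OF cover_fixed[of p b1 "- int (U c2 b2)"] cover_fixed[of p "\<not> b2" 1] k])
    fix f1 f2 f3 :: "bool \<Rightarrow> int"
    assume f: "f1 \<in> {f. f b1 = - int (U c2 b2)}" "f2 \<in> {f. f (\<not> b2) = 1}" "f3 \<in> {f. [(1 + int (U c3 b3)) * f b3 + int (U c3 (\<not> b3)) * f (\<not> b3) = 0] (mod p)}"
    define y where "y = f1 (\<not> b1)"
    let ?q = "y * y + int (U c1 (\<not> b1)) * y + (int (U c2 (\<not> b2)) - int (U c1 b1) * int (U c2 b2))"
    have "[(1 + int (U c3 b3)) * f3 b3 + int (U c3 (\<not> b3)) * f3 (\<not> b3) + ?q = 0 + ?q] (mod p)" using f by (intro cong_add cong_refl) simp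
    moreover have "(1 + int (U c3 b3)) * f3 b3 + int (U c3 (\<not> b3)) * f3 (\<not> b3) + ?q
      = f1 b1 * f2 b2 + f1 (\<not> b1) * f1 (\<not> b1) + f2 (\<not> b2) * f3 b3 + (int (U c1 b1) * f1 b1 + int (U c1 (\<not> b1)) * f1 (\<not> b1)) +
      (int (U c2 b2) * f2 b2 + int (U c2 (\<not> b2)) * f2 (\<not> b2)) + (int (U c3 b3) * f3 b3 + int (U c3 (\<not> b3)) * f3 (\<not> b3))"
      using f unfolding y_def by (simp add: algebra_simps)
    ultimately show "\<not> [f1 b1 * f2 b2 + f1 (\<not> b1) * f1 (\<not> b1) + f2 (\<not> b2) * f3 b3 + (int (U c1 b1) * f1 b1 + int (U c1 (\<not> b1)) * f1 (\<not> b1)) +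
      (int (U c2 b2) * f2 b2 + int (U c2 (\<not> b2)) * f2 (\<not> b2)) + (int (U c3 b3) * f3 b3 + int (U c3 (\<not> b3)) * f3 (\<not> b3)) = s] (mod p)"
      by (rule not_cong_transfer) (rule s)
  qed (rule F)
qed

text \<open>On each edge one end is fixed so that the coefficient of the other end vanishes, once in
  each class: x1 = -u2 removes x2, y2 = -v3 removes y3, and x3 = -v1 removes y1.\<close>

lemma full_triangle:
  assumes "finite C" "c1 \<in> C" "c2 \<in> C" "c3 \<in> C" "c1 \<noteq> c2" "c1 \<noteq> c3" "c2 \<noteq> c3" "large_for C U p"
    and F: "\<And>g. F g = g c1 b1 * g c2 b2 + g c1 (\<not> b1) * g c3 b3 + g c2 (\<not> b2) * g c3 (\<not> b3) + linear_part C U g"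
  shows "avoidable p F"
proof (rule avoid3[OF assms(1-8), where ?b1.0 = b1 and ?b2.0 = b2 and ?b3.0 = b3
      and P = "\<lambda>f1 f2 f3. f1 b1 * f2 b2 + f1 (\<not> b1) * f3 b3 + f2 (\<not> b2) * f3 (\<not> b3)"
      and s = "- int (U c1 b1) * U c2 b2 - int (U c2 (\<not> b2)) * U c3 (\<not> b3) - int (U c3 b3) * U c1 (\<not> b1) + 1",
      OF cover_fixed[of p b1 "- int (U c2 b2)"] cover_fixed[of p "\<not> b2" "- int (U c3 (\<not> b3))"] cover_fixed[of p b3 "- int (U c1 (\<not> b1))"]])
  fix f1 f2 f3 :: "bool \<Rightarrow> int"
  assume "f1 \<in> {f. f b1 = - int (U c2 b2)}" "f2 \<in> {f. f (\<not> b2) = - int (U c3 (\<not> b3))}" "f3 \<in> {f. f b3 = - int (U c1 (\<not> b1))}"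
  then show "\<not> [f1 b1 * f2 b2 + f1 (\<not> b1) * f3 b3 + f2 (\<not> b2) * f3 (\<not> b3) + (int (U c1 b1) * f1 b1 + int (U c1 (\<not> b1)) * f1 (\<not> b1)) +
      (int (U c2 b2) * f2 b2 + int (U c2 (\<not> b2)) * f2 (\<not> b2)) + (int (U c3 b3) * f3 b3 + int (U c3 (\<not> b3)) * f3 (\<not> b3)) =
      - int (U c1 b1) * U c2 b2 - int (U c2 (\<not> b2)) * U c3 (\<not> b3) - int (U c3 b3) * U c1 (\<not> b1) + 1] (mod p)"
    using large_forD(3)[OF assms(8)] by (intro not_cong_succ) (auto simp: algebra_simps)
qed (rule F)

lemma opposite_pair_fixed:
  assumes "finite C" "c1 \<in> C" "c2 \<in> C" "c1 \<noteq> c2" "large_for C U p"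
    and F: "\<And>g. F g = g c1 b1 * g c2 b2 + g c1 (\<not> b1) * g c2 (\<not> b2) + X (g c1) (g c2) + linear_part C U g"
    and X: "\<And>f1 f2. f1 b1 = a1 \<Longrightarrow> f2 (\<not> b2) = a2 \<Longrightarrow> [a1 * f2 b2 + f1 (\<not> b1) * a2 + X f1 f2 + int (U c1 (\<not> b1)) * f1 (\<not> b1) + int (U c2 b2) * f2 b2 = t] (mod p)"
  shows "avoidable p F"
proof (rule avoid2[OF assms(1-5), where ?b1.0 = b1 and ?b2.0 = b2
      and P = "\<lambda>f1 f2. f1 b1 * f2 b2 + f1 (\<not> b1) * f2 (\<not> b2) + X f1 f2"
      and s = "t + int (U c1 b1) * a1 + int (U c2 (\<not> b2)) * a2 + 1",
      OF cover_fixed[of p b1 a1] cover_fixed[of p "\<not> b2" a2]])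
  fix f1 f2 :: "bool \<Rightarrow> int"
  assume f: "f1 \<in> {f. f b1 = a1}" "f2 \<in> {f. f (\<not> b2) = a2}"
  have "[a1 * f2 b2 + f1 (\<not> b1) * a2 + X f1 f2 + int (U c1 (\<not> b1)) * f1 (\<not> b1) + int (U c2 b2) * f2 b2 + int (U c1 b1) * a1 + int (U c2 (\<not> b2)) * a2
    = t + int (U c1 b1) * a1 + int (U c2 (\<not> b2)) * a2] (mod p)" using f by (intro cong_add cong_refl X) auto
  moreover have "a1 * f2 b2 + f1 (\<not> b1) * a2 + X f1 f2 + int (U c1 (\<not> b1)) * f1 (\<not> b1) + int (U c2 b2) * f2 b2 + int (U c1 b1) * a1 + int (U c2 (\<not> b2)) * a2
    = f1 b1 * f2 b2 + f1 (\<not> b1) * f2 (\<not> b2) + X f1 f2 + (int (U c1 b1) * f1 b1 + int (U c1 (\<not> b1)) * f1 (\<not> b1)) +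
      (int (U c2 b2) * f2 b2 + int (U c2 (\<not> b2)) * f2 (\<not> b2))" using f by (simp add: algebra_simps)
  ultimately show "\<not> [f1 b1 * f2 b2 + f1 (\<not> b1) * f2 (\<not> b2) + X f1 f2 + (int (U c1 b1) * f1 b1 + int (U c1 (\<not> b1)) * f1 (\<not> b1)) +
      (int (U c2 b2) * f2 b2 + int (U c2 (\<not> b2)) * f2 (\<not> b2)) = t + int (U c1 b1) * a1 + int (U c2 (\<not> b2)) * a2 + 1] (mod p)"
    using large_forD(3)[OF assms(5)] by (intro not_cong_succ') auto
qed (rule F)

text \<open>With x1 = -u2 and y2 = -v1 there remains (u3 - u2) * x3 + v3 * y3, which the third class
  can keep at 0 unless u3 - u2 + v3 = 0 and v3 > 0. In that case it is -v3 times the difference of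
  the third class, and fixing vertices does not help. Then the three classes play
  \<open>square_class_game\<close> with X = x1 + u2, Y = y1 + v2, x = x2 + u1, y = y2 + v1, z = x3
  and D = v3 * (x3 - y3); these shifts absorb the linear part.\<close>

lemma opposite_pair_leaf:
  assumes C: "finite C" "c1 \<in> C" "c2 \<in> C" "c3 \<in> C" "c1 \<noteq> c2" "c1 \<noteq> c3" "c2 \<noteq> c3" and p: "large_for C U p"
    and u2: "int (U c2 b2) < p"
    and F: "\<And>g. F g = g c1 b1 * g c2 b2 + g c1 (\<not> b1) * g c2 (\<not> b2) + g c1 b1 * g c3 b3 + linear_part C U g"
  shows "avoidable p F"
proof -
  define u1 v1 u2 v2 u3 v3 where uv: "u1 = int (U c1 b1)" "v1 = int (U c1 (\<not> b1))" "u2 = int (U c2 b2)" "v2 = int (U c2 (\<not> b2))"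
    "u3 = int (U c3 b3)" "v3 = int (U c3 (\<not> b3))"
  note main = avoid3[OF C p, where ?b1.0 = b1 and ?b2.0 = b2 and ?b3.0 = b3 and F = F
      and P = "\<lambda>f1 f2 f3. f1 b1 * f2 b2 + f1 (\<not> b1) * f2 (\<not> b2) + f1 b1 * f3 b3", OF _ _ _ _ F, folded uv]
  have nonneg: "u3 \<ge> 0" "v3 \<ge> 0" "u2 \<ge> 0" by (simp_all add: uv)
  have lt: "u3 + v3 < p" "u2 < p" using large_forD(5)[OF p C(4), of b3] u2 by (simp_all add: uv)
  show ?thesis
  proof (cases "u3 - u2 + v3 = 0 \<and> v3 > 0")
    case False
    have T3: "cover p {f. [(u3 - u2) * f b3 + v3 * f (\<not> b3) = 0] (mod p)}"
    proof (cases "u3 - u2 + v3 = 0")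
      case True
      then have "v3 = 0" "u3 - u2 = 0" using False nonneg by auto
      then show ?thesis using cover_UNIV by simp
    next
      case ne: False
      have "\<not> p dvd u3 - u2 + v3"
      proof
        assume "p dvd u3 - u2 + v3"
        then have "\<bar>p\<bar> \<le> \<bar>u3 - u2 + v3\<bar>" using ne dvd_imp_le_int by blast
        then show False using lt nonneg by linarith
      qed
      then show ?thesis using cover_kernel large_forD(1)[OF p] by blast
    qed
    show ?thesis
    proof (rule main[OF cover_fixed[of p b1 "- u2"] cover_fixed[of p "\<not> b2" "- v1"] T3,
        where s = "- u1 * u2 - v1 * v2 + 1"])
      fix f1 f2 f3 :: "bool \<Rightarrow> int"
      assume f: "f1 \<in> {f. f b1 = - u2}" "f2 \<in> {f. f (\<not> b2) = - v1}" "f3 \<in> {f. [(u3 - u2) * f b3 + v3 * f (\<not> b3) = 0] (mod p)}"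
      have "[(u3 - u2) * f3 b3 + v3 * f3 (\<not> b3) + (- u1 * u2 - v1 * v2) = 0 + (- u1 * u2 - v1 * v2)] (mod p)"
        using f by (intro cong_add cong_refl) simp
      moreover have "(u3 - u2) * f3 b3 + v3 * f3 (\<not> b3) + (- u1 * u2 - v1 * v2)
        = f1 b1 * f2 b2 + f1 (\<not> b1) * f2 (\<not> b2) + f1 b1 * f3 b3 + (u1 * f1 b1 + v1 * f1 (\<not> b1)) + (u2 * f2 b2 + v2 * f2 (\<not> b2)) +
          (u3 * f3 b3 + v3 * f3 (\<not> b3))" using f by (simp add: algebra_simps)
      ultimately have "[f1 b1 * f2 b2 + f1 (\<not> b1) * f2 (\<not> b2) + f1 b1 * f3 b3 + (u1 * f1 b1 + v1 * f1 (\<not> b1)) + (u2 * f2 b2 + v2 * f2 (\<not> b2)) +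
          (u3 * f3 b3 + v3 * f3 (\<not> b3)) = - u1 * u2 - v1 * v2] (mod p)" by (simp only: add_0_left)
      then show "\<not> [f1 b1 * f2 b2 + f1 (\<not> b1) * f2 (\<not> b2) + f1 b1 * f3 b3 + (u1 * f1 b1 + v1 * f1 (\<not> b1)) + (u2 * f2 b2 + v2 * f2 (\<not> b2)) +
          (u3 * f3 b3 + v3 * f3 (\<not> b3)) = - u1 * u2 - v1 * v2 + 1] (mod p)"
        using large_forD(3)[OF p] by (intro not_cong_succ') simp_all
    qed
  next
    case True
    have nv: "\<not> p dvd v3" using True lt nonneg zdvd_not_zless[of v3 p] by linarith
    obtain R1 R2 R3 where R1: "\<And>E. \<exists>X Y. R1 X Y \<and> [X - Y = E] (mod p)" and R2: "\<And>E. \<exists>x y. R2 x y \<and> [x - y = E] (mod p)"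
      and R3: "\<And>D. \<exists>z. R3 D z" and R: "\<And>X Y x y z D. R1 X Y \<Longrightarrow> R2 x y \<Longrightarrow> R3 D z \<Longrightarrow> \<not> [X * (x + z) + Y * y = D] (mod p)"
      using square_class_game[OF large_forD(1,2)[OF p]] by metis
    have T1: "cover p {f. R1 (f b1 + u2) (f (\<not> b1) + v2)}"
      unfolding cover_iff[of _ _ b1]
    proof
      fix D
      obtain X Y where XY: "R1 X Y" "[X - Y = D + u2 - v2] (mod p)" using R1 by blast
      have "[X - Y - (u2 - v2) = D + u2 - v2 - (u2 - v2)] (mod p)" by (rule cong_diff[OF XY(2) cong_refl])
      then show "\<exists>f\<in>{f. R1 (f b1 + u2) (f (\<not> b1) + v2)}. [f b1 - f (\<not> b1) = D] (mod p)"
        using XY(1) by (intro bexI[of _ "\<lambda>b. if b = b1 then X - u2 else Y - v2"]) (simp_all add: algebra_simps)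
    qed
    have T2: "cover p {f. R2 (f b2 + u1) (f (\<not> b2) + v1)}"
      unfolding cover_iff[of _ _ b2]
    proof
      fix D
      obtain X Y where XY: "R2 X Y" "[X - Y = D + u1 - v1] (mod p)" using R2 by blast
      have "[X - Y - (u1 - v1) = D + u1 - v1 - (u1 - v1)] (mod p)" by (rule cong_diff[OF XY(2) cong_refl])
      then show "\<exists>f\<in>{f. R2 (f b2 + u1) (f (\<not> b2) + v1)}. [f b2 - f (\<not> b2) = D] (mod p)"
        using XY(1) by (intro bexI[of _ "\<lambda>b. if b = b2 then X - u1 else Y - v1"]) (simp_all add: algebra_simps)
    qed
    define z where "z D = (SOME z. R3 (v3 * D) z)" for D
    have z: "R3 (v3 * D) (z D)" for D unfolding z_def using R3 by (rule someI_ex)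
    have T3: "cover p {f. R3 (v3 * (f b3 - f (\<not> b3))) (f b3)}"
      using coverI[of "\<lambda>x y. R3 (v3 * (x - y)) x" z p b3] z by simp
    show ?thesis
    proof (rule main[OF T1 T2 T3, where s = "- u1 * u2 - v1 * v2"])
      fix f1 f2 f3 :: "bool \<Rightarrow> int"
      assume "f1 \<in> {f. R1 (f b1 + u2) (f (\<not> b1) + v2)}" "f2 \<in> {f. R2 (f b2 + u1) (f (\<not> b2) + v1)}"
        "f3 \<in> {f. R3 (v3 * (f b3 - f (\<not> b3))) (f b3)}"
      then have n: "\<not> [(f1 b1 + u2) * ((f2 b2 + u1) + f3 b3) + (f1 (\<not> b1) + v2) * (f2 (\<not> b2) + v1) = v3 * (f3 b3 - f3 (\<not> b3))] (mod p)"
        using R by simp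
      have u3: "u3 = u2 - v3" using True by simp
      show "\<not> [f1 b1 * f2 b2 + f1 (\<not> b1) * f2 (\<not> b2) + f1 b1 * f3 b3 + (u1 * f1 b1 + v1 * f1 (\<not> b1)) + (u2 * f2 b2 + v2 * f2 (\<not> b2)) +
          (u3 * f3 b3 + v3 * f3 (\<not> b3)) = - u1 * u2 - v1 * v2] (mod p)"
      proof
        assume a: "[f1 b1 * f2 b2 + f1 (\<not> b1) * f2 (\<not> b2) + f1 b1 * f3 b3 + (u1 * f1 b1 + v1 * f1 (\<not> b1)) + (u2 * f2 b2 + v2 * f2 (\<not> b2)) +
          (u3 * f3 b3 + v3 * f3 (\<not> b3)) = - u1 * u2 - v1 * v2] (mod p)"
        have "((f1 b1 + u2) * ((f2 b2 + u1) + f3 b3) + (f1 (\<not> b1) + v2) * (f2 (\<not> b2) + v1)) - v3 * (f3 b3 - f3 (\<not> b3))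
          = (f1 b1 * f2 b2 + f1 (\<not> b1) * f2 (\<not> b2) + f1 b1 * f3 b3 + (u1 * f1 b1 + v1 * f1 (\<not> b1)) + (u2 * f2 b2 + v2 * f2 (\<not> b2)) +
          (u3 * f3 b3 + v3 * f3 (\<not> b3))) - (- u1 * u2 - v1 * v2)" unfolding u3 by (simp add: algebra_simps)
        then show False using a n by (simp add: cong_iff_dvd_diff)
      qed
    qed
  qed
qed

text \<open>A third edge from x1 that ends in one of the two classes only changes the values at
  which the free coefficients vanish. If it doubles x1 * x2, the coefficient of x2 is 2 * x1 + u2,
  whence x1 is -u2 / 2 modulo \<open>p\<close>.\<close>

lemma opposite_pair_at_vertex:
  assumes C: "finite C" "c1 \<in> C" "c2 \<in> C" "c3 \<in> C" "c1 \<noteq> c2" and p: "large_for C U p"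
    and F: "\<And>g. F g = g c1 b1 * g c2 b2 + g c1 (\<not> b1) * g c2 (\<not> b2) + g c1 b1 * g c3 b3 + linear_part C U g"
  shows "avoidable p F"
proof -
  define u1 v1 u2 v2 where uv: "u1 = int (U c1 b1)" "v1 = int (U c1 (\<not> b1))" "u2 = int (U c2 b2)" "v2 = int (U c2 (\<not> b2))"
  note fixed = opposite_pair_fixed[OF C(1-3) C(5) p, folded uv]
  consider "c3 = c1" "b3 = b1" | "c3 = c1" "b3 = (\<not> b1)" | "c3 = c2" "b3 = b2" | "c3 = c2" "b3 = (\<not> b2)" | "c3 \<noteq> c1" "c3 \<noteq> c2" by blast
  then show ?thesis
  proof cases
    case 1
    show ?thesis by (rule fixed[of F b1 b2 "\<lambda>f1 f2. f1 b1 * f1 b1" "- u2" "- v1" "u2 * u2"]) (simp_all add: F 1 uv algebra_simps)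
  next
    case 2
    show ?thesis by (rule fixed[of F b1 b2 "\<lambda>f1 f2. f1 b1 * f1 (\<not> b1)" "- u2" "u2 - v1" 0]) (simp_all add: F 2 uv algebra_simps)
  next
    case 3
    obtain r where r: "[2 * r = 1] (mod p)" using inverse_mod[OF large_forD(1,4)[OF p]] by blast
    have "[2 * (- u2 * r) * x + u2 * x = 0] (mod p)" for x
    proof -
      have "[u2 * x - (2 * r) * (u2 * x) = u2 * x - 1 * (u2 * x)] (mod p)" using r by (intro cong_diff cong_mult cong_refl)
      then show ?thesis by (simp add: algebra_simps)
    qed
    note r' = this
    show ?thesis
    proof (rule fixed[of F b1 b2 "\<lambda>f1 f2. f1 b1 * f2 b2" "- u2 * r" "- v1" 0])
      fix f1 f2 :: "bool \<Rightarrow> int" assume f: "f1 b1 = - u2 * r" "f2 (\<not> b2) = - v1"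
      have "- u2 * r * f2 b2 + f1 (\<not> b1) * - v1 + f1 b1 * f2 b2 + int (U c1 (\<not> b1)) * f1 (\<not> b1) + int (U c2 b2) * f2 b2
        = 2 * (- u2 * r) * f2 b2 + u2 * f2 b2"
        unfolding f by (simp add: uv algebra_simps)
      then show "[- u2 * r * f2 b2 + f1 (\<not> b1) * - v1 + f1 b1 * f2 b2 + int (U c1 (\<not> b1)) * f1 (\<not> b1) + int (U c2 b2) * f2 b2 = 0] (mod p)"
        using r'[of "f2 b2"] by (simp only:)
    qed (simp add: F 3)
  next
    case 4
    show ?thesis by (rule fixed[of F b1 b2 "\<lambda>f1 f2. f1 b1 * f2 (\<not> b2)" "- u2" "- v1" "u2 * v1"]) (simp_all add: F 4 uv algebra_simps)
  next
    case 5
    then show ?thesis using large_forD(5)[OF p C(3), of b2] by (intro opposite_pair_leaf[OF C(1-5) _ _ p _ F]) auto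
  qed
qed

section \<open>Graphs without an edge between two classes touched at both vertices\<close>

definition touched :: "nat set \<Rightarrow> (nat \<Rightarrow> 'c \<times> bool) \<Rightarrow> (nat \<Rightarrow> 'c \<times> bool) \<Rightarrow> 'c \<Rightarrow> bool \<Rightarrow> bool" where
  "touched I v w c b \<longleftrightarrow> (\<exists>i\<in>I. v i = (c, b) \<or> w i = (c, b))"

definition val :: "('c \<Rightarrow> bool \<Rightarrow> int) \<Rightarrow> 'c \<times> bool \<Rightarrow> int" where
  "val g v = g (fst v) (snd v)"

lemma val_Pair [simp]: "val g (c, b) = g c b"
  by (simp add: val_def)

lemma sum_single:
  fixes f :: "'a \<Rightarrow> int"
  assumes "finite A" "a \<in> A" "\<And>x. x \<in> A \<Longrightarrow> x \<noteq> a \<Longrightarrow> f x = 0"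
  shows "sum f A = f a"
  using assms by (simp add: sum.remove)

text \<open>\<open>G\<close> is a maximal independent set of classes among those containing all classes touched at both
  vertices; every other class \<open>c\<close> is touched at the single vertex \<open>\<beta> c\<close> and has a neighbour \<open>\<pi> c\<close> in \<open>G\<close>
  through which it is steered.\<close>

lemma independent_configuration:
  fixes v w :: "nat \<Rightarrow> 'c \<times> bool" and U :: "'c \<Rightarrow> bool \<Rightarrow> nat"
  assumes C: "finite C" and I: "finite I" and vw: "\<And>i. i \<in> I \<Longrightarrow> fst (v i) \<in> C \<and> fst (w i) \<in> C"
    and indep: "\<And>i. i \<in> I \<Longrightarrow> fst (v i) \<noteq> fst (w i) \<Longrightarrow>
        \<not> (\<forall>b. touched I v w (fst (v i)) b) \<or> \<not> (\<forall>b. touched I v w (fst (w i)) b)"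
    and e: "\<epsilon> > 0"
  shows "\<forall>\<^sub>F p in at_top. prime p \<longrightarrow> nearable p \<epsilon> (\<lambda>g. (\<Sum>i\<in>I. val g (v i) * val g (w i)) + linear_part C U g)"
proof -
  define full where "full c \<longleftrightarrow> (\<forall>b. touched I v w c b)" for c
  define adj where "adj c c' \<longleftrightarrow> c \<noteq> c' \<and> (\<exists>i\<in>I. fst (v i) = c \<and> fst (w i) = c' \<or> fst (v i) = c' \<and> fst (w i) = c)" for c c'
  define J where "J = {X. X \<subseteq> C \<and> {c \<in> C. full c} \<subseteq> X \<and> (\<forall>c\<in>X. \<forall>c'\<in>X. \<not> adj c c')}"
  have "finite J" unfolding J_def using C by (rule_tac finite_subset[of _ "Pow C"]) auto
  moreover have "\<not> adj c c'" if cc: "full c" "full c'" for c c'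
  proof
    assume "adj c c'"
    then obtain i where i: "i \<in> I" "fst (v i) \<noteq> fst (w i)" "full (fst (v i))" "full (fst (w i))"
      using cc unfolding adj_def by auto
    then show False using indep[OF i(1,2)] unfolding full_def by blast
  qed
  then have "{c \<in> C. full c} \<in> J" unfolding J_def by blast
  ultimately obtain G where G: "G \<in> J" "\<And>X. X \<in> J \<Longrightarrow> G \<subseteq> X \<Longrightarrow> G = X" using finite_has_maximal[of J] by blast
  have GC: "G \<subseteq> C" "\<And>c. c \<in> C \<Longrightarrow> full c \<Longrightarrow> c \<in> G" and Gi: "\<And>c c'. c \<in> G \<Longrightarrow> c' \<in> G \<Longrightarrow> \<not> adj c c'"
    using G(1) by (auto simp: J_def)
  define Q where "Q = C - G"
  have fin: "finite Q" "finite G" using C GC finite_subset by (auto simp: Q_def)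
  have QG: "G \<inter> Q = {}" by (auto simp: Q_def)
  have adj_sym: "adj c c' \<longleftrightarrow> adj c' c" for c c' unfolding adj_def by auto
  have "\<exists>h. h \<in> G \<and> adj c h" if c: "c \<in> Q" for c
  proof (rule ccontr)
    assume a: "\<not> ?thesis"
    have "insert c G \<in> J" using G(1) c a adj_sym unfolding J_def Q_def by (auto simp: adj_def[of c c])
    then have "c \<in> G" using G(2) by blast
    then show False using c by (simp add: Q_def)
  qed
  then obtain \<pi> where pi: "\<And>c. c \<in> Q \<Longrightarrow> \<pi> c \<in> G \<and> adj c (\<pi> c)" by metis
  have "\<exists>b. \<not> touched I v w c (\<not> b)" if "c \<in> Q" for c
  proof -
    have "\<not> full c" using that GC by (auto simp: Q_def)
    then obtain b where "\<not> touched I v w c b" unfolding full_def by blast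
    then show ?thesis by (intro exI[of _ "\<not> b"]) simp
  qed
  then obtain \<beta> where be: "\<And>c. c \<in> Q \<Longrightarrow> \<not> touched I v w c (\<not> \<beta> c)" by metis
  have beta: "b = \<beta> c" if "c \<in> Q" "i \<in> I" "v i = (c, b) \<or> w i = (c, b)" for c b i
  proof (rule ccontr)
    assume "b \<noteq> \<beta> c"
    then have "b = (\<not> \<beta> c)" by blast
    then show False using be[OF that(1)] that(2,3) unfolding touched_def by blast
  qed
  define TT TF FF :: "'c \<Rightarrow> nat \<Rightarrow> nat" where
    "TT h i = of_bool (v i = (h, True) \<and> w i = (h, True))"
    and "TF h i = of_bool (v i = (h, True) \<and> w i = (h, False) \<or> v i = (h, False) \<and> w i = (h, True))"
    and "FF h i = of_bool (v i = (h, False) \<and> w i = (h, False))" for h i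
  define AA :: "'c \<Rightarrow> 'c \<Rightarrow> bool \<Rightarrow> nat \<Rightarrow> nat" where
    "AA c h b i = of_bool (v i = (c, \<beta> c) \<and> w i = (h, b) \<or> w i = (c, \<beta> c) \<and> v i = (h, b))" for c h b i
  \<comment> \<open>The whole difference is put on the vertex of \<open>c\<close> that no edge
    touches, so the touched vertex \<open>\<beta> c\<close> carries exactly the move.\<close>
  define off :: "int \<Rightarrow> 'c \<Rightarrow> int \<Rightarrow> bool \<Rightarrow> int" where "off p c D b = (if b = \<beta> c then 0 else if \<beta> c then - D else D)" for p c D b
  \<comment> \<open>An edge inside \<open>Q\<close> joins touched vertices only. It contributes a
    product of two moves, which belongs to the bounded part \<open>W\<close>.\<close>
  define WW where "WW h i = (if fst (v i) \<in> Q \<and> fst (w i) \<in> Q then h (fst (v i)) * h (fst (w i)) else 0)" for h :: "'c \<Rightarrow> int" and i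
  define W where "W h = (\<Sum>i\<in>I. WW h i) + (\<Sum>c\<in>Q. (int (U c True) + int (U c False)) * h c)" for h :: "'c \<Rightarrow> int"
  define al be ga where "al h = (\<Sum>i\<in>I. TT h i)" and "be h = (\<Sum>i\<in>I. TF h i)" and "ga h = (\<Sum>i\<in>I. FF h i)" for h
  define A where "A c h = (\<Sum>i\<in>I. AA c h True i)" for c h
  define B where "B c h = (\<Sum>i\<in>I. AA c h False i)" for c h
  define base where "base g = (\<Sum>h\<in>G. al h * (g h True)^2 + be h * g h True * g h False + ga h * (g h False)^2 + int (U h True) * g h True + int (U h False) * g h False)"
    for g :: "'c \<Rightarrow> bool \<Rightarrow> int"
  define \<Lambda> where "\<Lambda> c g = (\<Sum>h\<in>G. A c h * g h True + B c h * g h False)" for c and g :: "'c \<Rightarrow> bool \<Rightarrow> int"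
  have edge: "val g (v i) * val g (w i) = (\<Sum>h\<in>G. int (TT h i) * (g h True)^2 + int (TF h i) * g h True * g h False + int (FF h i) * (g h False)^2)
      + (\<Sum>c\<in>Q. k c * (\<Sum>h\<in>G. int (AA c h True i) * g h True + int (AA c h False i) * g h False)) + WW k i"
    if i: "i \<in> I" and gk: "\<And>c. c \<in> Q \<Longrightarrow> g c (\<beta> c) = k c" for g k i
  proof -
    obtain c b c' b' where v: "v i = (c, b)" and w: "w i = (c', b')" by fastforce
    have cC: "c \<in> C" "c' \<in> C" using vw[OF i] v w by auto
    have L1: "(\<Sum>h\<in>G. int (TT h i) * (g h True)^2 + int (TF h i) * g h True * g h False + int (FF h i) * (g h False)^2) = 0" if "c \<notin> G \<or> c' \<notin> G"
      by (rule sum.neutral) (use that v w in \<open>auto simp: TT_def TF_def FF_def\<close>)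
    consider "c \<in> G" "c' \<in> G" | "c \<in> Q" "c' \<in> G" | "c \<in> G" "c' \<in> Q" | "c \<in> Q" "c' \<in> Q" using cC by (auto simp: Q_def)
    then show ?thesis
    proof cases
      case 1
      have "fst (v i) = c" "fst (w i) = c'" using v w by simp_all
      then have cc: "c = c'" using Gi[OF 1] i unfolding adj_def by blast
      have "(\<Sum>h\<in>G. int (TT h i) * (g h True)^2 + int (TF h i) * g h True * g h False + int (FF h i) * (g h False)^2)
        = int (TT c i) * (g c True)^2 + int (TF c i) * g c True * g c False + int (FF c i) * (g c False)^2"
        by (rule sum_single[OF fin(2) 1(1)]) (use v w in \<open>auto simp: TT_def TF_def FF_def\<close>)
      also have "\<dots> = g c b * g c b'" using v w cc by (cases b; cases b') (simp_all add: TT_def TF_def FF_def power2_eq_square)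
      finally have "(\<Sum>h\<in>G. int (TT h i) * (g h True)^2 + int (TF h i) * g h True * g h False + int (FF h i) * (g h False)^2) = g c b * g c b'" .
      moreover have "(\<Sum>c\<in>Q. k c * (\<Sum>h\<in>G. int (AA c h True i) * g h True + int (AA c h False i) * g h False)) = 0"
      proof -
        have "AA c h b i = 0" if "c \<in> Q" for c h b using 1 v w QG that by (auto simp: AA_def)
        then show ?thesis by simp
      qed
      moreover have "WW k i = 0" using 1 v w QG by (auto simp: WW_def)
      ultimately show ?thesis using v w cc by simp
    next
      case 2
      have b: "b = \<beta> c" using beta[OF 2(1) i] v by blast
      have ne: "c \<noteq> c'" using 2 QG by blast
      have "(\<Sum>c\<in>Q. k c * (\<Sum>h\<in>G. int (AA c h True i) * g h True + int (AA c h False i) * g h False))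
        = k c * (\<Sum>h\<in>G. int (AA c h True i) * g h True + int (AA c h False i) * g h False)"
      proof (rule sum_single[OF fin(1) 2(1)])
        fix x assume x: "x \<in> Q" "x \<noteq> c"
        have "AA x h b i = 0" for h b using 2 v w QG x by (auto simp: AA_def)
        then show "k x * (\<Sum>h\<in>G. int (AA x h True i) * g h True + int (AA x h False i) * g h False) = 0" by simp
      qed
      also have "(\<Sum>h\<in>G. int (AA c h True i) * g h True + int (AA c h False i) * g h False) = int (AA c c' True i) * g c' True + int (AA c c' False i) * g c' False"
        by (rule sum_single[OF fin(2) 2(2)]) (use v w ne in \<open>auto simp: AA_def\<close>)
      also have "\<dots> = g c' b'" using v w b by (cases b') (auto simp: AA_def)
      finally show ?thesis using L1 2 QG v w b gk[OF 2(1)] by (auto simp: WW_def)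
    next
      case 3
      have b: "b' = \<beta> c'" using beta[OF 3(2) i] w by blast
      have ne: "c \<noteq> c'" using 3 QG by blast
      have "(\<Sum>c\<in>Q. k c * (\<Sum>h\<in>G. int (AA c h True i) * g h True + int (AA c h False i) * g h False))
        = k c' * (\<Sum>h\<in>G. int (AA c' h True i) * g h True + int (AA c' h False i) * g h False)"
      proof (rule sum_single[OF fin(1) 3(2)])
        fix x assume x: "x \<in> Q" "x \<noteq> c'"
        have "AA x h b i = 0" for h b using 3 v w QG x by (auto simp: AA_def)
        then show "k x * (\<Sum>h\<in>G. int (AA x h True i) * g h True + int (AA x h False i) * g h False) = 0" by simp
      qed
      also have "(\<Sum>h\<in>G. int (AA c' h True i) * g h True + int (AA c' h False i) * g h False) = int (AA c' c True i) * g c True + int (AA c' c False i) * g c False"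
        by (rule sum_single[OF fin(2) 3(1)]) (use v w ne in \<open>auto simp: AA_def\<close>)
      also have "\<dots> = g c b" using v w b by (cases b) (auto simp: AA_def)
      finally show ?thesis using L1 3 QG v w b gk[OF 3(2)] by (auto simp: WW_def)
    next
      case 4
      have b: "b = \<beta> c" "b' = \<beta> c'" using beta[OF 4(1) i] beta[OF 4(2) i] v w by blast+
      have "(\<Sum>c\<in>Q. k c * (\<Sum>h\<in>G. int (AA c h True i) * g h True + int (AA c h False i) * g h False)) = 0"
      proof -
        have "AA c h b i = 0" if "h \<in> G" for c h b using 4 v w QG that by (auto simp: AA_def)
        then show ?thesis by simp
      qed
      then show ?thesis using L1 4 QG v w b gk[OF 4(1)] gk[OF 4(2)] by (auto simp: WW_def)
    qed
  qed
  show ?thesis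
  proof (rule assembly[OF fin(1) e, where off = off and \<kappa> = "\<lambda>_. 0" and base = base and \<Lambda> = \<Lambda> and W = W
        and \<rho> = "\<lambda>p c D. int (U c (\<not> \<beta> c)) * off p c D (\<not> \<beta> c)"])
    show "[off p c D True - off p c D False = D] (mod p)" for p c D by (simp add: off_def)
  next
    fix p :: int and g :: "'c \<Rightarrow> bool \<Rightarrow> int" and k D
    assume g: "\<And>c b. c \<in> Q \<Longrightarrow> g c b = 0 + k c + off p c (D c) b"
    have gk: "g c (\<beta> c) = k c" if "c \<in> Q" for c using g[OF that] by (simp add: off_def)
    have "(\<Sum>i\<in>I. val g (v i) * val g (w i)) = (\<Sum>i\<in>I. (\<Sum>h\<in>G. int (TT h i) * (g h True)^2 + int (TF h i) * g h True * g h False + int (FF h i) * (g h False)^2)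
      + (\<Sum>c\<in>Q. k c * (\<Sum>h\<in>G. int (AA c h True i) * g h True + int (AA c h False i) * g h False)) + WW k i)"
      by (rule sum.cong[OF refl]) (rule edge, simp_all add: gk)
    also have "\<dots> = (\<Sum>i\<in>I. \<Sum>h\<in>G. int (TT h i) * (g h True)^2 + int (TF h i) * g h True * g h False + int (FF h i) * (g h False)^2)
      + (\<Sum>i\<in>I. \<Sum>c\<in>Q. k c * (\<Sum>h\<in>G. int (AA c h True i) * g h True + int (AA c h False i) * g h False)) + (\<Sum>i\<in>I. WW k i)"
      by (simp only: sum.distrib)
    also have "(\<Sum>i\<in>I. \<Sum>h\<in>G. int (TT h i) * (g h True)^2 + int (TF h i) * g h True * g h False + int (FF h i) * (g h False)^2)
      = (\<Sum>h\<in>G. al h * (g h True)^2 + be h * g h True * g h False + ga h * (g h False)^2)"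
      by (subst sum.swap) (simp add: al_def be_def ga_def sum.distrib sum_distrib_right)
    also have "(\<Sum>i\<in>I. \<Sum>c\<in>Q. k c * (\<Sum>h\<in>G. int (AA c h True i) * g h True + int (AA c h False i) * g h False)) = (\<Sum>c\<in>Q. k c * \<Lambda> c g)"
    proof (subst sum.swap, rule sum.cong[OF refl])
      fix c assume "c \<in> Q"
      have "(\<Sum>i\<in>I. \<Sum>h\<in>G. int (AA c h True i) * g h True + int (AA c h False i) * g h False) = \<Lambda> c g"
        by (subst sum.swap) (simp add: \<Lambda>_def A_def B_def sum.distrib sum_distrib_right)
      then show "(\<Sum>i\<in>I. k c * (\<Sum>h\<in>G. int (AA c h True i) * g h True + int (AA c h False i) * g h False)) = k c * \<Lambda> c g"
        by (simp add: sum_distrib_left[symmetric])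
    qed
    finally have E: "(\<Sum>i\<in>I. val g (v i) * val g (w i)) = (\<Sum>h\<in>G. al h * (g h True)^2 + be h * g h True * g h False + ga h * (g h False)^2)
       + (\<Sum>c\<in>Q. k c * \<Lambda> c g) + (\<Sum>i\<in>I. WW k i)" .
    have "linear_part C U g = linear_part G U g + linear_part Q U g"
      unfolding linear_part_def Q_def
      using sum.subset_diff[OF GC(1) C, of "\<lambda>c. int (U c True) * g c True + int (U c False) * g c False"] by (simp only: add.commute)
    moreover have "linear_part Q U g = (\<Sum>c\<in>Q. int (U c (\<not> \<beta> c)) * off p c (D c) (\<not> \<beta> c)) + (\<Sum>c\<in>Q. (int (U c True) + int (U c False)) * k c)"
      unfolding linear_part_def sum.distrib[symmetric]
    proof (rule sum.cong[OF refl])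
      fix c assume "c \<in> Q"
      then show "int (U c True) * g c True + int (U c False) * g c False = int (U c (\<not> \<beta> c)) * off p c (D c) (\<not> \<beta> c) + (int (U c True) + int (U c False)) * k c"
        by (cases "\<beta> c") (simp_all add: g off_def algebra_simps)
    qed
    moreover have "linear_part G U g = (\<Sum>h\<in>G. int (U h True) * g h True + int (U h False) * g h False)" by (simp add: linear_part_def)
    ultimately have "(\<Sum>i\<in>I. val g (v i) * val g (w i)) + linear_part C U g
       = base g + (\<Sum>c\<in>Q. k c * \<Lambda> c g + int (U c (\<not> \<beta> c)) * off p c (D c) (\<not> \<beta> c)) + W k"
      unfolding E base_def W_def by (simp add: sum.distrib)
    then show "[(\<Sum>i\<in>I. val g (v i) * val g (w i)) + linear_part C U g
       = base g + (\<Sum>c\<in>Q. k c * \<Lambda> c g + int (U c (\<not> \<beta> c)) * off p c (D c) (\<not> \<beta> c)) + W k] (mod p)" by simp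
  next
    fix N :: int and \<epsilon> :: real assume N: "N > 0" "\<epsilon> > 0"
    \<comment> \<open>As multiplicities the linear coefficients are nonnegative, so they cannot
      cancel.\<close>
    have "\<forall>h\<in>G. 0 < al h + be h + ga h \<or> int (U h True) + int (U h False) \<noteq> 0 \<or> int (U h True) = 0 \<and> int (U h False) = 0" by auto
    moreover have "\<pi> c \<in> G \<and> 0 < A c (\<pi> c) + B c (\<pi> c)" if c: "c \<in> Q" for c
    proof -
      obtain i where i: "i \<in> I" "fst (v i) = c \<and> fst (w i) = \<pi> c \<or> fst (v i) = \<pi> c \<and> fst (w i) = c" using pi[OF c] adj_def by blast
      obtain x bx y by' where vi: "v i = (x, bx)" and wi: "w i = (y, by')" by (metis prod.exhaust)
      have "\<exists>b. AA c (\<pi> c) b i = 1"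
      proof (cases "x = c \<and> y = \<pi> c")
        case True
        then have "bx = \<beta> c" using beta[OF c i(1), of bx] vi by simp
        then show ?thesis using True vi wi by (intro exI[of _ by']) (simp add: AA_def)
      next
        case False
        then have xy: "y = c" "x = \<pi> c" using i(2) vi wi by auto
        then have "by' = \<beta> c" using beta[OF c i(1), of by'] wi by simp
        then show ?thesis using xy vi wi by (intro exI[of _ bx]) (simp add: AA_def)
      qed
      then obtain b where "AA c (\<pi> c) b i = 1" by blast
      then have "0 < AA c (\<pi> c) True i + AA c (\<pi> c) False i" by (cases b) auto
      also have "\<dots> \<le> A c (\<pi> c) + B c (\<pi> c)"
        unfolding A_def B_def using i(1) I by (intro add_mono member_le_sum) auto
      finally show ?thesis using pi[OF c] by simp
    qed
    ultimately show "\<exists>K::'c \<Rightarrow> int. \<forall>\<^sub>F p in at_top. \<exists>S. (\<forall>c. cover p (S c)) \<and>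
        (\<forall>g. (\<forall>c\<in>-Q. g c \<in> S c) \<longrightarrow> near p \<epsilon> (base g) \<and> (\<forall>c\<in>Q. near p \<epsilon> (K c * \<Lambda> c g - p div N)))"
      unfolding base_def \<Lambda>_def by (rule independent_movers[OF fin N(2) QG])
  qed
qed

section \<open>Graphs settled by steering\<close>

definition half_shift :: "int \<Rightarrow> int \<Rightarrow> bool \<Rightarrow> int" where
  "half_shift p D b = (if b then D * ((p + 1) div 2) else - (D * ((p + 1) div 2)))"

lemma half_shift: "odd p \<Longrightarrow> [half_shift p D True - half_shift p D False = D] (mod p)"
proof -
  assume "odd p"
  then have "2 * ((p + 1) div 2) = p + 1" by presburger
  then have "half_shift p D True - half_shift p D False = D + p * D"
    unfolding half_shift_def by (simp add: algebra_simps)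
  then show ?thesis by (simp add: cong_iff_dvd_diff)
qed

lemma half_shift_opposite [simp]: "half_shift p D (\<not> b) = - half_shift p D b"
  by (simp add: half_shift_def)

lemma eventually_avoidable:
  assumes "finite C" "\<forall>\<^sub>F p in at_top. prime p \<longrightarrow> nearable p (1/8) F'"
    and "\<And>p. large_for C U p \<Longrightarrow> avoidable p F' \<Longrightarrow> avoidable p F"
  shows "\<forall>\<^sub>F p in at_top. prime p \<longrightarrow> avoidable p F"
proof (rule eventually_mono[OF eventually_conj[OF assms(2) eventually_large_for[OF assms(1), of U]]], intro impI)
  fix p assume a: "(prime p \<longrightarrow> nearable p (1/8) F') \<and> (prime p \<longrightarrow> large_for C U p)" "prime p"
  then have "p > 10" using large_forD(2) by blast
  then have "avoidable p (\<lambda>g. F' g + 0)" using a by (intro nearable_avoidable[of p "1/8"]) auto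
  then show "avoidable p F" using a assms(3) by simp
qed

text \<open>The second class splits its difference evenly by \<open>half_shift\<close>. Then x2 + y2
  is twice its move whatever the difference is, and it steers through 2 * x1. The first class moves
  last, with x1 * y1 and its own linear terms.\<close>

lemma double_edge_and_loop:
  assumes C: "finite C" "c1 \<in> C" "c2 \<in> C" "c1 \<noteq> c2"
    and F: "\<And>g. F g = g c1 b1 * g c2 b2 + g c1 (\<not> b1) * g c1 b1 + g c2 (\<not> b2) * g c1 b1 + linear_part C U g"
  shows "\<forall>\<^sub>F p in at_top. prime p \<longrightarrow> avoidable p F"
proof -
  define F' where "F' g = g c1 b1 * g c2 b2 + g c1 (\<not> b1) * g c1 b1 + g c2 (\<not> b2) * g c1 b1 + (int (U c1 b1) * g c1 b1 + int (U c1 (\<not> b1)) * g c1 (\<not> b1))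
    + (int (U c2 b2) * g c2 b2 + int (U c2 (\<not> b2)) * g c2 (\<not> b2))" for g
  define base where "base g = (\<Sum>h\<in>{c1}. int (0::nat) * (g h True)^2 + int (1::nat) * g h True * g h False + int (0::nat) * (g h False)^2 + int (U h True) * g h True + int (U h False) * g h False)"
    for g :: "'a \<Rightarrow> bool \<Rightarrow> int"
  define \<Lambda> where "\<Lambda> c g = (\<Sum>h\<in>{c1}. int (2 * of_bool b1) * g h True + int (2 * of_bool (\<not> b1)) * g h False)" for c :: 'a and g :: "'a \<Rightarrow> bool \<Rightarrow> int"
  have base: "base g = g c1 (\<not> b1) * g c1 b1 + (int (U c1 b1) * g c1 b1 + int (U c1 (\<not> b1)) * g c1 (\<not> b1))" for g
    by (cases b1) (simp_all add: base_def)
  have \<Lambda>: "\<Lambda> c g = 2 * g c1 b1" for c g by (cases b1) (simp_all add: \<Lambda>_def)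
  have "\<forall>\<^sub>F p in at_top. prime p \<longrightarrow> nearable p (1/8) F'"
  proof (rule assembly[of "{c2}" _ "\<lambda>p c. half_shift p" "\<lambda>_. 0" F' base \<Lambda> "\<lambda>p c D. int (U c2 b2) * half_shift p D b2 + int (U c2 (\<not> b2)) * half_shift p D (\<not> b2)"
      "\<lambda>h. (int (U c2 b2) + int (U c2 (\<not> b2))) * h c2"])
    fix p :: int and g :: "'a \<Rightarrow> bool \<Rightarrow> int" and h D
    assume "\<And>c b. c \<in> {c2} \<Longrightarrow> g c b = 0 + h c + half_shift p (D c) b"
    then have g: "g c2 b = h c2 + half_shift p (D c2) b" for b by simp
    show "[F' g = base g + (\<Sum>c\<in>{c2}. h c * \<Lambda> c g + (int (U c2 b2) * half_shift p (D c) b2 + int (U c2 (\<not> b2)) * half_shift p (D c) (\<not> b2))) + (int (U c2 b2) + int (U c2 (\<not> b2))) * h c2] (mod p)"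
      unfolding F'_def base \<Lambda> g by (simp add: algebra_simps)
  next
    fix N :: int and \<epsilon> :: real assume N: "N > 0" "\<epsilon> > 0"
    show "\<exists>K::'a \<Rightarrow> int. \<forall>\<^sub>F p in at_top. \<exists>S. (\<forall>c. cover p (S c)) \<and>
        (\<forall>g. (\<forall>c\<in>-{c2}. g c \<in> S c) \<longrightarrow> near p \<epsilon> (base g) \<and> (\<forall>c\<in>{c2}. near p \<epsilon> (K c * \<Lambda> c g - p div N)))"
      unfolding base_def \<Lambda>_def
      by (rule independent_movers[of "{c2}" "{c1}" _ "\<lambda>_. 0" "\<lambda>_. 1" "\<lambda>_. 0" "\<lambda>h. int (U h True)" "\<lambda>h. int (U h False)" "\<lambda>_. c1"
            "\<lambda>_ _. 2 * of_bool b1" "\<lambda>_ _. 2 * of_bool (\<not> b1)"]) (use N C in auto)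
  qed (auto simp: half_shift)
  then show ?thesis
  proof (rule eventually_avoidable[OF C(1), where U = U])
    fix p assume p: "large_for C U p" and a: "avoidable p F'"
    have "avoidable p (\<lambda>g. F' g + linear_part (C - {c1} - {c2}) U g)"
      by (rule avoidable_add_linear_part[OF a p C(1)]) (auto simp: F'_def)
    moreover have "F g = F' g + linear_part (C - {c1} - {c2}) U g" for g
      unfolding F F'_def using C by (simp add: linear_part_remove[of C c1 U g b1] linear_part_remove[of "C - {c1}" c2 U g b2])
    ultimately show "avoidable p F" by presburger
  qed
qed

definition vertex_shift :: "bool \<Rightarrow> int \<Rightarrow> bool \<Rightarrow> int" where
  "vertex_shift \<beta> D b = (if b = \<beta> then 0 else if \<beta> then - D else D)"

lemma vertex_shift: "vertex_shift \<beta> D True - vertex_shift \<beta> D False = D"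
  by (simp add: vertex_shift_def)

lemma vertex_shift_same [simp]: "vertex_shift \<beta> D \<beta> = 0"
  by (simp add: vertex_shift_def)

text \<open>Both neighbours of the first class steer: the second by even splitting, through 2 * x1,
  and the third at x3, through y1. The first class moves last, with linear terms only.\<close>

lemma double_edge_and_leaf:
  assumes C: "finite C" "c1 \<in> C" "c2 \<in> C" "c3 \<in> C" "c1 \<noteq> c2" "c1 \<noteq> c3" "c2 \<noteq> c3"
    and F: "\<And>g. F g = g c1 b1 * g c2 b2 + g c1 (\<not> b1) * g c3 b3 + g c2 (\<not> b2) * g c1 b1 + linear_part C U g"
  shows "\<forall>\<^sub>F p in at_top. prime p \<longrightarrow> avoidable p F"
proof -
  define F' where "F' g = g c1 b1 * g c2 b2 + g c1 (\<not> b1) * g c3 b3 + g c2 (\<not> b2) * g c1 b1 + (int (U c1 b1) * g c1 b1 + int (U c1 (\<not> b1)) * g c1 (\<not> b1))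
    + (int (U c2 b2) * g c2 b2 + int (U c2 (\<not> b2)) * g c2 (\<not> b2)) + (int (U c3 b3) * g c3 b3 + int (U c3 (\<not> b3)) * g c3 (\<not> b3))" for g
  define A where "A c b = (if c = c2 then 2 * of_bool (b = b1) else of_bool (b \<noteq> b1) :: nat)" for c b
  define base where "base g = (\<Sum>h\<in>{c1}. int (0::nat) * (g h True)^2 + int (0::nat) * g h True * g h False + int (0::nat) * (g h False)^2 + int (U h True) * g h True + int (U h False) * g h False)"
    for g :: "'a \<Rightarrow> bool \<Rightarrow> int"
  define \<Lambda> where "\<Lambda> c g = (\<Sum>h\<in>{c1}. int (A c True) * g h True + int (A c False) * g h False)" for c :: 'a and g :: "'a \<Rightarrow> bool \<Rightarrow> int"
  define off where "off p c D = (if c = c2 then half_shift p D else vertex_shift b3 D)" for p c D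
  define \<rho> where "\<rho> p c D = (if c = c2 then int (U c2 b2) * half_shift p D b2 + int (U c2 (\<not> b2)) * half_shift p D (\<not> b2) else int (U c3 (\<not> b3)) * vertex_shift b3 D (\<not> b3))" for p c D
  have base: "base g = int (U c1 b1) * g c1 b1 + int (U c1 (\<not> b1)) * g c1 (\<not> b1)" for g
    by (cases b1) (simp_all add: base_def)
  have \<Lambda>: "\<Lambda> c2 g = 2 * g c1 b1" "\<Lambda> c3 g = g c1 (\<not> b1)" for g using C(7) by (cases b1; simp add: \<Lambda>_def A_def)+
  have "\<forall>\<^sub>F p in at_top. prime p \<longrightarrow> nearable p (1/8) F'"
  proof (rule assembly[of "{c2, c3}" _ off "\<lambda>_. 0" F' base \<Lambda> \<rho> "\<lambda>h. (int (U c2 b2) + int (U c2 (\<not> b2))) * h c2 + (int (U c3 b3) + int (U c3 (\<not> b3))) * h c3"])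
    fix p :: int and g :: "'a \<Rightarrow> bool \<Rightarrow> int" and h D
    assume "\<And>c b. c \<in> {c2, c3} \<Longrightarrow> g c b = 0 + h c + off p c (D c) b"
    then have g: "g c2 b = h c2 + half_shift p (D c2) b" "g c3 b = h c3 + vertex_shift b3 (D c3) b" for b using C by (simp_all add: off_def)
    have "F' g = base g + (\<Sum>c\<in>{c2, c3}. h c * \<Lambda> c g + \<rho> p c (D c)) + ((int (U c2 b2) + int (U c2 (\<not> b2))) * h c2 + (int (U c3 b3) + int (U c3 (\<not> b3))) * h c3)"
      unfolding F'_def base g using C(7) by (simp add: \<Lambda> \<rho>_def algebra_simps)
    then show "[F' g = base g + (\<Sum>c\<in>{c2, c3}. h c * \<Lambda> c g + \<rho> p c (D c)) + ((int (U c2 b2) + int (U c2 (\<not> b2))) * h c2 + (int (U c3 b3) + int (U c3 (\<not> b3))) * h c3)] (mod p)" by simp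
  next
    fix N :: int and \<epsilon> :: real assume N: "N > 0" "\<epsilon> > 0"
    show "\<exists>K::'a \<Rightarrow> int. \<forall>\<^sub>F p in at_top. \<exists>S. (\<forall>c. cover p (S c)) \<and>
        (\<forall>g. (\<forall>c\<in>-{c2, c3}. g c \<in> S c) \<longrightarrow> near p \<epsilon> (base g) \<and> (\<forall>c\<in>{c2, c3}. near p \<epsilon> (K c * \<Lambda> c g - p div N)))"
      unfolding base_def \<Lambda>_def
      by (rule independent_movers[of "{c2, c3}" "{c1}" _ "\<lambda>_. 0" "\<lambda>_. 0" "\<lambda>_. 0" "\<lambda>h. int (U h True)" "\<lambda>h. int (U h False)" "\<lambda>_. c1"
            "\<lambda>c _. A c True" "\<lambda>c _. A c False"]) (use N C in \<open>auto simp: A_def\<close>)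
  qed (auto simp: half_shift off_def vertex_shift)
  then show ?thesis
  proof (rule eventually_avoidable[OF C(1), where U = U])
    fix p assume p: "large_for C U p" and a: "avoidable p F'"
    have "avoidable p (\<lambda>g. F' g + linear_part (C - {c1} - {c2} - {c3}) U g)"
      by (rule avoidable_add_linear_part[OF a p C(1)]) (auto simp: F'_def)
    moreover have "F g = F' g + linear_part (C - {c1} - {c2} - {c3}) U g" for g
      unfolding F F'_def using C by (simp add: linear_part_remove[of C c1 U g b1] linear_part_remove[of "C - {c1}" c2 U g b2] linear_part_remove[of "C - {c1} - {c2}" c3 U g b3])
    ultimately show "avoidable p F" by presburger
  qed
qed

text \<open>x1 = -v1 removes y1 and leaves the second class with \<open>\<alpha>\<close> * x2 +
  \<open>v2\<close> * y2 beside the edge y2 * x3. The third class steers through y2, and the second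
  moves last.\<close>

lemma loop_and_leaf:
  assumes C: "finite C" "c1 \<in> C" "c2 \<in> C" "c3 \<in> C" "c1 \<noteq> c2" "c1 \<noteq> c3" "c2 \<noteq> c3"
    and F: "\<And>g. F g = g c1 b1 * g c2 b2 + g c1 (\<not> b1) * g c1 b1 + g c2 (\<not> b2) * g c3 b3 + linear_part C U g"
  shows "\<forall>\<^sub>F p in at_top. prime p \<longrightarrow> avoidable p F"
proof -
  define \<alpha> where "\<alpha> = int (U c2 b2) - int (U c1 (\<not> b1))"
  define v2 where "v2 = int (U c2 (\<not> b2))"
  \<comment> \<open>\<open>\<alpha>\<close> can be negative, and if \<open>\<alpha> + v2 = 0\<close>
    the linear part of the second class depends on its difference alone. Moving x3 around
    \<open>\<kappa>\<close> instead of 0 raises the coefficient of y2 so that the sum becomes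
    1.\<close>
  define \<kappa> where "\<kappa> = 1 - \<alpha> - v2"
  define F' where "F' g = \<alpha> * g c2 b2 + v2 * g c2 (\<not> b2) + g c2 (\<not> b2) * g c3 b3 + (int (U c3 b3) * g c3 b3 + int (U c3 (\<not> b3)) * g c3 (\<not> b3))" for g
  define co where "co b = (if b = b2 then \<alpha> else v2 + \<kappa>)" for b
  define base where "base g = (\<Sum>h\<in>{c2}. int (0::nat) * (g h True)^2 + int (0::nat) * g h True * g h False + int (0::nat) * (g h False)^2 + co True * g h True + co False * g h False)"
    for g :: "'a \<Rightarrow> bool \<Rightarrow> int"
  define \<Lambda> where "\<Lambda> c g = (\<Sum>h\<in>{c2}. int (of_bool (\<not> b2)) * g h True + int (of_bool b2) * g h False)" for c :: 'a and g :: "'a \<Rightarrow> bool \<Rightarrow> int"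
  have base: "base g = \<alpha> * g c2 b2 + (v2 + \<kappa>) * g c2 (\<not> b2)" for g
    by (cases b2) (simp_all add: base_def co_def)
  have \<Lambda>: "\<Lambda> c g = g c2 (\<not> b2)" for c g by (cases b2) (simp_all add: \<Lambda>_def)
  have "\<forall>\<^sub>F p in at_top. prime p \<longrightarrow> nearable p (1/8) F'"
  proof (rule assembly[of "{c3}" _ "\<lambda>p c D. vertex_shift b3 D" "\<lambda>_. \<kappa>" F' base \<Lambda> "\<lambda>p c D. int (U c3 (\<not> b3)) * vertex_shift b3 D (\<not> b3)"
      "\<lambda>h. (int (U c3 b3) + int (U c3 (\<not> b3))) * (\<kappa> + h c3)"])
    fix p :: int and g :: "'a \<Rightarrow> bool \<Rightarrow> int" and h D
    assume "\<And>c b. c \<in> {c3} \<Longrightarrow> g c b = \<kappa> + h c + vertex_shift b3 (D c) b"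
    then have g: "g c3 b = \<kappa> + h c3 + vertex_shift b3 (D c3) b" for b by simp
    show "[F' g = base g + (\<Sum>c\<in>{c3}. h c * \<Lambda> c g + int (U c3 (\<not> b3)) * vertex_shift b3 (D c) (\<not> b3)) + (int (U c3 b3) + int (U c3 (\<not> b3))) * (\<kappa> + h c3)] (mod p)"
      unfolding F'_def base \<Lambda> g by (simp add: algebra_simps)
  next
    fix N :: int and \<epsilon> :: real assume N: "N > 0" "\<epsilon> > 0"
    have "co True + co False \<noteq> 0" by (cases b2) (simp_all add: co_def \<kappa>_def)
    then show "\<exists>K::'a \<Rightarrow> int. \<forall>\<^sub>F p in at_top. \<exists>S. (\<forall>c. cover p (S c)) \<and>
        (\<forall>g. (\<forall>c\<in>-{c3}. g c \<in> S c) \<longrightarrow> near p \<epsilon> (base g) \<and> (\<forall>c\<in>{c3}. near p \<epsilon> (K c * \<Lambda> c g - p div N)))"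
      unfolding base_def \<Lambda>_def
      by (intro independent_movers[of "{c3}" "{c2}" _ "\<lambda>_. 0" "\<lambda>_. 0" "\<lambda>_. 0" "\<lambda>h. co True" "\<lambda>h. co False" "\<lambda>_. c2"
            "\<lambda>_ _. of_bool (\<not> b2)" "\<lambda>_ _. of_bool b2"]) (use N C in auto)
  qed (auto simp: vertex_shift)
  then show ?thesis
  proof (rule eventually_avoidable[OF C(1), where U = U])
    fix p assume p: "large_for C U p" and a: "avoidable p F'"
    have "avoidable p (\<lambda>g. F' g + linear_part (C - {c1} - {c2} - {c3}) U g)"
      by (rule avoidable_add_linear_part[OF a p C(1)]) (auto simp: F'_def)
    then show "avoidable p F"
    proof (rule avoidable_restrict[where A = "{c1}" and T = "\<lambda>_. {f. f b1 = - int (U c1 (\<not> b1))}" and t = "- int (U c1 b1) * int (U c1 (\<not> b1))"])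
      fix g assume "\<And>c. c \<in> {c1} \<Longrightarrow> g c \<in> {f. f b1 = - int (U c1 (\<not> b1))}"
      then have g: "g c1 b1 = - int (U c1 (\<not> b1))" by simp
      have "F g = (F' g + linear_part (C - {c1} - {c2} - {c3}) U g) + - int (U c1 b1) * int (U c1 (\<not> b1))"
        unfolding F F'_def \<alpha>_def v2_def using C g by (simp add: linear_part_remove[of C c1 U g b1] linear_part_remove[of "C - {c1}" c2 U g b2] linear_part_remove[of "C - {c1} - {c2}" c3 U g b3] algebra_simps)
      then show "[F g = (F' g + linear_part (C - {c1} - {c2} - {c3}) U g) + - int (U c1 b1) * int (U c1 (\<not> b1))] (mod p)" by simp
    next
      fix g g' :: "'a \<Rightarrow> bool \<Rightarrow> int" assume gg: "\<And>c. c \<notin> {c1} \<Longrightarrow> g c = g' c"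
      have "linear_part (C - {c1} - {c2} - {c3}) U g = linear_part (C - {c1} - {c2} - {c3}) U g'"
        unfolding linear_part_def by (rule sum.cong) (use gg in auto)
      then show "F' g + linear_part (C - {c1} - {c2} - {c3}) U g = F' g' + linear_part (C - {c1} - {c2} - {c3}) U g'"
        using gg[of c2] gg[of c3] C by (simp add: F'_def)
    qed (rule cover_fixed)
  qed
qed

lemma near_half_add: "near p (\<epsilon> / 2) s \<Longrightarrow> near p (\<epsilon> / 2) t \<Longrightarrow> near p \<epsilon> (s + t)"
  using near_add[of p "\<epsilon> / 2" s "\<epsilon> / 2" t] by simp

lemma adjacent_cover_pair:
  assumes "N > 0" "\<epsilon> > 0" "\<epsilon>' > 0" "\<epsilon>' \<le> \<epsilon>" "c1 \<noteq> c2"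
  shows "\<exists>K. \<forall>\<^sub>F p in at_top. \<forall>t::int. \<exists>S. (\<forall>c. cover p (S c)) \<and>
     (\<forall>f1\<in>S c1. \<forall>f2\<in>S c2. near p \<epsilon>' ((f1 b1 + s1) * (f2 b2 + s2)) \<and> near p \<epsilon>' (V * f2 (\<not> b2)) \<and>
        near p \<epsilon>' (K * f1 (\<not> b1) - t) \<and> near p \<epsilon>' (K * f2 (\<not> b2) - p div N))"
proof -
  obtain K where ev: "\<forall>\<^sub>F p in at_top. \<exists>A1 A2. (\<forall>t D. \<exists>X\<in>A1. near p \<epsilon>' (K * (X - D) - t)) \<and>
    (\<forall>D. \<exists>X\<in>A2. near p \<epsilon>' (V * (X - D)) \<and> near p \<epsilon>' (K * (X - D) - p div N)) \<and> (\<forall>X\<in>A1. \<forall>X'\<in>A2. near p \<epsilon>' (X * X'))"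
    using adjacent_movers[OF assms(1,3), of V] by (elim exE)
  show ?thesis
  proof (rule exI[of _ K], rule eventually_mono[OF ev], elim exE conjE, intro allI)
    fix p A1 A2 t
    assume A1: "\<forall>t D. \<exists>X\<in>A1. near p \<epsilon>' (K * (X - D) - t)"
      and A2: "\<forall>D. \<exists>X\<in>A2. near p \<epsilon>' (V * (X - D)) \<and> near p \<epsilon>' (K * (X - D) - p div N)"
      and A: "\<forall>X\<in>A1. \<forall>X'\<in>A2. near p \<epsilon>' (X * X')"
    define T1 where "T1 = {f. f b1 + s1 \<in> A1 \<and> near p \<epsilon>' (K * f (\<not> b1) - t)}"
    define T2 where "T2 = {f. f b2 + s2 \<in> A2 \<and> near p \<epsilon>' (V * f (\<not> b2)) \<and> near p \<epsilon>' (K * f (\<not> b2) - p div N)}"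
    have "cover p T1" unfolding cover_iff[of _ _ b1]
    proof
      fix D
      obtain X where X: "X \<in> A1" "near p \<epsilon>' (K * (X - (D + s1)) - t)" using A1 by blast
      then have "(\<lambda>b. if b = b1 then X - s1 else X - s1 - D) \<in> T1" by (simp add: T1_def algebra_simps)
      then show "\<exists>f\<in>T1. [f b1 - f (\<not> b1) = D] (mod p)" by (rule bexI[rotated]) simp
    qed
    moreover have "cover p T2" unfolding cover_iff[of _ _ b2]
    proof
      fix D
      obtain X where X: "X \<in> A2" "near p \<epsilon>' (V * (X - (D + s2)))" "near p \<epsilon>' (K * (X - (D + s2)) - p div N)" using A2 by blast
      then have "(\<lambda>b. if b = b2 then X - s2 else X - s2 - D) \<in> T2" by (simp add: T2_def algebra_simps)
      then show "\<exists>f\<in>T2. [f b2 - f (\<not> b2) = D] (mod p)" by (rule bexI[rotated]) simp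
    qed
    ultimately show "\<exists>S. (\<forall>c. cover p (S c)) \<and>
     (\<forall>f1\<in>S c1. \<forall>f2\<in>S c2. near p \<epsilon>' ((f1 b1 + s1) * (f2 b2 + s2)) \<and> near p \<epsilon>' (V * f2 (\<not> b2)) \<and>
        near p \<epsilon>' (K * f1 (\<not> b1) - t) \<and> near p \<epsilon>' (K * f2 (\<not> b2) - p div N))"
      using assms(5) A by (intro exI[of _ "\<lambda>c. if c = c1 then T1 else if c = c2 then T2 else UNIV"]) (auto simp: T1_def T2_def cover_UNIV)
  qed
qed

text \<open>y1 and y2 have to be multipliers for the leaves x3 and x4 although x1 and x2 are joined,
  so no independent set of movers exists, and \<open>adjacent_movers\<close> takes its place. The
  linear terms of x1 and x2 complete their product to (x1 + u2) * (x2 + u1).\<close>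

lemma two_leaves:
  assumes C: "finite C" "c1 \<in> C" "c2 \<in> C" "c3 \<in> C" "c4 \<in> C" "c1 \<noteq> c2" "c1 \<noteq> c3" "c2 \<noteq> c3" "c1 \<noteq> c4" "c2 \<noteq> c4" "c3 \<noteq> c4"
    and F: "\<And>g. F g = g c1 b1 * g c2 b2 + g c1 (\<not> b1) * g c3 b3 + g c2 (\<not> b2) * g c4 b4 + linear_part C U g"
  shows "\<forall>\<^sub>F p in at_top. prime p \<longrightarrow> avoidable p F"
proof -
  define u1 v1 u2 v2 where uv: "u1 = int (U c1 b1)" "v1 = int (U c1 (\<not> b1))" "u2 = int (U c2 b2)" "v2 = int (U c2 (\<not> b2))"
  \<comment> \<open>Starting x3 at -v1 cancels the linear term v1 * y1; only the term of y2 is kept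
    small by \<open>adjacent_movers\<close> itself.\<close>
  define \<kappa> where "\<kappa> c = (if c = c3 then - v1 else 0)" for c
  define \<beta> where "\<beta> c = (if c = c3 then b3 else b4)" for c
  define F' where "F' g = g c1 b1 * g c2 b2 + g c1 (\<not> b1) * g c3 b3 + g c2 (\<not> b2) * g c4 b4 + (u1 * g c1 b1 + v1 * g c1 (\<not> b1)) + (u2 * g c2 b2 + v2 * g c2 (\<not> b2))
     + (int (U c3 b3) * g c3 b3 + int (U c3 (\<not> b3)) * g c3 (\<not> b3)) + (int (U c4 b4) * g c4 b4 + int (U c4 (\<not> b4)) * g c4 (\<not> b4))" for g
  define base where "base g = (g c1 b1 + u2) * (g c2 b2 + u1) + v2 * g c2 (\<not> b2)" for g :: "'a \<Rightarrow> bool \<Rightarrow> int"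
  define \<Lambda> where "\<Lambda> c g = (if c = c3 then g c1 (\<not> b1) else g c2 (\<not> b2))" for c and g :: "'a \<Rightarrow> bool \<Rightarrow> int"
  define W where "W h = (int (U c3 b3) + int (U c3 (\<not> b3))) * (h c3 - v1) + (int (U c4 b4) + int (U c4 (\<not> b4))) * h c4 - u1 * u2" for h :: "'a \<Rightarrow> int"
  have "\<forall>\<^sub>F p in at_top. prime p \<longrightarrow> nearable p (1/8) F'"
  proof (rule assembly[of "{c3, c4}" _ "\<lambda>p c D. vertex_shift (\<beta> c) D" \<kappa> F' base \<Lambda> "\<lambda>p c D. int (U c (\<not> \<beta> c)) * vertex_shift (\<beta> c) D (\<not> \<beta> c)" W])
    fix p :: int and g :: "'a \<Rightarrow> bool \<Rightarrow> int" and h D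
    assume "\<And>c b. c \<in> {c3, c4} \<Longrightarrow> g c b = \<kappa> c + h c + vertex_shift (\<beta> c) (D c) b"
    then have g: "g c3 b = - v1 + h c3 + vertex_shift b3 (D c3) b" "g c4 b = h c4 + vertex_shift b4 (D c4) b" for b using C by (simp_all add: \<kappa>_def \<beta>_def)
    have "F' g = base g + (\<Sum>c\<in>{c3, c4}. h c * \<Lambda> c g + int (U c (\<not> \<beta> c)) * vertex_shift (\<beta> c) (D c) (\<not> \<beta> c)) + W h"
      unfolding F'_def base_def W_def g using C(11) by (simp add: \<Lambda>_def \<beta>_def algebra_simps)
    then show "[F' g = base g + (\<Sum>c\<in>{c3, c4}. h c * \<Lambda> c g + int (U c (\<not> \<beta> c)) * vertex_shift (\<beta> c) (D c) (\<not> \<beta> c)) + W h] (mod p)" by simp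
  next
    fix N :: int and \<epsilon> :: real assume N: "N > 0" "\<epsilon> > 0"
    obtain K where ev: "\<forall>\<^sub>F p in at_top. \<forall>t::int. \<exists>S. (\<forall>c. cover p (S c)) \<and>
     (\<forall>f1\<in>S c1. \<forall>f2\<in>S c2. near p (\<epsilon> / 2) ((f1 b1 + u2) * (f2 b2 + u1)) \<and> near p (\<epsilon> / 2) (v2 * f2 (\<not> b2)) \<and>
        near p (\<epsilon> / 2) (K * f1 (\<not> b1) - t) \<and> near p (\<epsilon> / 2) (K * f2 (\<not> b2) - p div N))"
      using adjacent_cover_pair[OF N(1,2), of "\<epsilon> / 2" c1 c2 b1 u2 b2 u1 v2] N C by auto
    show "\<exists>K::'a \<Rightarrow> int. \<forall>\<^sub>F p in at_top. \<exists>S. (\<forall>c. cover p (S c)) \<and>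
        (\<forall>g. (\<forall>c\<in>-{c3, c4}. g c \<in> S c) \<longrightarrow> near p \<epsilon> (base g) \<and> (\<forall>c\<in>{c3, c4}. near p \<epsilon> (K c * \<Lambda> c g - p div N)))"
    proof (rule exI[of _ "\<lambda>_. K"], rule eventually_mono[OF eventually_conj[OF ev eventually_ge_at_top[of 0]]], elim conjE)
      fix p :: int assume p0: "0 \<le> p" and "\<forall>t::int. \<exists>S. (\<forall>c. cover p (S c)) \<and>
       (\<forall>f1\<in>S c1. \<forall>f2\<in>S c2. near p (\<epsilon> / 2) ((f1 b1 + u2) * (f2 b2 + u1)) \<and> near p (\<epsilon> / 2) (v2 * f2 (\<not> b2)) \<and>
        near p (\<epsilon> / 2) (K * f1 (\<not> b1) - t) \<and> near p (\<epsilon> / 2) (K * f2 (\<not> b2) - p div N))"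
      then obtain S where S: "\<forall>c. cover p (S c)" "\<forall>f1\<in>S c1. \<forall>f2\<in>S c2. near p (\<epsilon> / 2) ((f1 b1 + u2) * (f2 b2 + u1)) \<and> near p (\<epsilon> / 2) (v2 * f2 (\<not> b2)) \<and>
        near p (\<epsilon> / 2) (K * f1 (\<not> b1) - p div N) \<and> near p (\<epsilon> / 2) (K * f2 (\<not> b2) - p div N)" by blast
      have "near p \<epsilon> (base g) \<and> (\<forall>c\<in>{c3, c4}. near p \<epsilon> (K * \<Lambda> c g - p div N))" if g: "\<forall>c\<in>-{c3, c4}. g c \<in> S c" for g
      proof -
        have "g c1 \<in> S c1" "g c2 \<in> S c2" using g C by auto
        then have n: "near p (\<epsilon> / 2) ((g c1 b1 + u2) * (g c2 b2 + u1))" "near p (\<epsilon> / 2) (v2 * g c2 (\<not> b2))"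
          "near p (\<epsilon> / 2) (K * g c1 (\<not> b1) - p div N)" "near p (\<epsilon> / 2) (K * g c2 (\<not> b2) - p div N)" using S(2) by blast+
        have "near p \<epsilon> (base g)" unfolding base_def by (rule near_half_add[OF n(1,2)])
        moreover have "near p \<epsilon> (K * \<Lambda> c g - p div N)" if "c \<in> {c3, c4}" for c
          using near_mono[OF n(3), of \<epsilon>] near_mono[OF n(4), of \<epsilon>] N p0 by (simp add: \<Lambda>_def)
        ultimately show ?thesis by blast
      qed
      then show "\<exists>S. (\<forall>c. cover p (S c)) \<and>
        (\<forall>g. (\<forall>c\<in>-{c3, c4}. g c \<in> S c) \<longrightarrow> near p \<epsilon> (base g) \<and> (\<forall>c\<in>{c3, c4}. near p \<epsilon> (K * \<Lambda> c g - p div N)))"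
        using S(1) by blast
    qed
  qed (auto simp: vertex_shift)
  then show ?thesis
  proof (rule eventually_avoidable[OF C(1), where U = U])
    fix p assume p: "large_for C U p" and a: "avoidable p F'"
    have "avoidable p (\<lambda>g. F' g + linear_part (C - {c1} - {c2} - {c3} - {c4}) U g)"
      by (rule avoidable_add_linear_part[OF a p C(1)]) (auto simp: F'_def)
    moreover have "F g = F' g + linear_part (C - {c1} - {c2} - {c3} - {c4}) U g" for g
      unfolding F F'_def uv using C by (simp add: linear_part_remove[of C c1 U g b1] linear_part_remove[of "C - {c1}" c2 U g b2]
        linear_part_remove[of "C - {c1} - {c2}" c3 U g b3] linear_part_remove[of "C - {c1} - {c2} - {c3}" c4 U g b4])
    ultimately show "avoidable p F" by presburger
  qed
qed

text \<open>y1 and y2 meet the same vertex x3, so their sum is the multiplier: scaled by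
  \<open>K\<close>, the first class supplies about 0 and the second about \<open>p div N\<close>.
  Starting x3 at -v1 cancels v1 * y1 but changes the coefficient of y2 to v2 - v1, which may be
  negative; this is the parameter \<open>V\<close> of the movers.\<close>

lemma triangle_at_vertex:
  assumes C: "finite C" "c1 \<in> C" "c2 \<in> C" "c3 \<in> C" "c1 \<noteq> c2" "c1 \<noteq> c3" "c2 \<noteq> c3"
    and F: "\<And>g. F g = g c1 b1 * g c2 b2 + g c1 (\<not> b1) * g c3 b3 + g c2 (\<not> b2) * g c3 b3 + linear_part C U g"
  shows "\<forall>\<^sub>F p in at_top. prime p \<longrightarrow> avoidable p F"
proof -
  define u1 v1 u2 v2 where uv: "u1 = int (U c1 b1)" "v1 = int (U c1 (\<not> b1))" "u2 = int (U c2 b2)" "v2 = int (U c2 (\<not> b2))"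
  define F' where "F' g = g c1 b1 * g c2 b2 + g c1 (\<not> b1) * g c3 b3 + g c2 (\<not> b2) * g c3 b3 + (u1 * g c1 b1 + v1 * g c1 (\<not> b1)) + (u2 * g c2 b2 + v2 * g c2 (\<not> b2))
     + (int (U c3 b3) * g c3 b3 + int (U c3 (\<not> b3)) * g c3 (\<not> b3))" for g
  define base where "base g = (g c1 b1 + u2) * (g c2 b2 + u1) + (v2 - v1) * g c2 (\<not> b2)" for g :: "'a \<Rightarrow> bool \<Rightarrow> int"
  define \<Lambda> where "\<Lambda> c g = g c1 (\<not> b1) + g c2 (\<not> b2)" for c :: 'a and g :: "'a \<Rightarrow> bool \<Rightarrow> int"
  define W where "W h = (int (U c3 b3) + int (U c3 (\<not> b3))) * (h c3 - v1) - u1 * u2" for h :: "'a \<Rightarrow> int"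
  have "\<forall>\<^sub>F p in at_top. prime p \<longrightarrow> nearable p (1/8) F'"
  proof (rule assembly[of "{c3}" _ "\<lambda>p c D. vertex_shift b3 D" "\<lambda>_. - v1" F' base \<Lambda> "\<lambda>p c D. int (U c3 (\<not> b3)) * vertex_shift b3 D (\<not> b3)" W])
    fix p :: int and g :: "'a \<Rightarrow> bool \<Rightarrow> int" and h D
    assume "\<And>c b. c \<in> {c3} \<Longrightarrow> g c b = - v1 + h c + vertex_shift b3 (D c) b"
    then have g: "g c3 b = - v1 + h c3 + vertex_shift b3 (D c3) b" for b by simp
    have "F' g = base g + (\<Sum>c\<in>{c3}. h c * \<Lambda> c g + int (U c3 (\<not> b3)) * vertex_shift b3 (D c) (\<not> b3)) + W h"
      unfolding F'_def base_def W_def g by (simp add: \<Lambda>_def algebra_simps)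
    then show "[F' g = base g + (\<Sum>c\<in>{c3}. h c * \<Lambda> c g + int (U c3 (\<not> b3)) * vertex_shift b3 (D c) (\<not> b3)) + W h] (mod p)" by simp
  next
    fix N :: int and \<epsilon> :: real assume N: "N > 0" "\<epsilon> > 0"
    obtain K where ev: "\<forall>\<^sub>F p in at_top. \<forall>t::int. \<exists>S. (\<forall>c. cover p (S c)) \<and>
     (\<forall>f1\<in>S c1. \<forall>f2\<in>S c2. near p (\<epsilon> / 2) ((f1 b1 + u2) * (f2 b2 + u1)) \<and> near p (\<epsilon> / 2) ((v2 - v1) * f2 (\<not> b2)) \<and>
        near p (\<epsilon> / 2) (K * f1 (\<not> b1) - t) \<and> near p (\<epsilon> / 2) (K * f2 (\<not> b2) - p div N))"
      using adjacent_cover_pair[OF N(1,2), of "\<epsilon> / 2" c1 c2 b1 u2 b2 u1 "v2 - v1"] N C by auto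
    show "\<exists>K::'a \<Rightarrow> int. \<forall>\<^sub>F p in at_top. \<exists>S. (\<forall>c. cover p (S c)) \<and>
        (\<forall>g. (\<forall>c\<in>-{c3}. g c \<in> S c) \<longrightarrow> near p \<epsilon> (base g) \<and> (\<forall>c\<in>{c3}. near p \<epsilon> (K c * \<Lambda> c g - p div N)))"
    proof (rule exI[of _ "\<lambda>_. K"], rule eventually_mono[OF ev])
      fix p :: int assume "\<forall>t::int. \<exists>S. (\<forall>c. cover p (S c)) \<and>
       (\<forall>f1\<in>S c1. \<forall>f2\<in>S c2. near p (\<epsilon> / 2) ((f1 b1 + u2) * (f2 b2 + u1)) \<and> near p (\<epsilon> / 2) ((v2 - v1) * f2 (\<not> b2)) \<and>
        near p (\<epsilon> / 2) (K * f1 (\<not> b1) - t) \<and> near p (\<epsilon> / 2) (K * f2 (\<not> b2) - p div N))"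
      then obtain S where S: "\<forall>c. cover p (S c)" "\<forall>f1\<in>S c1. \<forall>f2\<in>S c2. near p (\<epsilon> / 2) ((f1 b1 + u2) * (f2 b2 + u1)) \<and> near p (\<epsilon> / 2) ((v2 - v1) * f2 (\<not> b2)) \<and>
        near p (\<epsilon> / 2) (K * f1 (\<not> b1) - 0) \<and> near p (\<epsilon> / 2) (K * f2 (\<not> b2) - p div N)" by blast
      have "near p \<epsilon> (base g) \<and> (\<forall>c\<in>{c3}. near p \<epsilon> (K * \<Lambda> c g - p div N))" if g: "\<forall>c\<in>-{c3}. g c \<in> S c" for g
      proof -
        have "g c1 \<in> S c1" "g c2 \<in> S c2" using g C by auto
        then have n: "near p (\<epsilon> / 2) ((g c1 b1 + u2) * (g c2 b2 + u1))" "near p (\<epsilon> / 2) ((v2 - v1) * g c2 (\<not> b2))"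
          "near p (\<epsilon> / 2) (K * g c1 (\<not> b1) - 0)" "near p (\<epsilon> / 2) (K * g c2 (\<not> b2) - p div N)" using S(2) by blast+
        have "near p \<epsilon> (base g)" unfolding base_def by (rule near_half_add[OF n(1,2)])
        moreover have "near p \<epsilon> (K * \<Lambda> c g - p div N)" for c
          using near_half_add[OF n(3,4)] by (simp add: \<Lambda>_def algebra_simps)
        ultimately show ?thesis by blast
      qed
      then show "\<exists>S. (\<forall>c. cover p (S c)) \<and>
        (\<forall>g. (\<forall>c\<in>-{c3}. g c \<in> S c) \<longrightarrow> near p \<epsilon> (base g) \<and> (\<forall>c\<in>{c3}. near p \<epsilon> (K * \<Lambda> c g - p div N)))"
        using S(1) by blast
    qed
  qed (auto simp: vertex_shift)
  then show ?thesis
  proof (rule eventually_avoidable[OF C(1), where U = U])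
    fix p assume p: "large_for C U p" and a: "avoidable p F'"
    have "avoidable p (\<lambda>g. F' g + linear_part (C - {c1} - {c2} - {c3}) U g)"
      by (rule avoidable_add_linear_part[OF a p C(1)]) (auto simp: F'_def)
    moreover have "F g = F' g + linear_part (C - {c1} - {c2} - {c3}) U g" for g
      unfolding F F'_def uv using C by (simp add: linear_part_remove[of C c1 U g b1] linear_part_remove[of "C - {c1}" c2 U g b2] linear_part_remove[of "C - {c1} - {c2}" c3 U g b3])
    ultimately show "avoidable p F" by presburger
  qed
qed

section \<open>Sorting the graphs with at most three edges\<close>

lemma eventually_avoidableI:
  assumes "finite C" "\<And>p. large_for C U p \<Longrightarrow> avoidable p F"
  shows "\<forall>\<^sub>F p in at_top. prime p \<longrightarrow> avoidable p F"
  by (rule eventually_mono[OF eventually_large_for[OF assms(1), of U]]) (use assms(2) in blast)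

lemma opposite_pair_and_edge_meeting:
  assumes C: "finite C" "c1 \<in> C" "c2 \<in> C" "c1 \<noteq> c2" and R: "fst R \<in> C" and P: "fst P = c1 \<or> fst P = c2"
    and F: "\<And>g. F g = g c1 b1 * g c2 b2 + g c1 (\<not> b1) * g c2 (\<not> b2) + val g P * val g R + linear_part C U g"
  shows "\<forall>\<^sub>F p in at_top. prime p \<longrightarrow> avoidable p F"
proof (rule eventually_avoidableI[OF C(1), of U])
  fix p assume p: "large_for C U p"
  obtain c3 b3 where Rp: "R = (c3, b3)" and c3: "c3 \<in> C" using R by (cases R) auto
  obtain c b where Pp: "P = (c, b)" by (cases P)
  note vertex = opposite_pair_at_vertex[OF C(1) _ _ c3 _ p]
  consider "c = c1" "b = b1" | "c = c1" "b = (\<not> b1)" | "c = c2" "b = b2" | "c = c2" "b = (\<not> b2)" using P Pp by auto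
  then show "avoidable p F"
  proof cases
    case 1
    show ?thesis by (rule vertex[of c1 c2 F b1 b2 b3]) (use C in \<open>simp_all add: F Pp Rp 1\<close>)
  next
    case 2
    show ?thesis by (rule vertex[of c1 c2 F "\<not> b1" "\<not> b2" b3]) (use C in \<open>simp_all add: F Pp Rp 2\<close>)
  next
    case 3
    show ?thesis by (rule vertex[of c2 c1 F b2 b1 b3]) (use C in \<open>simp_all add: F Pp Rp 3\<close>)
  next
    case 4
    show ?thesis by (rule vertex[of c2 c1 F "\<not> b2" "\<not> b1" b3]) (use C in \<open>simp_all add: F Pp Rp 4\<close>)
  qed
qed

lemma opposite_pair_and_edge:
  assumes C: "finite C" "c1 \<in> C" "c2 \<in> C" "c1 \<noteq> c2" and PR: "fst P \<in> C" "fst R \<in> C"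
    and F: "\<And>g. F g = g c1 b1 * g c2 b2 + g c1 (\<not> b1) * g c2 (\<not> b2) + val g P * val g R + linear_part C U g"
  shows "\<forall>\<^sub>F p in at_top. prime p \<longrightarrow> avoidable p F"
proof -
  consider "fst P = c1 \<or> fst P = c2" | "fst R = c1 \<or> fst R = c2" | "fst P \<in> C - {c1} - {c2}" "fst R \<in> C - {c1} - {c2}"
    using PR by blast
  then show ?thesis
  proof cases
    case 1
    show ?thesis by (rule opposite_pair_and_edge_meeting[OF C PR(2) 1 F])
  next
    case 2
    show ?thesis by (rule opposite_pair_and_edge_meeting[OF C PR(1) 2, of F b1 b2 U]) (simp add: F)
  next
    case 3
    define F' where "F' g = (\<Sum>i\<in>{0::nat}. val g P * val g R) + linear_part (C - {c1} - {c2}) U g" for g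
    have "\<forall>\<^sub>F p in at_top. prime p \<longrightarrow> nearable p (1/8) F'"
      unfolding F'_def
    proof (rule independent_configuration)
      fix i :: nat assume "i \<in> {0}" and ne: "fst P \<noteq> fst R"
      have "\<not> touched {0} (\<lambda>_. P) (\<lambda>_. R) (fst P) (\<not> snd P)" using ne by (cases P; cases R) (simp add: touched_def)
      then show "\<not> (\<forall>b. touched {0} (\<lambda>_. P) (\<lambda>_. R) (fst P) b) \<or> \<not> (\<forall>b. touched {0} (\<lambda>_. P) (\<lambda>_. R) (fst R) b)" by blast
    qed (use C 3 in auto)
    then show ?thesis
    proof (rule eventually_avoidable[OF C(1), where U = U])
      fix p assume p: "large_for C U p" and a: "avoidable p F'"
      define u1 v1 u2 v2 where uv: "u1 = int (U c1 b1)" "v1 = int (U c1 (\<not> b1))" "u2 = int (U c2 b2)" "v2 = int (U c2 (\<not> b2))"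
      show "avoidable p F"
      \<comment> \<open>x1 = -u2 and y2 = -v1 make the opposite pair together with the linear terms
        of both classes constant, so only the separate edge is left.\<close>
      proof (rule avoidable_restrict[OF a, where A = "{c1, c2}"
            and T = "\<lambda>c. if c = c1 then {f. f b1 = - u2} else {f. f (\<not> b2) = - v1}" and t = "- u1 * u2 - v1 * v2"])
        show "cover p (if c = c1 then {f. f b1 = - u2} else {f. f (\<not> b2) = - v1})" for c
          using cover_fixed[of p b1] cover_fixed[of p "\<not> b2"] by simp
      next
        fix g assume g: "\<And>c. c \<in> {c1, c2} \<Longrightarrow> g c \<in> (if c = c1 then {f. f b1 = - u2} else {f. f (\<not> b2) = - v1})"
        have g12: "g c1 b1 = - u2" "g c2 (\<not> b2) = - v1" using g[of c1] g[of c2] C(4) by simp_all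
        have "F g = F' g + (- u1 * u2 - v1 * v2)"
          unfolding F F'_def using C by (simp add: linear_part_remove[of C c1 U g b1] linear_part_remove[of "C - {c1}" c2 U g b2] g12 uv[symmetric] algebra_simps)
        then show "[F g = F' g + (- u1 * u2 - v1 * v2)] (mod p)" by simp
      next
        fix g g' :: "'a \<Rightarrow> bool \<Rightarrow> int" assume gg: "\<And>c. c \<notin> {c1, c2} \<Longrightarrow> g c = g' c"
        have "linear_part (C - {c1} - {c2}) U g = linear_part (C - {c1} - {c2}) U g'"
          unfolding linear_part_def by (rule sum.cong) (use gg in auto)
        then show "F' g = F' g'" using gg 3 by (simp add: F'_def val_def)
      qed
    qed
  qed
qed

text \<open>\<open>P\<close> and \<open>R\<close> are the far ends of the edges at y1 and y2. If
  \<open>P\<close> is y2 or \<open>R\<close> is y1, there is an opposite pair; all other positions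
  give, up to exchanging the two classes, one of the graphs treated before.\<close>

lemma edge_with_two_ends:
  assumes C: "finite C" "c1 \<in> C" "c2 \<in> C" "c1 \<noteq> c2" and PR: "fst P \<in> C" "fst R \<in> C"
    and F: "\<And>g. F g = g c1 b1 * g c2 b2 + g c1 (\<not> b1) * val g P + g c2 (\<not> b2) * val g R + linear_part C U g"
  shows "\<forall>\<^sub>F p in at_top. prime p \<longrightarrow> avoidable p F"
proof -
  have C': "c2 \<noteq> c1" using C by blast
  note ev = eventually_avoidableI[OF C(1), of U]
  have P: "P = (c1, b1) \<or> P = (c1, \<not> b1) \<or> P = (c2, b2) \<or> P = (c2, \<not> b2) \<or> (fst P \<noteq> c1 \<and> fst P \<noteq> c2)"
    by (cases P) auto
  have R: "R = (c1, b1) \<or> R = (c1, \<not> b1) \<or> R = (c2, b2) \<or> R = (c2, \<not> b2) \<or> (fst R \<noteq> c1 \<and> fst R \<noteq> c2)"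
    by (cases R) auto
  show ?thesis
  proof (cases "P = (c2, \<not> b2) \<or> R = (c1, \<not> b1)")
    case True
    then show ?thesis
    proof
      assume "P = (c2, \<not> b2)"
      then show ?thesis
        using C PR by (intro opposite_pair_and_edge[OF C, of P R F b1 b2 U]) (simp_all add: F)
    next
      assume "R = (c1, \<not> b1)"
      then show ?thesis
        using C PR by (intro opposite_pair_and_edge[OF C, of R P F b1 b2 U]) (simp_all add: F algebra_simps)
    qed
  next
    case False
    obtain c3 b3 where P3: "P = (c3, b3)" by (cases P)
    obtain c4 b4 where R4: "R = (c4, b4)" by (cases R)
    have c34: "c3 \<in> C" "c4 \<in> C" using PR P3 R4 by auto
    have Pc: "P = (c1, b1) \<or> P = (c1, \<not> b1) \<or> P = (c2, b2) \<or> (c3 \<noteq> c1 \<and> c3 \<noteq> c2)"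
      using P False unfolding P3 fst_conv by blast
    have Rc: "R = (c1, b1) \<or> R = (c2, b2) \<or> R = (c2, \<not> b2) \<or> (c4 \<noteq> c1 \<and> c4 \<noteq> c2)"
      using R False unfolding R4 fst_conv by blast
    consider (a) "P = (c1, b1)" | (b) "P = (c1, \<not> b1)" | (d) "P = (c2, b2)" | (e) "c3 \<noteq> c1" "c3 \<noteq> c2" using Pc by blast
    note cases_P = this
    consider (1) "R = (c1, b1)" | (2) "R = (c2, b2)" | (3) "R = (c2, \<not> b2)" | (4) "c4 \<noteq> c1" "c4 \<noteq> c2" using Rc by blast
    note cases_R = this
    show ?thesis
    proof (cases rule: cases_P)
      case a
      show ?thesis
      proof (cases rule: cases_R)
        case 1
        note Q1 = this
        show ?thesis by (rule double_edge_and_loop[OF C, of F b1 b2 U]) (simp add: F a Q1)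
      next
        case 2
        note Q2 = this
        show ?thesis by (rule ev, rule loops_at_both_ends[OF C, of U _ F b1 b2]) (simp_all add: F a Q2)
      next
        case 3
        note Q3 = this
        show ?thesis by (rule ev, rule loop_and_square[OF C, of U _ F b1 b2]) (simp_all add: F a Q3)
      next
        case 4
        note Q4 = this
        show ?thesis by (rule loop_and_leaf[OF C(1-3) c34(2), of F b1 b2 b4 U]) (use a Q4 C in \<open>simp_all add: F R4\<close>)
      qed
    next
      case b
      show ?thesis
      proof (cases rule: cases_R)
        case 1
        note Q1 = this
        show ?thesis by (rule ev, rule double_edge_and_square[OF C, of U _ F b1 b2]) (simp_all add: F b Q1)
      next
        case 2
        note Q2 = this
        show ?thesis by (rule ev, rule loop_and_square[OF C(1,3,2) C', of U _ F b2 b1]) (simp_all add: F b Q2 algebra_simps)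
      next
        case 3
        note Q3 = this
        show ?thesis by (rule ev, rule squares_at_both_ends[OF C, of U _ F b1 b2]) (simp_all add: F b Q3)
      next
        case 4
        note Q4 = this
        show ?thesis by (rule ev, rule square_and_leaf[OF C(1-3) c34(2), of U _ F b1 b2 b4]) (use b Q4 C in \<open>simp_all add: F R4\<close>)
      qed
    next
      case d
      show ?thesis
      proof (cases rule: cases_R)
        case 1
        note Q1 = this
        show ?thesis by (rule ev, rule crossed_three[OF C, of U _ F b1 b2]) (simp_all add: F d Q1)
      next
        case 2
        note Q2 = this
        show ?thesis by (rule double_edge_and_loop[OF C(1,3,2) C', of F b2 b1 U]) (simp add: F d Q2 algebra_simps)
      next
        case 3
        note Q3 = this
        show ?thesis by (rule ev, rule double_edge_and_square[OF C(1,3,2) C', of U _ F b2 b1]) (simp_all add: F d Q3 algebra_simps)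
      next
        case 4
        note Q4 = this
        show ?thesis by (rule double_edge_and_leaf[OF C(1,3,2) c34(2), of F b2 b1 b4 U]) (use d Q4 C in \<open>simp_all add: F R4 algebra_simps\<close>)
      qed
    next
      case e
      show ?thesis
      proof (cases rule: cases_R)
        case 1
        note Q1 = this
        show ?thesis by (rule double_edge_and_leaf[OF C(1-3) c34(1), of F b1 b2 b3 U]) (use e Q1 C in \<open>simp_all add: F P3\<close>)
      next
        case 2
        note Q2 = this
        show ?thesis by (rule loop_and_leaf[OF C(1,3,2) c34(1), of F b2 b1 b3 U]) (use e Q2 C in \<open>simp_all add: F P3 algebra_simps\<close>)
      next
        case 3
        note Q3 = this
        show ?thesis by (rule ev, rule square_and_leaf[OF C(1,3,2) c34(1), of U _ F b2 b1 b3]) (use e Q3 C in \<open>simp_all add: F P3 algebra_simps\<close>)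
      next
        case 4
        note Q4 = this
        consider "c3 \<noteq> c4" | "c4 = c3" "b4 = b3" | "c4 = c3" "b4 = (\<not> b3)" by blast
        then show ?thesis
        proof cases
          case 1
          show ?thesis by (rule two_leaves[OF C(1-3) c34, of F b1 b2 b3 b4 U]) (use 1 e Q4 C in \<open>simp_all add: F P3 R4\<close>)
        next
          case 2
          show ?thesis by (rule triangle_at_vertex[OF C(1-3) c34(1), of F b1 b2 b3 U]) (use 2 e Q4 C in \<open>simp_all add: F P3 R4\<close>)
        next
          case 3
          show ?thesis by (rule ev, rule full_triangle[OF C(1-3) c34(1), of U _ F b1 b2 b3]) (use 3 e Q4 C in \<open>simp_all add: F P3 R4\<close>)
        qed
      qed
    qed
  qed
qed

text \<open>An edge x1 * x2 between two classes touched at both vertices needs edges at y1 and at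
  y2. If these are different, the three edges are the whole graph. If they coincide, they form an
  opposite pair with the first one, and at most one further edge exists.\<close>

lemma small_configuration_avoidable:
  fixes v w :: "nat \<Rightarrow> 'c \<times> bool" and U :: "'c \<Rightarrow> bool \<Rightarrow> nat"
  assumes C: "finite C" and I: "finite I" "card I \<le> 3" and vw: "\<And>i. i \<in> I \<Longrightarrow> fst (v i) \<in> C \<and> fst (w i) \<in> C"
  shows "\<forall>\<^sub>F p in at_top. prime p \<longrightarrow> avoidable p (\<lambda>g. (\<Sum>i\<in>I. val g (v i) * val g (w i)) + linear_part C U g)"
proof (cases "\<exists>i\<in>I. fst (v i) \<noteq> fst (w i) \<and> (\<forall>b. touched I v w (fst (v i)) b) \<and> (\<forall>b. touched I v w (fst (w i)) b)")
  case False
  have "\<forall>\<^sub>F p in at_top. prime p \<longrightarrow> nearable p (1/8) (\<lambda>g. (\<Sum>i\<in>I. val g (v i) * val g (w i)) + linear_part C U g)"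
    by (rule independent_configuration[OF C I(1) vw]) (use False in \<open>simp_all, blast\<close>)
  then show ?thesis by (rule eventually_avoidable[OF C, where U = U])
next
  case True
  then obtain i where i: "i \<in> I" "fst (v i) \<noteq> fst (w i)" "\<And>b. touched I v w (fst (v i)) b" "\<And>b. touched I v w (fst (w i)) b"
    by blast
  obtain c1 b1 where vi: "v i = (c1, b1)" by (cases "v i")
  obtain c2 b2 where wi: "w i = (c2, b2)" by (cases "w i")
  have c: "c1 \<in> C" "c2 \<in> C" "c1 \<noteq> c2" using vw[OF i(1)] i(2) vi wi by auto
  have edge: "\<exists>P. fst P \<in> C \<and> (\<forall>g. val g (v j) * val g (w j) = g c' b' * val g P) \<and> (v j = (c', b') \<and> w j = P \<or> w j = (c', b') \<and> v j = P)"
    if "j \<in> I" "v j = (c', b') \<or> w j = (c', b')" for j c' b'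
    using that(2)
  proof
    assume "v j = (c', b')"
    then show ?thesis using vw[OF that(1)] by (intro exI[of _ "w j"]) simp
  next
    assume "w j = (c', b')"
    then show ?thesis using vw[OF that(1)] by (intro exI[of _ "v j"]) simp
  qed
  obtain j where j: "j \<in> I" "v j = (c1, \<not> b1) \<or> w j = (c1, \<not> b1)"
    using i(3)[of "\<not> b1"] vi unfolding touched_def by auto
  obtain k where k: "k \<in> I" "v k = (c2, \<not> b2) \<or> w k = (c2, \<not> b2)"
    using i(4)[of "\<not> b2"] wi unfolding touched_def by auto
  have ij: "i \<noteq> j" "i \<noteq> k" using j k vi wi c by auto
  obtain P where P: "fst P \<in> C" "\<And>g. val g (v j) * val g (w j) = g c1 (\<not> b1) * val g P"
      "v j = (c1, \<not> b1) \<and> w j = P \<or> w j = (c1, \<not> b1) \<and> v j = P"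
    using edge[OF j] by blast
  obtain R where R: "fst R \<in> C" "\<And>g. val g (v k) * val g (w k) = g c2 (\<not> b2) * val g R"
    using edge[OF k] by blast
  show ?thesis
  proof (cases "j = k")
    case False
    have "I = {i, j, k}"
      using card_seteq[of I "{i, j, k}"] I i(1) j(1) k(1) ij False by simp
    then have "(\<Sum>i\<in>I. val g (v i) * val g (w i)) = g c1 b1 * g c2 b2 + g c1 (\<not> b1) * val g P + g c2 (\<not> b2) * val g R" for g
      using ij False by (simp add: vi wi P(2) R(2))
    then show ?thesis by (intro edge_with_two_ends[OF C c P(1) R(1), of _ b1 b2 U]) simp
  next
    case True
    then have "P = (c2, \<not> b2)" using P(3) k(2) c by auto
    then have opp: "val g (v j) * val g (w j) = g c1 (\<not> b1) * g c2 (\<not> b2)" for g using P(2) by simp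
    show ?thesis
    proof (cases "I = {i, j}")
      case True
      then have S: "(\<Sum>i\<in>I. val g (v i) * val g (w i)) = g c1 b1 * g c2 b2 + g c1 (\<not> b1) * g c2 (\<not> b2)" for g
        using ij by (simp add: vi wi opp)
      show ?thesis
      proof (rule eventually_avoidableI[OF C, of U])
        fix p assume p: "large_for C U p"
        show "avoidable p (\<lambda>g. (\<Sum>i\<in>I. val g (v i) * val g (w i)) + linear_part C U g)"
          by (rule opposite_pair_fixed[OF C c p, of _ b1 b2 "\<lambda>_ _. 0" "- int (U c2 b2)" "- int (U c1 (\<not> b1))" 0]) (simp_all add: S algebra_simps)
      qed
    next
      case False
      then obtain m where m: "m \<in> I" "m \<noteq> i" "m \<noteq> j" using i(1) j(1) by blast
      have "I = {i, j, m}"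
        using card_seteq[of I "{i, j, m}"] I i(1) j(1) m ij by simp
      then have "(\<Sum>i\<in>I. val g (v i) * val g (w i)) = g c1 b1 * g c2 b2 + g c1 (\<not> b1) * g c2 (\<not> b2) + val g (v m) * val g (w m)" for g
        using ij m by (simp add: vi wi opp)
      then show ?thesis using vw[OF m(1)] by (intro opposite_pair_and_edge[OF C c, of "v m" "w m" _ b1 b2 U]) simp_all
    qed
  qed
qed

section \<open>Sieving by primes\<close>

definition smooth_sum :: "nat set \<Rightarrow> nat \<Rightarrow> real" where
  "smooth_sum S n = (\<Sum>m\<in>{m. 0 < m \<and> m \<le> n \<and> prime_factors m \<subseteq> S}. 1 / real m)"

text \<open>A number counted for \<open>insert p S\<close> is either free of \<open>p\<close> or
  \<open>p\<close> times a number counted there, so the sum is at most \<open>smooth_sum S n\<close>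
  plus \<open>1 / p\<close> times itself.\<close>

lemma smooth_sum_insert:
  assumes "prime p" "p \<notin> S"
  shows "smooth_sum (insert p S) n * (1 - 1 / p) \<le> smooth_sum S n"
proof -
  let ?A = "\<lambda>S. {m. 0 < m \<and> m \<le> n \<and> prime_factors m \<subseteq> S}"
  have fin: "finite (?A S)" for S by (rule finite_subset[of _ "{..n}"]) auto
  have sub: "?A (insert p S) \<subseteq> ?A S \<union> (\<lambda>m. p * m) ` ?A (insert p S)"
  proof
    fix m assume m: "m \<in> ?A (insert p S)"
    show "m \<in> ?A S \<union> (\<lambda>m. p * m) ` ?A (insert p S)"
    proof (cases "p dvd m")
      case True
      then obtain k where k: "m = p * k" by blast
      then have "k > 0" using m by auto
      moreover have "k \<le> m" using k mult_le_mono1[OF prime_ge_1_nat[OF assms(1)], of k] by simp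
      moreover have "prime_factors k \<subseteq> prime_factors m" using k m by (intro dvd_prime_factors) auto
      ultimately have "k \<in> ?A (insert p S)" using m by auto
      then show ?thesis using k by blast
    next
      case False
      then have "p \<notin> prime_factors m" by (auto simp: in_prime_factors_iff)
      then show ?thesis using m by auto
    qed
  qed
  have "smooth_sum (insert p S) n \<le> (\<Sum>m\<in>?A S \<union> (\<lambda>m. p * m) ` ?A (insert p S). 1 / real m)"
    unfolding smooth_sum_def using fin sub by (intro sum_mono2) auto
  also have "\<dots> \<le> smooth_sum S n + (\<Sum>m\<in>(\<lambda>m. p * m) ` ?A (insert p S). 1 / real m)"
  proof -
    have "(\<Sum>m\<in>?A S \<union> (\<lambda>m. p * m) ` ?A (insert p S). 1 / real m)
      = smooth_sum S n + (\<Sum>m\<in>(\<lambda>m. p * m) ` ?A (insert p S). 1 / real m) - (\<Sum>m\<in>?A S \<inter> (\<lambda>m. p * m) ` ?A (insert p S). 1 / real m)"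
      unfolding smooth_sum_def using fin by (intro sum_Un) auto
    moreover have "(\<Sum>m\<in>?A S \<inter> (\<lambda>m. p * m) ` ?A (insert p S). 1 / real m) \<ge> 0" by (intro sum_nonneg) auto
    ultimately show ?thesis by linarith
  qed
  also have "(\<Sum>m\<in>(\<lambda>m. p * m) ` ?A (insert p S). 1 / real m) = (\<Sum>m\<in>?A (insert p S). 1 / real (p * m))"
    using assms(1) by (subst sum.reindex) (auto simp: inj_on_def prime_gt_0_nat)
  also have "\<dots> = 1 / p * smooth_sum (insert p S) n"
    unfolding smooth_sum_def by (simp add: sum_distrib_left)
  finally show ?thesis by (simp add: algebra_simps)
qed

lemma smooth_sum_bound:
  assumes "finite S" "\<forall>p\<in>S. prime p"
  shows "smooth_sum S n * (\<Prod>p\<in>S. 1 - 1 / real p) \<le> 1"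
  using assms
proof (induction S rule: finite_induct)
  case empty
  have "{m. 0 < m \<and> m \<le> n \<and> prime_factors m \<subseteq> {}} \<subseteq> {1::nat}"
    using prime_factorization_empty_iff by (auto simp: prime_factorization_empty_iff)
  then have "smooth_sum {} n \<le> (\<Sum>m\<in>{1::nat}. 1 / real m)" unfolding smooth_sum_def by (intro sum_mono2) auto
  then show ?case by simp
next
  case (insert p S)
  have "smooth_sum (insert p S) n * (\<Prod>p\<in>insert p S. 1 - 1 / real p)
    = (smooth_sum (insert p S) n * (1 - 1 / p)) * (\<Prod>p\<in>S. 1 - 1 / real p)"
    using insert by simp
  also have "\<dots> \<le> smooth_sum S n * (\<Prod>p\<in>S. 1 - 1 / real p)"
    using insert smooth_sum_insert[of p S n]
    by (intro mult_right_mono prod_nonneg) (auto simp: prime_gt_0_nat Suc_le_eq)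
  also have "\<dots> \<le> 1" using insert by auto
  finally show ?case .
qed

text \<open>Euler's argument: every integer up to \<open>n\<close> is composed of primes up to
  \<open>n\<close>, so the product over these primes is at most the inverse of the harmonic number.
  Leaving out the primes up to \<open>B\<close> costs only the constant factor
  \<open>C\<close>.\<close>

lemma primes_sieve:
  fixes \<delta> :: real and B :: nat
  assumes "\<delta> > 0"
  shows "\<exists>P. finite P \<and> (\<forall>p\<in>P. prime p \<and> p > B) \<and> (\<Prod>p\<in>P. 1 - 1 / real p) < \<delta>"
proof -
  define C where "C = (\<Prod>p\<in>{p. prime p \<and> p \<le> B}. 1 - 1 / real p)"
  have finB: "finite {p. prime p \<and> p \<le> n}" for n :: nat by (rule finite_subset[of _ "{..n}"]) auto
  have pos: "1 - 1 / real p > 0" if "prime p" for p using prime_gt_1_nat[OF that] by simp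
  have C: "C > 0" unfolding C_def using pos by (intro prod_pos) auto
  \<comment> \<open>Large enough for \<open>ln (n + 1)\<close>, a lower bound of the harmonic
    number, to exceed \<open>1 / (C * \<delta>)\<close>.\<close>
  define n where "n = max B (nat \<lceil>exp (1 / (C * \<delta>))\<rceil>)"
  have "exp (1 / (C * \<delta>)) < real n + 1" unfolding n_def by linarith
  then have "1 / (C * \<delta>) < ln (real n + 1)" by (metis exp_gt_zero ln_exp ln_less_cancel_iff order_less_trans)
  also have "\<dots> \<le> harm n" using ln_le_harm[of n] by simp
  finally have n: "harm n > 1 / (C * \<delta>)" "n \<ge> B" by (simp_all add: n_def)
  define S where "S = {p. prime p \<and> p \<le> n}"
  define P where "P = {p. prime p \<and> p \<le> n \<and> p > B}"
  have S: "finite S" "\<forall>p\<in>S. prime p" using finB by (auto simp: S_def)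
  have "{m. 0 < m \<and> m \<le> n \<and> prime_factors m \<subseteq> S} = {1..n}"
  proof -
    have "prime_factors m \<subseteq> S" if "0 < m" "m \<le> n" for m
    proof
      fix q assume "q \<in> prime_factors m"
      then have "prime q" "q dvd m" by (simp_all add: in_prime_factors_iff)
      then show "q \<in> S" using dvd_imp_le[of q m] that by (simp add: S_def)
    qed
    then have "{m. 0 < m \<and> m \<le> n \<and> prime_factors m \<subseteq> S} = {m. 0 < m \<and> m \<le> n}" by blast
    also have "{m. 0 < m \<and> m \<le> n} = {1..n}" by auto
    finally show ?thesis .
  qed
  then have "smooth_sum S n = harm n" by (simp add: smooth_sum_def harm_def inverse_eq_divide)
  then have "harm n * (\<Prod>p\<in>S. 1 - 1 / real p) \<le> 1" using smooth_sum_bound[OF S, of n] by simp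
  moreover have "S = {p. prime p \<and> p \<le> B} \<union> P" using n(2) by (auto simp: S_def P_def)
  then have "(\<Prod>p\<in>S. 1 - 1 / real p) = C * (\<Prod>p\<in>P. 1 - 1 / real p)"
    unfolding C_def using finB by (simp add: P_def prod.union_disjoint disjoint_iff)
  ultimately have *: "harm n * (C * (\<Prod>p\<in>P. 1 - 1 / real p)) \<le> 1" by simp
  have Ppos: "(\<Prod>p\<in>P. 1 - 1 / real p) > 0" using pos unfolding P_def by (intro prod_pos) blast
  have "(\<Prod>p\<in>P. 1 - 1 / real p) < \<delta>"
  proof (rule ccontr)
    assume "\<not> ?thesis"
    then have "C * \<delta> \<le> C * (\<Prod>p\<in>P. 1 - 1 / real p)" using C by simp
    moreover have "0 < C * \<delta>" using C assms by simp
    have "0 \<le> (harm n :: real)" by (rule harm_nonneg)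
    ultimately have "harm n * (C * \<delta>) \<le> harm n * (C * (\<Prod>p\<in>P. 1 - 1 / real p))" by (rule mult_left_mono)
    then have "harm n * (C * \<delta>) \<le> 1" using * by linarith
    moreover have "1 < harm n * (C * \<delta>)" using n(1) \<open>0 < C * \<delta>\<close> by (simp only: pos_divide_less_eq)
    ultimately show False by linarith
  qed
  then show ?thesis using finB[of n] by (intro exI[of _ P]) (auto simp: P_def intro: finite_subset)
qed

text \<open>Disjointness allows every prime to serve a single index. It is achieved by choosing each
  new set beyond the sum of all primes chosen so far.\<close>

lemma disjoint_prime_sieves:
  fixes \<delta> :: real and b :: "'w \<Rightarrow> nat"
  assumes "\<delta> > 0" "finite W"
  shows "\<exists>P. (\<forall>w\<in>W. finite (P w) \<and> (\<forall>p\<in>P w. prime p \<and> p > b w) \<and> (\<Prod>p\<in>P w. 1 - 1 / real p) < \<delta>) \<and>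
    (\<forall>w\<in>W. \<forall>w'\<in>W. w \<noteq> w' \<longrightarrow> P w \<inter> P w' = {})"
  using assms(2)
proof (induction W rule: finite_induct)
  case (insert w W)
  obtain P where P: "\<forall>w\<in>W. finite (P w) \<and> (\<forall>p\<in>P w. prime p \<and> p > b w) \<and> (\<Prod>p\<in>P w. 1 - 1 / real p) < \<delta>"
      "\<forall>w\<in>W. \<forall>w'\<in>W. w \<noteq> w' \<longrightarrow> P w \<inter> P w' = {}" using insert.IH by (elim exE conjE) (rule that)
  have fin: "finite (\<Union>w\<in>W. P w)" using P(1) insert.hyps(1) by blast
  define B where "B = max (b w) (\<Sum>(\<Union>w\<in>W. P w))"
  obtain R where R: "finite R" "\<forall>p\<in>R. prime p \<and> p > B" "(\<Prod>p\<in>R. 1 - 1 / real p) < \<delta>" using primes_sieve[OF assms(1)] by blast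
  have le: "p \<le> B" if "p \<in> (\<Union>w\<in>W. P w)" for p
    unfolding B_def using member_le_sum[of p "\<Union>w\<in>W. P w" "\<lambda>x. x"] that fin by auto
  have disj: "R \<inter> P w' = {}" if w': "w' \<in> W" for w'
  proof -
    have "p \<notin> P w'" if p: "p \<in> R" for p
    proof
      assume "p \<in> P w'"
      then have "p \<le> B" using le w' by blast
      then show False using R(2)[rule_format, OF p] by simp
    qed
    then show ?thesis by blast
  qed
  have Rb: "\<forall>p\<in>R. prime p \<and> p > b w" using R(2) by (simp add: B_def)
  show ?case
  proof (intro exI[of _ "P(w := R)"] conjI ballI impI)
    fix v v' assume v: "v \<in> insert w W" "v' \<in> insert w W" "v \<noteq> v'"
    consider "v = w" "v' \<in> W" "v' \<noteq> w" | "v' = w" "v \<in> W" "v \<noteq> w" | "v \<in> W" "v' \<in> W" "v \<noteq> w" "v' \<noteq> w" using v by blast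
    then show "(P(w := R)) v \<inter> (P(w := R)) v' = {}"
    proof cases
      case 1 then show ?thesis using disj[of v'] by simp
    next
      case 2 then show ?thesis using disj[of v] by (simp add: Int_commute)
    next
      case 3 then show ?thesis using P(2)[rule_format, OF 3(1,2) v(3)] by simp
    qed
  next
    fix v assume v: "v \<in> insert w W"
    show "finite ((P(w := R)) v)" using v P(1) R(1) by (cases "v = w") simp_all
    show "(\<Prod>p\<in>(P(w := R)) v. 1 - 1 / real p) < \<delta>" using v P(1) R(3) by (cases "v = w") simp_all
    fix p assume p: "p \<in> (P(w := R)) v"
    show "prime p" "p > b v" using v p P(1) Rb by (cases "v = w"; simp)+
  qed
qed auto

section \<open>Counting residues modulo products\<close>

lemma mod_residue_decomposition:
  fixes a b :: int
  assumes "a > 0" "b > 0"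
  shows "bij_betw (\<lambda>(r, s). r + a * s) ({0..<a} \<times> {0..<b}) {0..<a * b}"
proof (rule bij_betw_byWitness[where f' = "\<lambda>t. (t mod a, t div a)"])
  show "(\<lambda>(r, s). r + a * s) ` ({0..<a} \<times> {0..<b}) \<subseteq> {0..<a * b}"
  proof (rule image_subsetI)
    fix x assume "x \<in> {0..<a} \<times> {0..<b}"
    then obtain r s where x: "x = (r, s)" "0 \<le> r" "r < a" "0 \<le> s" "s < b" by auto
    then have "a * (s + 1) \<le> a * b" using assms by (intro mult_left_mono) auto
    then show "(case x of (r, s) \<Rightarrow> r + a * s) \<in> {0..<a * b}" using x assms by (simp add: distrib_left)
  qed
  show "(\<lambda>t. (t mod a, t div a)) ` {0..<a * b} \<subseteq> {0..<a} \<times> {0..<b}"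
  proof (rule image_subsetI)
    fix t assume t: "t \<in> {0..<a * b}"
    have "t div a < b"
    proof (rule ccontr)
      assume "\<not> ?thesis"
      then have "a * b \<le> a * (t div a)" using assms by (intro mult_left_mono) auto
      moreover have "a * (t div a) + t mod a = t" by simp
      moreover have "t mod a \<ge> 0" using assms by simp
      moreover have "t < a * b" using t by simp
      ultimately show False by linarith
    qed
    then show "(t mod a, t div a) \<in> {0..<a} \<times> {0..<b}" using t assms by (simp add: pos_imp_zdiv_nonneg_iff)
  qed
qed (use assms in auto)

lemma card_mod_preimage:
  fixes a b :: int
  assumes "a > 0" "b > 0" "R \<subseteq> {0..<a}"
  shows "card {t \<in> {0..<a * b}. t mod a \<in> R} = nat b * card R"
proof -
  have im: "(\<lambda>(r, s). r + a * s) ` ({0..<a} \<times> {0..<b}) = {0..<a * b}"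
    using mod_residue_decomposition[OF assms(1,2)] by (simp add: bij_betw_def)
  have md: "(r + a * s) mod a = r" if "r \<in> {0..<a}" for r s using that by simp
  have "{t \<in> {0..<a * b}. t mod a \<in> R} = (\<lambda>(r, s). r + a * s) ` (R \<times> {0..<b})"
  proof (rule subset_antisym; rule subsetI)
    fix t assume t: "t \<in> {t \<in> {0..<a * b}. t mod a \<in> R}"
    then have "t \<in> (\<lambda>(r, s). r + a * s) ` ({0..<a} \<times> {0..<b})" unfolding im by simp
    then obtain r s where rs: "r \<in> {0..<a}" "s \<in> {0..<b}" "t = r + a * s" by (elim imageE SigmaE) (rule that, assumption, assumption, simp)
    then have "r \<in> R" using t md[OF rs(1)] by simp
    then show "t \<in> (\<lambda>(r, s). r + a * s) ` (R \<times> {0..<b})" using rs by (intro image_eqI[of _ _ "(r, s)"]) simp_all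
  next
    fix t assume "t \<in> (\<lambda>(r, s). r + a * s) ` (R \<times> {0..<b})"
    then obtain r s where rs: "r \<in> R" "s \<in> {0..<b}" "t = r + a * s" by (elim imageE SigmaE) (rule that, assumption, assumption, simp)
    have r: "r \<in> {0..<a}" using rs(1) assms(3) by blast
    have "t \<in> (\<lambda>(r, s). r + a * s) ` ({0..<a} \<times> {0..<b})" using rs r by (intro image_eqI[of _ _ "(r, s)"]) simp_all
    then have "t \<in> {0..<a * b}" unfolding im .
    then show "t \<in> {t \<in> {0..<a * b}. t mod a \<in> R}" using rs md[OF r] by simp
  qed
  moreover have "inj_on (\<lambda>(r, s). r + a * s) (R \<times> {0..<b})"
    by (rule inj_on_subset[OF bij_betw_imp_inj_on[OF mod_residue_decomposition[OF assms(1,2)]]]) (use assms(3) in blast)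
  ultimately have "card {t \<in> {0..<a * b}. t mod a \<in> R} = card (R \<times> {0..<b})" by (simp add: card_image)
  then show ?thesis by (simp add: card_cartesian_product)
qed

lemma card_crt_le:
  fixes a b :: int
  assumes "a > 0" "b > 0" "coprime a b" "R \<subseteq> {0..<a}" "T \<subseteq> {0..<b}"
  shows "card {t \<in> {0..<a * b}. t mod a \<in> R \<and> t mod b \<in> T} \<le> card R * card T"
proof -
  have "inj_on (\<lambda>t. (t mod a, t mod b)) {t \<in> {0..<a * b}. t mod a \<in> R \<and> t mod b \<in> T}"
  proof (rule inj_onI, clarsimp)
    fix s t :: int assume st: "0 \<le> s" "s < a * b" "0 \<le> t" "t < a * b" "s mod a = t mod a" "s mod b = t mod b"
    have "[s = t] (mod a)" using st(5) by (simp only: unique_euclidean_semiring_class.cong_def)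
    moreover have "[s = t] (mod b)" using st(6) by (simp only: unique_euclidean_semiring_class.cong_def)
    ultimately have "[s = t] (mod a * b)" using assms(3) by (rule coprime_cong_mult)
    then have "s mod (a * b) = t mod (a * b)" by (simp only: unique_euclidean_semiring_class.cong_def)
    then show "s = t" using st by simp
  qed
  moreover have "(\<lambda>t. (t mod a, t mod b)) ` {t \<in> {0..<a * b}. t mod a \<in> R \<and> t mod b \<in> T} \<subseteq> R \<times> T" by auto
  moreover have "finite (R \<times> T)" using assms finite_subset by blast
  ultimately have "card {t \<in> {0..<a * b}. t mod a \<in> R \<and> t mod b \<in> T} \<le> card (R \<times> T)" by (rule card_inj_on_le)
  then show ?thesis by (simp add: card_cartesian_product)
qed

text \<open>By the Chinese remainder theorem a residue is determined by its reductions modulo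
  \<open>p\<close> and modulo the product of the others, and each prime forbids one of its
  \<open>p\<close> classes.\<close>

lemma card_avoiding:
  fixes s :: "nat \<Rightarrow> int"
  assumes "finite P" "\<forall>p\<in>P. prime p"
  shows "real (card {t \<in> {0..<int (\<Prod>P)}. \<forall>p\<in>P. \<not> [t = s p] (mod int p)}) \<le> real (\<Prod>P) * (\<Prod>p\<in>P. 1 - 1 / real p)"
  using assms
proof (induction P rule: finite_induct)
  case empty
  have "{t \<in> {0..<int (\<Prod>{})}. \<forall>p\<in>{}. \<not> [t = s p] (mod int p)} \<subseteq> {0}" by auto
  then have "card {t \<in> {0..<int (\<Prod>{})}. \<forall>p\<in>{}. \<not> [t = s p] (mod int p)} \<le> card {0::int}" by (intro card_mono) simp_all
  then show ?case by simp
next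
  case (insert p P)
  let ?A = "\<lambda>P. {t \<in> {0..<int (\<Prod>P)}. \<forall>p\<in>P. \<not> [t = s p] (mod int p)}"
  have p: "prime p" "p > 1" using insert prime_gt_1_nat by auto
  have pos: "int (\<Prod>P) > 0" using insert by (auto simp: prime_gt_0_nat intro!: prod_pos)
  have cop: "coprime (int p) (int (\<Prod>P))"
    using insert by (auto simp del: of_nat_prod intro!: prod_coprime_right primes_coprime)
  let ?T = "{t \<in> {0..<int p}. \<not> [t = s p] (mod int p)}"
  have "?T \<subseteq> {0..<int p} - {s p mod int p}" by (auto simp: cong_def)
  then have "card ?T \<le> card ({0..<int p} - {s p mod int p})" by (intro card_mono) auto
  also have "\<dots> = p - 1" using p by (subst card_Diff_singleton) auto
  finally have cT: "card ?T \<le> p - 1" .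
  have "?A (insert p P) \<subseteq> {t \<in> {0..<int p * int (\<Prod>P)}. t mod int p \<in> ?T \<and> t mod int (\<Prod>P) \<in> ?A P}"
  proof
    fix t assume t: "t \<in> ?A (insert p P)"
    have "[t mod int (\<Prod>P) = t] (mod int r)" if "r \<in> P" for r
      using that insert(1) by (metis cong_dvd_modulus cong_mod_left cong_refl dvd_prod_eqI of_nat_dvd_iff id_apply)
    then have "\<not> [t mod int (\<Prod>P) = s r] (mod int r)" if "r \<in> P" for r
      using that t cong_trans cong_sym by blast
    then show "t \<in> {t \<in> {0..<int p * int (\<Prod>P)}. t mod int p \<in> ?T \<and> t mod int (\<Prod>P) \<in> ?A P}"
      using t pos p insert by (auto simp: cong_def)
  qed
  then have "card (?A (insert p P)) \<le> card {t \<in> {0..<int p * int (\<Prod>P)}. t mod int p \<in> ?T \<and> t mod int (\<Prod>P) \<in> ?A P}"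
    by (rule card_mono[OF finite_subset[OF _ finite_atLeastLessThan_int[of 0 "int p * int (\<Prod>P)"]], rotated]) blast
  also have "\<dots> \<le> card ?T * card (?A P)" using p pos cop by (intro card_crt_le) auto
  also have "\<dots> \<le> (p - 1) * card (?A P)" using cT by simp
  finally have "real (card (?A (insert p P))) \<le> real ((p - 1) * card (?A P))" by (rule of_nat_mono)
  also have "\<dots> = real (p - 1) * real (card (?A P))" by simp
  also have "\<dots> \<le> real (p - 1) * (real (\<Prod>P) * (\<Prod>p\<in>P. 1 - 1 / real p))"
    using insert by (intro mult_left_mono) auto
  also have "\<dots> = real (\<Prod>(insert p P)) * (\<Prod>p\<in>insert p P. 1 - 1 / real p)"
    using insert p by (simp add: field_simps of_nat_diff)
  finally show ?case .
qed

section \<open>Blocks of primes\<close>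

lemma dvd_prod_set:
  fixes P :: "nat set"
  assumes "finite P" "p \<in> P"
  shows "p dvd \<Prod>P" "int p dvd int (\<Prod>P)"
proof -
  show "p dvd \<Prod>P" using dvd_prodI[OF assms, of "\<lambda>x. x"] by simp
  then show "int p dvd int (\<Prod>P)" by (simp only: of_nat_dvd_iff)
qed

text \<open>One function carries all slots, the linear ones placed behind the factors, so that a
  single assignment of classes to slots describes a filling.\<close>

definition form :: "nat \<Rightarrow> nat \<Rightarrow> (nat \<Rightarrow> int) \<Rightarrow> int" where
  "form l k y = (\<Sum>i\<in>{1..l}. y (2 * i - 1) * y (2 * i)) + (\<Sum>j\<in>{1..k}. y (2 * l + j))"

lemma form_eq:
  assumes "\<And>i. i \<in> {1..2 * l + k} \<Longrightarrow> y i = z i"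
  shows "form l k y = form l k z"
proof -
  have "(\<Sum>i\<in>{1..l}. y (2 * i - 1) * y (2 * i)) = (\<Sum>i\<in>{1..l}. z (2 * i - 1) * z (2 * i))"
  proof (rule sum.cong[OF refl])
    fix i assume "i \<in> {1..l}"
    then have "2 * i - 1 \<in> {1..2 * l + k}" "2 * i \<in> {1..2 * l + k}" by auto
    then show "y (2 * i - 1) * y (2 * i) = z (2 * i - 1) * z (2 * i)" by (simp only: assms)
  qed
  moreover have "(\<Sum>j\<in>{1..k}. y (2 * l + j)) = (\<Sum>j\<in>{1..k}. z (2 * l + j))"
    by (rule sum.cong[OF refl]) (simp add: assms)
  ultimately show ?thesis by (simp add: form_def)
qed

lemma form_cong:
  assumes "\<And>i. i \<in> {1..2 * l + k} \<Longrightarrow> [y i = z i] (mod m)"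
  shows "[form l k y = form l k z] (mod m)"
proof -
  have "[(\<Sum>i\<in>{1..l}. y (2 * i - 1) * y (2 * i)) = (\<Sum>i\<in>{1..l}. z (2 * i - 1) * z (2 * i))] (mod m)"
  proof (rule cong_sum)
    fix i assume "i \<in> {1..l}"
    then have "2 * i - 1 \<in> {1..2 * l + k}" "2 * i \<in> {1..2 * l + k}" by auto
    then show "[y (2 * i - 1) * y (2 * i) = z (2 * i - 1) * z (2 * i)] (mod m)" by (intro cong_mult assms)
  qed
  moreover have "[(\<Sum>j\<in>{1..k}. y (2 * l + j)) = (\<Sum>j\<in>{1..k}. z (2 * l + j))] (mod m)"
    by (rule cong_sum) (rule assms, simp)
  ultimately show ?thesis unfolding form_def by (rule cong_add)
qed

text \<open>The products become the edges of the graph, and the linear slots are collected into the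
  multiplicities \<open>U\<close>.\<close>

lemma form_configuration:
  fixes x :: "nat \<Rightarrow> 'c \<times> bool"
  assumes "l \<le> 3"
  shows "\<forall>\<^sub>F p in at_top. prime p \<longrightarrow> avoidable p (\<lambda>g. form l k (\<lambda>i. val g (x i)))"
proof -
  define C where "C = (\<lambda>i. fst (x i)) ` {1..2 * l + k}"
  define U where "U c b = card {j \<in> {1..k}. x (2 * l + j) = (c, b)}" for c b
  have U: "int (U c b) = (\<Sum>j\<in>{1..k}. of_bool (x (2 * l + j) = (c, b)))" for c b
    unfolding U_def by (simp add: sum.If_cases of_bool_def Int_def)
  have "linear_part C U g = (\<Sum>j\<in>{1..k}. val g (x (2 * l + j)))" for g
  proof -
    have "linear_part C U g = (\<Sum>c\<in>C. \<Sum>j\<in>{1..k}. of_bool (x (2 * l + j) = (c, True)) * g c True + of_bool (x (2 * l + j) = (c, False)) * g c False)"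
      unfolding linear_part_def U by (simp add: sum.distrib sum_distrib_right)
    also have "\<dots> = (\<Sum>j\<in>{1..k}. \<Sum>c\<in>C. of_bool (x (2 * l + j) = (c, True)) * g c True + of_bool (x (2 * l + j) = (c, False)) * g c False)"
      by (rule sum.swap)
    also have "\<dots> = (\<Sum>j\<in>{1..k}. val g (x (2 * l + j)))"
    proof (rule sum.cong[OF refl])
      fix j assume j: "j \<in> {1..k}"
      obtain c b where cb: "x (2 * l + j) = (c, b)" by (cases "x (2 * l + j)")
      have "2 * l + j \<in> {1..2 * l + k}" using j by simp
      then have "fst (x (2 * l + j)) \<in> C" unfolding C_def by (rule imageI)
      then have "c \<in> C" using cb by simp
      then have "(\<Sum>c\<in>C. of_bool (x (2 * l + j) = (c, True)) * g c True + of_bool (x (2 * l + j) = (c, False)) * g c False)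
        = of_bool (x (2 * l + j) = (c, True)) * g c True + of_bool (x (2 * l + j) = (c, False)) * g c False"
        by (intro sum_single) (auto simp: C_def cb)
      then show "(\<Sum>c\<in>C. of_bool (x (2 * l + j) = (c, True)) * g c True + of_bool (x (2 * l + j) = (c, False)) * g c False) = val g (x (2 * l + j))"
        by (cases b) (simp_all add: cb)
    qed
    finally show ?thesis .
  qed
  then have "form l k (\<lambda>i. val g (x i)) = (\<Sum>i\<in>{1..l}. val g (x (2 * i - 1)) * val g (x (2 * i))) + linear_part C U g" for g
    by (simp add: form_def)
  moreover have "\<forall>\<^sub>F p in at_top. prime p \<longrightarrow> avoidable p (\<lambda>g. (\<Sum>i\<in>{1..l}. val g (x (2 * i - 1)) * val g (x (2 * i))) + linear_part C U g)"
  proof (rule small_configuration_avoidable)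
    show "fst (x (2 * i - 1)) \<in> C \<and> fst (x (2 * i)) \<in> C" if "i \<in> {1..l}" for i
      unfolding C_def using that by (intro conjI imageI) auto
  qed (use assms in \<open>auto simp: C_def\<close>)
  ultimately show ?thesis by simp
qed

text \<open>\<open>X d p True\<close> and \<open>X d p False\<close> are the residues modulo \<open>p\<close> of the pair of elements with difference \<open>d\<close>.
  After \<open>J\<close> blocks every value of the form is in \<open>Bad\<close> unless its differences occupy more than \<open>J\<close> classes.\<close>

definition block_system :: "nat \<Rightarrow> nat \<Rightarrow> nat \<Rightarrow> real \<Rightarrow> nat \<Rightarrow> nat set \<Rightarrow> (int \<Rightarrow> nat \<Rightarrow> bool \<Rightarrow> int) \<Rightarrow> int set \<Rightarrow> bool" where
  "block_system l k M \<delta> J P X Bad \<longleftrightarrow>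
    finite P \<and> P \<noteq> {} \<and> (\<forall>p\<in>P. prime p \<and> p > M) \<and>
    (\<forall>d. \<forall>p\<in>P. [X d p True - X d p False = d] (mod int p)) \<and>
    (\<forall>d d'. d mod int (\<Prod>P) = d' mod int (\<Prod>P) \<longrightarrow> (\<forall>p\<in>P. X d p = X d' p)) \<and>
    Bad \<subseteq> {0..<int (\<Prod>P)} \<and> real (card Bad) \<le> real J * \<delta> * real (\<Prod>P) \<and>
    (\<forall>d r t. (\<forall>p\<in>P. [t = form l k (\<lambda>i. X (d i) p (r i))] (mod int p)) \<longrightarrow>
       t mod int (\<Prod>P) \<in> Bad \<or> J < card ((\<lambda>i. d i mod int (\<Prod>P)) ` {1..2 * l + k}))"

text \<open>Any single prime works: there is at least one slot, hence at least one class, so for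
  \<open>J = 0\<close> the second alternative always holds and nothing is bad.\<close>

lemma block_system_base:
  assumes "l > 0"
  shows "\<exists>P X. block_system l k M \<delta> 0 P X {}"
proof -
  obtain p :: nat where p: "prime p" "p > M" using bigger_prime by blast
  have ne: "0 < card (A ` {1..2 * l + k})" for A :: "nat \<Rightarrow> int" using assms by (simp add: card_gt_0_iff)
  show ?thesis
    unfolding block_system_def
    by (intro exI[of _ "{p}"] exI[of _ "\<lambda>d p b. if b then d mod int p else 0"]) (use p ne in auto)
qed

text \<open>A tuple outside the old \<open>Bad\<close> has more than \<open>J\<close> classes modulo
  the old product. If it has no more than \<open>Suc J\<close> modulo the new one, no class has
  split, so slots with congruent differences receive identical pairs, which is the situation of
  \<open>avoidable\<close>. Every new prime reserved for its filling then excludes one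
  residue.\<close>

lemma block_system_step:
  assumes "l \<le> 3" "\<delta> > 0" and sys: "block_system l k M \<delta> J P X Bad"
  shows "\<exists>P' X' Bad'. block_system l k M \<delta> (Suc J) P' X' Bad'"
proof -
  define q where "q = int (\<Prod>P)"
  have P: "finite P" "P \<noteq> {}" "\<And>p. p \<in> P \<Longrightarrow> prime p" "\<And>p. p \<in> P \<Longrightarrow> p > M"
    and XP: "\<And>d p. p \<in> P \<Longrightarrow> [X d p True - X d p False = d] (mod int p)"
    and Xq: "\<And>d d' p. d mod q = d' mod q \<Longrightarrow> p \<in> P \<Longrightarrow> X d p = X d' p"
    and Bad: "Bad \<subseteq> {0..<q}" "real (card Bad) \<le> real J * \<delta> * real (\<Prod>P)"
    and main: "\<And>d r t. (\<And>p. p \<in> P \<Longrightarrow> [t = form l k (\<lambda>i. X (d i) p (r i))] (mod int p)) \<Longrightarrow>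
       t mod q \<in> Bad \<or> J < card ((\<lambda>i. d i mod q) ` {1..2 * l + k})"
    using sys unfolding block_system_def q_def by blast+
  have q0: "q > 0" unfolding q_def using P prime_gt_0_nat by (auto intro!: prod_pos)
  \<comment> \<open>A filling assigns to each slot a class modulo \<open>q\<close> and one of the
    two vertices of that class.\<close>
  define W where "W = PiE {1..2 * l + k} (\<lambda>_. {0..<q} \<times> (UNIV :: bool set))"
  have finW: "finite W" unfolding W_def by (intro finite_PiE) auto
  have "W \<noteq> {}" unfolding W_def using q0 by (subst PiE_eq_empty_iff) auto
  then have cW: "card W > 0" using finW by (simp add: card_gt_0_iff)
  have "\<forall>w::nat \<Rightarrow> int \<times> bool. \<exists>N. \<forall>p\<ge>N. prime p \<longrightarrow> avoidable p (\<lambda>g. form l k (\<lambda>i. val g (w i)))"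
    using form_configuration[OF assms(1), of k] unfolding eventually_at_top_linorder by blast
  from choice[OF this] obtain N :: "(nat \<Rightarrow> int \<times> bool) \<Rightarrow> int"
    where N: "\<forall>w. \<forall>p\<ge>N w. prime p \<longrightarrow> avoidable p (\<lambda>g. form l k (\<lambda>i. val g (w i)))" by (elim exE)
  \<comment> \<open>Primes beyond \<open>\<Sum>P\<close> are not in \<open>P\<close>, and beyond
    \<open>N w\<close> the strategies for the filling \<open>w\<close> exist.\<close>
  define b where "b w = max (max M (\<Sum>P)) (nat (N w))" for w
  have "\<delta> / real (card W) > 0" using assms(2) cW by simp
  from disjoint_prime_sieves[OF this finW, of b] obtain R where
      R1: "\<forall>w\<in>W. finite (R w) \<and> (\<forall>p\<in>R w. prime p \<and> p > b w) \<and> (\<Prod>p\<in>R w. 1 - 1 / real p) < \<delta> / real (card W)"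
      and R2: "\<forall>w\<in>W. \<forall>w'\<in>W. w \<noteq> w' \<longrightarrow> R w \<inter> R w' = {}"
    by (elim exE conjE)
  have R: "finite (R w)" "p \<in> R w \<Longrightarrow> prime p \<and> p > b w" "(\<Prod>p\<in>R w. 1 - 1 / real p) < \<delta> / real (card W)"
      "w' \<in> W \<Longrightarrow> w \<noteq> w' \<Longrightarrow> R w \<inter> R w' = {}" if "w \<in> W" for w w' p
    using R1 R2 that by blast+
  define Q where "Q = (\<Union>w\<in>W. R w)"
  have finQ: "finite Q" unfolding Q_def using finW R(1) by blast
  have PQ: "P \<inter> Q = {}"
  proof -
    have False if p: "p \<in> P" "p \<in> Q" for p
    proof -
      obtain w where "w \<in> W" "p \<in> R w" using p by (auto simp: Q_def)
      then have "p > \<Sum>P" using R(2)[of w p] by (simp add: b_def)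
      then show False using member_le_sum[of p P "\<lambda>x. x"] p P(1) by simp
    qed
    then show ?thesis by blast
  qed
  define own where "own p = (SOME w. w \<in> W \<and> p \<in> R w)" for p
  have own: "own p = w" if "w \<in> W" "p \<in> R w" for w p
  proof -
    have "own p \<in> W \<and> p \<in> R (own p)" unfolding own_def by (rule someI[of _ w]) (use that in blast)
    then show ?thesis using R(4)[of "own p" w] that by blast
  qed
  have ex: "\<exists>S s. p \<in> Q \<longrightarrow> (\<forall>c. cover (int p) (S c)) \<and> (\<forall>g. (\<forall>c. g c \<in> S c) \<longrightarrow> \<not> [form l k (\<lambda>i. val g (own p i)) = s] (mod int p))" for p
  proof (cases "p \<in> Q")
    case True
    then obtain w where w: "w \<in> W" "p \<in> R w" by (auto simp: Q_def)
    have "prime p" "p > nat (N w)" using R(2)[OF w] by (auto simp: b_def)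
    then have "avoidable (int p) (\<lambda>g. form l k (\<lambda>i. val g (own p i)))"
      using N[rule_format, of w "int p"] own[OF w] by simp
    then show ?thesis unfolding avoidable_def by blast
  qed auto
  have "\<forall>p. \<exists>S s. p \<in> Q \<longrightarrow> (\<forall>c. cover (int p) (S c)) \<and>
      (\<forall>g. (\<forall>c. g c \<in> S c) \<longrightarrow> \<not> [form l k (\<lambda>i. val g (own p i)) = s] (mod int p))"
    by (rule allI) (rule ex)
  from choice[OF this] obtain S where "\<forall>p. \<exists>s. p \<in> Q \<longrightarrow> (\<forall>c. cover (int p) (S p c)) \<and>
      (\<forall>g. (\<forall>c. g c \<in> S p c) \<longrightarrow> \<not> [form l k (\<lambda>i. val g (own p i)) = s] (mod int p))" by (elim exE)
  from choice[OF this] obtain s where Ss: "\<forall>p. p \<in> Q \<longrightarrow> (\<forall>c. cover (int p) (S p c)) \<and>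
      (\<forall>g. (\<forall>c. g c \<in> S p c) \<longrightarrow> \<not> [form l k (\<lambda>i. val g (own p i)) = s p] (mod int p))" by (elim exE)
  have S: "cover (int p) (S p c)" if "p \<in> Q" for p c using Ss that by blast
  have s: "\<not> [form l k (\<lambda>i. val g (own p i)) = s p] (mod int p)" if "p \<in> Q" "\<And>c. g c \<in> S p c" for p g
    using Ss that by blast
  \<comment> \<open>The class \<open>d mod q\<close> selects the set of functions and
    \<open>d mod int p\<close> the member, so the pair depends on \<open>d\<close> only modulo the
    new product.\<close>
  define f where "f d p = (SOME f. f \<in> S p (d mod q) \<and> [f True - f False = d mod int p] (mod int p))" for d p
  have f: "f d p \<in> S p (d mod q)" "[f d p True - f d p False = d mod int p] (mod int p)" if "p \<in> Q" for d p
  proof -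
    have "\<exists>f. f \<in> S p (d mod q) \<and> [f True - f False = d mod int p] (mod int p)"
      using S[OF that, of "d mod q"] unfolding cover_def by blast
    then have "f d p \<in> S p (d mod q) \<and> [f d p True - f d p False = d mod int p] (mod int p)"
      unfolding f_def by (rule someI_ex)
    then show "f d p \<in> S p (d mod q)" "[f d p True - f d p False = d mod int p] (mod int p)" by blast+
  qed
  define X' where "X' d p = (if p \<in> P then X d p else f d p)" for d p
  define q' where "q' = int (\<Prod>(P \<union> Q))"
  have q'_eq: "q' = q * int (\<Prod>Q)" unfolding q'_def q_def using P(1) finQ PQ by (simp add: prod.union_disjoint)
  have primeQ: "prime p" "p > M" if pQ: "p \<in> Q" for p
  proof -
    obtain w where "w \<in> W" "p \<in> R w" using pQ by (auto simp: Q_def)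
    then show "prime p" "p > M" using R(2)[of w p] by (auto simp: b_def)
  qed
  have Qpos: "int (\<Prod>Q) > 0" using primeQ(1) prime_gt_0_nat by (auto intro!: prod_pos)
  have q'0: "q' > 0" using q0 Qpos by (simp add: q'_eq)
  have dvd_q': "int p dvd q'" if "p \<in> P \<union> Q" for p
    unfolding q'_def using that P(1) finQ by (intro dvd_prod_set) auto
  have modq: "t mod q' mod q = t mod q" for t by (simp add: q'_eq mod_mod_cancel)
  define Z where "Z w = {t \<in> {0..<q'}. \<forall>p\<in>R w. \<not> [t = s p] (mod int p)}" for w
  \<comment> \<open>Lifting the old set keeps its density, and each of the \<open>card W\<close>
    sets \<open>Z w\<close> has density at most \<open>\<delta> / card W\<close>, so the bound grows
    by \<open>\<delta>\<close>.\<close>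
  define Bad' where "Bad' = {t \<in> {0..<q'}. t mod q \<in> Bad} \<union> (\<Union>w\<in>W. Z w)"
  have cardZ: "real (card (Z w)) \<le> \<delta> / real (card W) * q'" if w: "w \<in> W" for w
  proof -
    define a where "a = int (\<Prod>(R w))"
    define T where "T = {t \<in> {0..<a}. \<forall>p\<in>R w. \<not> [t = s p] (mod int p)}"
    have R_sub: "R w \<subseteq> P \<union> Q" using w by (auto simp: Q_def)
    define b' where "b' = int (\<Prod>(P \<union> Q - R w))"
    have "q' = a * b'"
      unfolding q'_def a_def b'_def of_nat_mult[symmetric] using R_sub P(1) finQ prod.subset_diff[of "R w" "P \<union> Q" "\<lambda>x. x"] by (simp add: mult.commute)
    moreover have a0: "a > 0" unfolding a_def using R(2)[OF w] prime_gt_0_nat by (auto intro!: prod_pos)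
    ultimately have b0: "b' > 0" using q'0 by (simp add: zero_less_mult_iff)
    have "[t mod a = t] (mod int p)" if "p \<in> R w" for t p
    proof -
      have "int p dvd a" unfolding a_def using that R(1)[OF w] by (intro dvd_prod_set)
      then show ?thesis by (simp add: unique_euclidean_semiring_class.cong_def mod_mod_cancel)
    qed
    then have mod_a: "\<not> [t = s p] (mod int p) \<longleftrightarrow> \<not> [t mod a = s p] (mod int p)" if "p \<in> R w" for t p
      using that cong_sym cong_trans by blast
    have "Z w = {t \<in> {0..<a * b'}. t mod a \<in> T}"
      unfolding Z_def \<open>q' = a * b'\<close>
    proof (rule Collect_cong, rule conj_cong[OF refl])
      fix t
      have "t mod a \<in> {0..<a}" using a0 by simp
      moreover have "(\<forall>p\<in>R w. \<not> [t = s p] (mod int p)) \<longleftrightarrow> (\<forall>p\<in>R w. \<not> [t mod a = s p] (mod int p))"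
        using mod_a by blast
      ultimately show "(\<forall>p\<in>R w. \<not> [t = s p] (mod int p)) \<longleftrightarrow> t mod a \<in> T" unfolding T_def by blast
    qed
    moreover have "T \<subseteq> {0..<a}" unfolding T_def by blast
    ultimately have "card (Z w) = nat b' * card T" by (simp only: card_mod_preimage[OF a0 b0])
    then have cZ: "real (card (Z w)) = real (nat b') * real (card T)" by simp
    have "real (card T) \<le> real (\<Prod>(R w)) * (\<Prod>p\<in>R w. 1 - 1 / real p)"
      unfolding T_def a_def using R(1,2)[OF w] by (intro card_avoiding) auto
    also have "\<dots> \<le> real (\<Prod>(R w)) * (\<delta> / real (card W))"
      by (rule mult_left_mono[OF less_imp_le[OF R(3)[OF w]] of_nat_0_le_iff])
    finally have "real (card (Z w)) \<le> real (nat b') * (real (\<Prod>(R w)) * (\<delta> / real (card W)))"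
      unfolding cZ by (rule mult_left_mono) simp
    also have "\<dots> = \<delta> / real (card W) * (real_of_int a * real_of_int b')"
      using b0 by (simp add: a_def)
    finally show ?thesis unfolding \<open>q' = a * b'\<close> by simp
  qed
  have card_Bad': "real (card Bad') \<le> real (Suc J) * \<delta> * real (\<Prod>(P \<union> Q))"
  proof -
    have q'r: "real (\<Prod>(P \<union> Q)) = real_of_int q'" by (simp add: q'_def)
    have "card {t \<in> {0..<q'}. t mod q \<in> Bad} = nat (int (\<Prod>Q)) * card Bad"
      unfolding q'_eq by (rule card_mod_preimage[OF q0 Qpos Bad(1)])
    then have "real (card {t \<in> {0..<q'}. t mod q \<in> Bad}) = real (\<Prod>Q) * real (card Bad)"
      by (simp only: nat_int of_nat_mult)
    also have "\<dots> \<le> real (\<Prod>Q) * (real J * \<delta> * real (\<Prod>P))" by (rule mult_left_mono[OF Bad(2) of_nat_0_le_iff])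
    also have "\<dots> = real J * \<delta> * q'" by (simp add: q'_eq q_def)
    finally have 1: "real (card {t \<in> {0..<q'}. t mod q \<in> Bad}) \<le> real J * \<delta> * q'" .
    have "real (card (\<Union>w\<in>W. Z w)) \<le> (\<Sum>w\<in>W. real (card (Z w)))"
      unfolding of_nat_sum[symmetric] of_nat_le_iff by (rule card_UN_le[OF finW])
    also have "\<dots> \<le> (\<Sum>w\<in>W. \<delta> / real (card W) * q')" by (rule sum_mono) (rule cardZ)
    also have "\<dots> = \<delta> * q'" using cW by simp
    finally have 2: "real (card (\<Union>w\<in>W. Z w)) \<le> \<delta> * q'" .
    have "real (card Bad') \<le> real (card {t \<in> {0..<q'}. t mod q \<in> Bad}) + real (card (\<Union>w\<in>W. Z w))"
      unfolding Bad'_def of_nat_add[symmetric] of_nat_le_iff by (rule card_Un_le)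
    then show ?thesis using 1 2 unfolding q'r by (simp add: algebra_simps)
  qed
  have X'_diff: "[X' d p True - X' d p False = d] (mod int p)" if "p \<in> P \<union> Q" for d p
  proof (cases "p \<in> P")
    case True then show ?thesis using XP by (simp add: X'_def)
  next
    case False
    then have "[X' d p True - X' d p False = d mod int p] (mod int p)" using f(2)[of p d] that by (simp add: X'_def)
    then show ?thesis by (simp add: unique_euclidean_semiring_class.cong_def)
  qed
  have X'_mod: "X' d p = X' d' p" if dd: "d mod q' = d' mod q'" and p: "p \<in> P \<union> Q" for d d' p
  proof -
    have q: "d mod q = d' mod q" using dd modq by metis
    show ?thesis
    proof (cases "p \<in> P")
      case True then show ?thesis using Xq[OF q] by (simp add: X'_def)
    next
      case False
      have "d mod int p = d' mod int p" using dvd_q'[OF p] dd mod_mod_cancel by metis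
      then show ?thesis using False q by (simp add: X'_def f_def)
    qed
  qed
  have final: "t mod q' \<in> Bad' \<or> Suc J < card ((\<lambda>i. d i mod q') ` {1..2 * l + k})"
    if t: "\<And>p. p \<in> P \<union> Q \<Longrightarrow> [t = form l k (\<lambda>i. X' (d i) p (r i))] (mod int p)" for d r t
  proof (rule ccontr)
    assume a: "\<not> ?thesis"
    define I where "I = {1..2 * l + k}"
    have tq: "t mod q' \<in> {0..<q'}" using q'0 by simp
    have "t mod q \<in> Bad \<or> J < card ((\<lambda>i. d i mod q) ` I)"
      unfolding I_def
    proof (rule main)
      show "[t = form l k (\<lambda>i. X (d i) p (r i))] (mod int p)" if "p \<in> P" for p using t[of p] that by (simp add: X'_def)
    qed
    moreover have "t mod q \<notin> Bad" using a tq modq by (auto simp: Bad'_def)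
    ultimately have big: "Suc J \<le> card ((\<lambda>i. d i mod q) ` I)" by simp
    have im: "(\<lambda>c. c mod q) ` (\<lambda>i. d i mod q') ` I = (\<lambda>i. d i mod q) ` I" by (simp add: image_image modq)
    have finI: "finite ((\<lambda>i. d i mod q') ` I)" by (simp add: I_def)
    \<comment> \<open>At least \<open>Suc J\<close> classes modulo \<open>q\<close> and at most
      \<open>Suc J\<close> modulo \<open>q'\<close> force equality, so reduction modulo
      \<open>q\<close> is injective on the classes that occur.\<close>
    have "card ((\<lambda>c. c mod q) ` (\<lambda>i. d i mod q') ` I) = card ((\<lambda>i. d i mod q') ` I)"
      unfolding im
    proof (rule antisym)
      show "card ((\<lambda>i. d i mod q) ` I) \<le> card ((\<lambda>i. d i mod q') ` I)"
        using card_image_le[OF finI, of "\<lambda>c. c mod q"] unfolding im .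
      have "card ((\<lambda>i. d i mod q') ` I) \<le> Suc J" using a unfolding I_def by linarith
      then show "card ((\<lambda>i. d i mod q') ` I) \<le> card ((\<lambda>i. d i mod q) ` I)" using big by (rule le_trans)
    qed
    then have inj: "inj_on (\<lambda>c. c mod q) ((\<lambda>i. d i mod q') ` I)" by (rule eq_card_imp_inj_on[OF finI])
    have same: "d i mod q' = d j mod q'" if ij: "i \<in> I" "j \<in> I" "d i mod q = d j mod q" for i j
      by (rule inj_onD[OF inj]) (use ij modq in auto)
    define w where "w = restrict (\<lambda>i. (d i mod q, r i)) I"
    have w: "w \<in> W" unfolding w_def W_def I_def using q0 by auto
    have "\<not> [t = s p] (mod int p)" if p: "p \<in> R w" for p
    proof
      assume ts: "[t = s p] (mod int p)"
      have pQ: "p \<in> Q" using p w by (auto simp: Q_def)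
      then have pP: "p \<notin> P" using PQ by blast
      have ex_h: "\<exists>h. h \<in> S p c \<and> (\<forall>i\<in>I. d i mod q = c \<longrightarrow> h = X' (d i) p)" for c
      proof (cases "\<exists>i\<in>I. d i mod q = c")
        case True
        then obtain i where i: "i \<in> I" "d i mod q = c" by blast
        have "X' (d i) p \<in> S p c" using f(1)[OF pQ, of "d i"] i pP by (simp add: X'_def)
        moreover have "X' (d i) p = X' (d j) p" if "j \<in> I" "d j mod q = c" for j
          using same[OF i(1) that(1)] i that pQ by (intro X'_mod) auto
        ultimately show ?thesis by blast
      next
        case False
        then show ?thesis using S[OF pQ, of c] unfolding cover_def by blast
      qed
      \<comment> \<open>Consistent because slots of one class modulo \<open>q\<close> carry the same
        pair modulo \<open>p\<close>; a class without a slot receives any member of its set.\<close>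
      define g where "g c = (SOME h. h \<in> S p c \<and> (\<forall>i\<in>I. d i mod q = c \<longrightarrow> h = X' (d i) p))" for c
      have "g c \<in> S p c \<and> (\<forall>i\<in>I. d i mod q = c \<longrightarrow> g c = X' (d i) p)" for c
        using someI_ex[OF ex_h[of c]] unfolding g_def .
      then have g: "g c \<in> S p c" "i \<in> I \<Longrightarrow> d i mod q = c \<Longrightarrow> g c = X' (d i) p" for c i by blast+
      have "form l k (\<lambda>i. val g (own p i)) = form l k (\<lambda>i. X' (d i) p (r i))"
        unfolding own[OF w p]
      proof (rule form_eq)
        fix i assume "i \<in> {1..2 * l + k}"
        then have i: "i \<in> I" by (simp add: I_def)
        then show "val g (w i) = X' (d i) p (r i)" using g(2)[OF i refl] by (simp add: w_def)
      qed
      moreover have "\<not> [form l k (\<lambda>i. val g (own p i)) = s p] (mod int p)" by (rule s[OF pQ]) (rule g)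
      moreover have "[t = form l k (\<lambda>i. X' (d i) p (r i))] (mod int p)" using t pQ by blast
      then have "[form l k (\<lambda>i. X' (d i) p (r i)) = s p] (mod int p)" using ts cong_sym cong_trans by blast
      ultimately show False by simp
    qed
    moreover have "[t mod q' = t] (mod int p)" if "p \<in> R w" for p
    proof -
      have "int p dvd q'" using that w by (intro dvd_q') (auto simp: Q_def)
      then show ?thesis by (simp add: unique_euclidean_semiring_class.cong_def mod_mod_cancel)
    qed
    ultimately have "\<not> [t mod q' = s p] (mod int p)" if "p \<in> R w" for p
      using that cong_trans[OF cong_sym, of "t mod q'" t "int p" "s p"] by blast
    then have "t mod q' \<in> Z w" unfolding Z_def using tq by blast
    then show False using a w by (auto simp: Bad'_def)
  qed
  have "block_system l k M \<delta> (Suc J) (P \<union> Q) X' Bad'"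
    unfolding block_system_def q'_def[symmetric]
  proof (intro conjI allI ballI impI)
    show "Bad' \<subseteq> {0..<q'}" unfolding Bad'_def Z_def by blast
    show "finite (P \<union> Q)" "P \<union> Q \<noteq> {}" using P(1,2) finQ by auto
    show "prime p" "p > M" if "p \<in> P \<union> Q" for p using that P(3,4) primeQ by blast+
    show "[X' d p True - X' d p False = d] (mod int p)" if "p \<in> P \<union> Q" for d p by (rule X'_diff[OF that])
    show "X' d p = X' d' p" if "d mod q' = d' mod q'" "p \<in> P \<union> Q" for d d' p by (rule X'_mod[OF that])
    show "real (card Bad') \<le> real (Suc J) * \<delta> * real (\<Prod>(P \<union> Q))" by (rule card_Bad')
    show "t mod q' \<in> Bad' \<or> Suc J < card ((\<lambda>i. d i mod q') ` {1..2 * l + k})"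
      if "\<forall>p\<in>P \<union> Q. [t = form l k (\<lambda>i. X' (d i) p (r i))] (mod int p)" for d r t
      by (rule final[of t d r]) (use that in blast)
  qed
  then show ?thesis by blast
qed

lemma block_system_exists:
  assumes "l > 0" "l \<le> 3" "\<delta> > 0"
  shows "\<exists>P X Bad. block_system l k M \<delta> J P X Bad"
proof (induction J)
  case 0
  show ?case using block_system_base[OF assms(1)] by blast
next
  case (Suc J)
  then show ?case using block_system_step[OF assms(2,3)] by blast
qed

section \<open>Transfer to the residue ring\<close>

lemma chinese_remainder_primes:
  fixes u :: "nat \<Rightarrow> int"
  assumes "finite P" "\<And>p. p \<in> P \<Longrightarrow> prime p"
  shows "\<exists>a\<in>{0..<int (\<Prod>P)}. \<forall>p\<in>P. [a = u p] (mod int p)"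
proof -
  have pos: "p > 0" if "p \<in> P" for p using assms(2)[OF that] prime_gt_0_nat by blast
  have "\<exists>x. \<forall>p\<in>P. [x = nat (u p mod int p)] (mod p)"
    using assms by (intro chinese_remainder_nat) (auto intro: primes_coprime)
  then obtain x where x: "\<And>p. p \<in> P \<Longrightarrow> [x = nat (u p mod int p)] (mod p)" by blast
  have "[int x mod int (\<Prod>P) = u p] (mod int p)" if "p \<in> P" for p
  proof -
    have "[int x = int (nat (u p mod int p))] (mod int p)" using x[OF that] by (simp only: cong_int_iff)
    then have "[int x = u p] (mod int p)" using pos[OF that] by (simp add: unique_euclidean_semiring_class.cong_def)
    moreover have "int p dvd int (\<Prod>P)" using assms(1) that by (rule dvd_prod_set)
    ultimately show ?thesis by (simp add: unique_euclidean_semiring_class.cong_def mod_mod_cancel)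
  qed
  moreover have "int (\<Prod>P) > 0" using pos by (auto intro!: prod_pos)
  ultimately show ?thesis by (intro bexI[of _ "int x mod int (\<Prod>P)"]) auto
qed

lemma cong_prod_primes:
  fixes a b :: int
  assumes "finite P" "\<And>p. p \<in> P \<Longrightarrow> prime p" "\<And>p. p \<in> P \<Longrightarrow> [a = b] (mod int p)"
  shows "[a = b] (mod int (\<Prod>P))"
proof -
  have "[a = b] (mod (\<Prod>p\<in>P. int p))"
    by (rule cong_cong_prod_coprime) (use assms in \<open>auto intro: primes_coprime\<close>)
  then show ?thesis by simp
qed

lemma quad_lin_sumset_residue_ring:
  assumes q: "q > 1" and A: "A \<subseteq> carrier (residue_ring q)" and t: "t \<in> quad_lin_sumset (residue_ring q) l k A"
  obtains y where "\<And>i. i \<in> {1..2 * l + k} \<Longrightarrow> y i \<in> A" "t = form l k y mod q"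
proof -
  interpret residues q "residue_ring q" by unfold_locales (use q in auto)
  obtain a a' where aa: "a \<in> {1..2 * l} \<rightarrow> A" "a' \<in> {1..k} \<rightarrow> A"
    and t: "t = (\<Oplus>\<^bsub>residue_ring q\<^esub>i\<in>{1..l}. a (2 * i - 1) \<otimes>\<^bsub>residue_ring q\<^esub> a (2 * i)) \<oplus>\<^bsub>residue_ring q\<^esub> (\<Oplus>\<^bsub>residue_ring q\<^esub>j\<in>{1..k}. a' j)"
    using t unfolding quad_lin_sumset_def by blast
  define y where "y i = (if i \<le> 2 * l then a i else a' (i - 2 * l))" for i
  have yA: "y i \<in> A" if "i \<in> {1..2 * l + k}" for i
  proof (cases "i \<le> 2 * l")
    case True then show ?thesis using aa(1) that by (auto simp: y_def)
  next
    case False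
    then have "i - 2 * l \<in> {1..k}" using that by auto
    then show ?thesis using aa(2) False by (auto simp: y_def)
  qed
  have "(\<Oplus>\<^bsub>residue_ring q\<^esub>i\<in>{1..l}. a (2 * i - 1) \<otimes>\<^bsub>residue_ring q\<^esub> a (2 * i)) = (\<Sum>i\<in>{1..l}. a (2 * i - 1) * a (2 * i)) mod q"
    unfolding res_mult_eq by (rule sum_cong) simp
  also have "(\<Sum>i\<in>{1..l}. a (2 * i - 1) * a (2 * i)) = (\<Sum>i\<in>{1..l}. y (2 * i - 1) * y (2 * i))"
  proof (rule sum.cong[OF refl])
    fix i assume "i \<in> {1..l}"
    then have "2 * i - 1 \<le> 2 * l" "2 * i \<le> 2 * l" by auto
    then show "a (2 * i - 1) * a (2 * i) = y (2 * i - 1) * y (2 * i)" by (simp only: y_def if_True)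
  qed
  finally have 1: "(\<Oplus>\<^bsub>residue_ring q\<^esub>i\<in>{1..l}. a (2 * i - 1) \<otimes>\<^bsub>residue_ring q\<^esub> a (2 * i)) = (\<Sum>i\<in>{1..l}. y (2 * i - 1) * y (2 * i)) mod q" .
  have inA: "a' j \<in> carrier (residue_ring q)" if "j \<in> {1..k}" for j using aa(2) A that by blast
  have "(\<Oplus>\<^bsub>residue_ring q\<^esub>j\<in>{1..k}. a' j) = (\<Oplus>\<^bsub>residue_ring q\<^esub>j\<in>{1..k}. a' j mod q)"
  proof (rule add.finprod_cong'[OF refl])
    show "a' j = a' j mod q" if "j \<in> {1..k}" for j using inA[OF that] by (simp add: res_carrier_eq)
  qed simp
  also have "\<dots> = (\<Sum>j\<in>{1..k}. a' j) mod q" by (rule sum_cong) simp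
  also have "(\<Sum>j\<in>{1..k}. a' j) = (\<Sum>j\<in>{1..k}. y (2 * l + j))" by (rule sum.cong[OF refl]) (simp add: y_def)
  finally have 2: "(\<Oplus>\<^bsub>residue_ring q\<^esub>j\<in>{1..k}. a' j) = (\<Sum>j\<in>{1..k}. y (2 * l + j)) mod q" .
  have "t = form l k y mod q" unfolding t 1 2 by (simp add: form_def add_cong)
  then show thesis using that yA by blast
qed

theorem theorem5:
  fixes l k M :: nat and \<epsilon> :: real
  assumes "l \<in> {1, 2, 3}" and "\<epsilon> > 0"
  shows "\<exists>(q :: nat) (A :: int set).
    q > 1 \<and>
    (\<exists>P :: nat set. finite P \<and> (\<forall>p\<in>P. prime p) \<and> q = \<Prod>P) \<and>
    (\<forall>p. prime p \<and> p dvd q \<longrightarrow> p > M) \<and>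
    A \<subseteq> carrier (residue_ring (int q)) \<and>
    difference_set (residue_ring (int q)) A = carrier (residue_ring (int q)) \<and>
    real (card (quad_lin_sumset (residue_ring (int q)) l k A)) < \<epsilon> * real q"
proof -
  define n where "n = 2 * l + k"
  \<comment> \<open>\<open>n\<close> is the number of slots, so after \<open>n\<close> blocks no
    tuple can have more than \<open>n\<close> classes and every value is in \<open>Bad\<close>. Each
    block contributes density \<open>\<delta>\<close>, together \<open>\<epsilon> / 2\<close>, which
    leaves room for the strict inequality.\<close>
  define \<delta> where "\<delta> = \<epsilon> / (2 * real n)"
  have l: "l > 0" "l \<le> 3" using assms(1) by auto
  have n: "n > 0" using l by (simp add: n_def)
  have "\<delta> > 0" using assms(2) n by (simp add: \<delta>_def)
  then obtain P X Bad where sys: "block_system l k M \<delta> n P X Bad" using block_system_exists[OF l] by blast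
  define q where "q = \<Prod>P"
  have P: "finite P" "P \<noteq> {}" "\<And>p. p \<in> P \<Longrightarrow> prime p" "\<And>p. p \<in> P \<Longrightarrow> p > M"
    and XP: "\<And>d p. p \<in> P \<Longrightarrow> [X d p True - X d p False = d] (mod int p)"
    and Bad: "Bad \<subseteq> {0..<int q}" "real (card Bad) \<le> real n * \<delta> * real q"
    and main: "\<And>d r t. (\<And>p. p \<in> P \<Longrightarrow> [t = form l k (\<lambda>i. X (d i) p (r i))] (mod int p)) \<Longrightarrow>
       t mod int q \<in> Bad \<or> n < card ((\<lambda>i. d i mod int q) ` {1..2 * l + k})"
    using sys unfolding block_system_def q_def by blast+
  have q1: "q > 1"
  proof -
    obtain p where p: "p \<in> P" using P by blast
    have "p dvd q" unfolding q_def using P(1) p by (rule dvd_prod_set)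
    moreover have "q > 0" unfolding q_def using P prime_gt_0_nat by (auto intro!: prod_pos)
    ultimately have "p \<le> q" by (rule dvd_imp_le)
    then show ?thesis using prime_gt_1_nat[OF P(3)[OF p]] by simp
  qed
  interpret residues "int q" "residue_ring (int q)" by unfold_locales (use q1 in auto)
  define A where "A = {a \<in> {0..<int q}. \<exists>d b. \<forall>p\<in>P. [a = X d p b] (mod int p)}"
  have AC: "A \<subseteq> carrier (residue_ring (int q))" by (auto simp: A_def res_carrier_eq)
  have diff: "difference_set (residue_ring (int q)) A = carrier (residue_ring (int q))"
  proof
    show "difference_set (residue_ring (int q)) A \<subseteq> carrier (residue_ring (int q))"
      using AC unfolding difference_set_def by blast
    show "carrier (residue_ring (int q)) \<subseteq> difference_set (residue_ring (int q)) A"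
    proof
      fix d assume d: "d \<in> carrier (residue_ring (int q))"
      obtain a where a: "a \<in> {0..<int q}" "\<And>p. p \<in> P \<Longrightarrow> [a = X d p True] (mod int p)"
        using chinese_remainder_primes[OF P(1,3), of "\<lambda>p. X d p True"] unfolding q_def by blast
      obtain b where b: "b \<in> {0..<int q}" "\<And>p. p \<in> P \<Longrightarrow> [b = X d p False] (mod int p)"
        using chinese_remainder_primes[OF P(1,3), of "\<lambda>p. X d p False"] unfolding q_def by blast
      have ab: "a \<in> A" "b \<in> A" using a b unfolding A_def by blast+
      have "[a - b = d] (mod int q)"
        unfolding q_def
      proof (rule cong_prod_primes[OF P(1,3)])
        fix p assume p: "p \<in> P"
        show "[a - b = d] (mod int p)" by (rule cong_trans[OF cong_diff[OF a(2) b(2)] XP]) (rule p)+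
      qed
      then have "(a - b) mod int q = d" using d by (simp add: unique_euclidean_semiring_class.cong_def res_carrier_eq)
      then have "a \<ominus>\<^bsub>residue_ring (int q)\<^esub> b = d" by (simp add: a_minus_def res_neg_eq res_add_eq mod_simps)
      then show "d \<in> difference_set (residue_ring (int q)) A" using ab unfolding difference_set_def by blast
    qed
  qed
  have "quad_lin_sumset (residue_ring (int q)) l k A \<subseteq> Bad"
  proof
    fix t assume "t \<in> quad_lin_sumset (residue_ring (int q)) l k A"
    then obtain y where y: "\<And>i. i \<in> {1..2 * l + k} \<Longrightarrow> y i \<in> A" "t = form l k y mod int q"
      using quad_lin_sumset_residue_ring[OF m_gt_one AC] by metis
    have "\<forall>i. \<exists>d b. i \<in> {1..2 * l + k} \<longrightarrow> (\<forall>p\<in>P. [y i = X d p b] (mod int p))"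
      using y(1) unfolding A_def by blast
    from choice[OF this] obtain d where "\<forall>i. \<exists>b. i \<in> {1..2 * l + k} \<longrightarrow> (\<forall>p\<in>P. [y i = X (d i) p b] (mod int p))" by (elim exE)
    from choice[OF this] obtain r where "\<forall>i. i \<in> {1..2 * l + k} \<longrightarrow> (\<forall>p\<in>P. [y i = X (d i) p (r i)] (mod int p))" by (elim exE)
    then have dr: "[y i = X (d i) p (r i)] (mod int p)" if "i \<in> {1..2 * l + k}" "p \<in> P" for i p using that by blast
    have "form l k y mod int q \<in> Bad \<or> n < card ((\<lambda>i. d i mod int q) ` {1..2 * l + k})"
      by (rule main[of _ d r], rule form_cong) (rule dr)
    moreover have "card ((\<lambda>i. d i mod int q) ` {1..2 * l + k}) \<le> n"
      using card_image_le[of "{1..2 * l + k}" "\<lambda>i. d i mod int q"] by (simp add: n_def)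
    ultimately show "t \<in> Bad" unfolding y(2) by (simp add: not_less[symmetric])
  qed
  then have "card (quad_lin_sumset (residue_ring (int q)) l k A) \<le> card Bad"
    using Bad(1) finite_subset by (intro card_mono) blast+
  then have "real (card (quad_lin_sumset (residue_ring (int q)) l k A)) \<le> real n * \<delta> * real q"
    using Bad(2) by linarith
  also have "\<dots> = \<epsilon> / 2 * real q" using n by (simp add: \<delta>_def)
  also have "\<dots> < \<epsilon> * real q" using assms(2) q1 by simp
  finally have "real (card (quad_lin_sumset (residue_ring (int q)) l k A)) < \<epsilon> * real q" .
  moreover have "p > M" if p: "prime p" "p dvd q" for p
  proof -
    obtain p' where "p' \<in> P" "p dvd p'" using p P(1) by (auto simp: q_def prime_dvd_prod_iff)
    then show ?thesis using P(3,4) p(1) primes_dvd_imp_eq by blast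
  qed
  ultimately show ?thesis using q1 P(1,3) AC diff q_def by blast
qed

end
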